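(* Let $U\subsetneq\mathbb{C}$ be a simply connected domain containing the origin, and let $\mu_U$ be the distribution of $\Re(Z_{\tau_U})$, where $(Z_t)_{t\ge 0}$ is a standard planar Brownian motion started at $0$ and $\tau_U$ is its exit time from $U$. Assume that $\mu_U$ is non-degenerate, has mean zero and has a finite $p$-th moment for some $p>1$, and let $G$ be the Gross domain generated by $\mu_U$. Then the Skorokhod energy of $G$ is at most that of $U$: $$\Lambda(G)\le \Lambda(U).$$
   Context: $\mathbb{D}$ is the open unit disc. "Univalent" means analytic and injective. Skorokhod energy. For a simply connected domain $U\subsetneq\mathbb{C}$ containing $0$, let $f(z)=\sum_{n\ge 1}c_n z^n$ be any univalent function mapping $\mathbb{D}$ onto $U$ with $f(0)=0$. The Skorokhod energy of $U$ is $$\Lambda(U)=\mathfrak{E}(\Re f(e^{ti}))=\frac14\sum_{n=1}^{\infty}n^2|c_n|^2\in[0,+\infty],$$ which does not depend on the choice of $f$. Here, for a real $2\pi$-periodic function $h$, $\mathfrak{E}(h)=\frac12\cdot\frac1{2\pi}\int_0^{2\pi}|h'(t)|^2dt$ with $h'$ the distributional derivative (and $\mathfrak{E}(h)=+\infty$ if $h'\notin L^2$). The coefficient formula is taken as the meaning of $\Lambda(U)$ in all cases. Gross domain. Let $\mu$ be a non-degenerate probability distribution on $\mathbb{R}$ with mean zero and finite $p$-th moment for some $p>1$. Let $F(x)=\mu((-\infty,x])$ be its c.d.f. and $Q(u)=\inf\{x: F(x)\ge u\}$, $u\in(0,1)$, its quantile function. The even function $\theta\in(-\pi,\pi)\mapsto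 Q(|\theta|/\pi)$ has Fourier series $\sum_{n\ge1}a_n\cos(n\theta)$ (the constant term vanishes because $\mu$ is centered), where $a_n=\frac1\pi\int_{-\pi}^{\pi}Q(|\theta|/\pi)\cos(n\theta)\,d\theta$. The function $\Psi(z)=\sum_{n\ge1}a_nz^n$ is univalent on $\mathbb{D}$ (known theorem of Gross), and the Gross domain generated by $\mu$ is $G=\Psi(\mathbb{D})$. *)

theory Defs
  imports "HOL-Probability.Probability" "HOL-Complex_Analysis.Complex_Analysis"
begin

section \<open>Planar Brownian motion and its exit distribution\<close>

locale standard_brownian_motion = prob_space M
  for M :: "'a measure" and B :: "real \<Rightarrow> 'a \<Rightarrow> real" +
  assumes measurable_at: "t \<ge> 0 \<Longrightarrow> B t \<in> borel_measurable M"
    and starts_at_0: "AE \<omega> in M. B 0 \<omega> = 0"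
    and continuous_paths: "\<omega> \<in> space M \<Longrightarrow> continuous_on {0..} (\<lambda>t. B t \<omega>)"
    and gaussian_increments: "0 \<le> s \<Longrightarrow> s < t \<Longrightarrow>
      distributed M lborel (\<lambda>\<omega>. B t \<omega> - B s \<omega>) (normal_density 0 (sqrt (t - s)))"
    and independent_increments: "0 \<le> ts 0 \<Longrightarrow> (\<And>i. i < n \<Longrightarrow> ts i < ts (Suc i)) \<Longrightarrow>
      indep_vars (\<lambda>_. borel) (\<lambda>i \<omega>. B (ts (Suc i)) \<omega> - B (ts i) \<omega>) {..<n::nat}"

text \<open>
  The time parameter ranges over the reals, but only nonnegative times are constrained or used.
  Path continuity is required for every sample point, so that the exit position below is
  measurable without assuming completeness of the probability space.
\<close>

locale planar_brownian_motion = prob_space M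
  for M :: "'a measure" and Z :: "real \<Rightarrow> 'a \<Rightarrow> complex" +
  assumes Re_brownian: "standard_brownian_motion M (\<lambda>t \<omega>. Re (Z t \<omega>))"
    and Im_brownian: "standard_brownian_motion M (\<lambda>t \<omega>. Im (Z t \<omega>))"
    and Re_Im_independent:
      "indep_var (Pi\<^sub>M {0..} (\<lambda>_. borel)) (\<lambda>\<omega>. \<lambda>t\<in>{0..}. Re (Z t \<omega>))
                 (Pi\<^sub>M {0..} (\<lambda>_. borel)) (\<lambda>\<omega>. \<lambda>t\<in>{0..}. Im (Z t \<omega>))"

definition exit_time :: "(real \<Rightarrow> 'a \<Rightarrow> complex) \<Rightarrow> complex set \<Rightarrow> 'a \<Rightarrow> ennreal" where
  "exit_time Z U \<omega> = (INF t \<in> {t. 0 \<le> t \<and> Z t \<omega> \<notin> U}. ennreal t)"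

text \<open>
  A simply connected proper subdomain of the plane has a non-polar complement, so the exit time
  is almost surely finite; on the null event where it is infinite, \<open>enn2real\<close>
  evaluates the process at time 0.
\<close>

definition exit_Re_distr ::
    "'a measure \<Rightarrow> (real \<Rightarrow> 'a \<Rightarrow> complex) \<Rightarrow> complex set \<Rightarrow> real measure" where
  "exit_Re_distr M Z U = distr M borel (\<lambda>\<omega>. Re (Z (enn2real (exit_time Z U \<omega>)) \<omega>))"


section \<open>Skorokhod energy\<close>

definition univalent_onto :: "(complex \<Rightarrow> complex) \<Rightarrow> complex set \<Rightarrow> bool" where
  "univalent_onto f U \<longleftrightarrow>
     f holomorphic_on ball 0 1 \<and> inj_on f (ball 0 1) \<and> f ` ball 0 1 = U \<and> f 0 = 0"

definition taylor_coeff :: "(complex \<Rightarrow> complex) \<Rightarrow> nat \<Rightarrow> complex" where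
  "taylor_coeff f n = (deriv ^^ n) f 0 / fact n"

definition coeff_energy :: "(complex \<Rightarrow> complex) \<Rightarrow> ennreal" where
  "coeff_energy f = (\<Sum>n. ennreal ((real n)\<^sup>2 * (cmod (taylor_coeff f n))\<^sup>2)) / 4"

definition skorokhod_energy :: "complex set \<Rightarrow> ennreal" where
  "skorokhod_energy U = coeff_energy (SOME f. univalent_onto f U)"

text \<open>The energy does not depend on the chosen map, since any two differ by a rotation.\<close>

lemma univalent_onto_rotation:
  assumes f: "univalent_onto f U" and g: "univalent_onto g U"
  obtains \<alpha> where "cmod \<alpha> = 1" "\<And>z. cmod z < 1 \<Longrightarrow> f z = g (\<alpha> * z)"
proof -
  have fh: "f holomorphic_on ball 0 1" and fi: "inj_on f (ball 0 1)"
    and fU: "f ` ball 0 1 = U" and f0: "f 0 = 0"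
    and gh: "g holomorphic_on ball 0 1" and gi: "inj_on g (ball 0 1)"
    and gU: "g ` ball 0 1 = U" and g0: "g 0 = 0"
    using f g by (auto simp: univalent_onto_def)
  obtain f' where f'h: "f' holomorphic_on U" and f': "\<And>z. z \<in> ball 0 1 \<Longrightarrow> f' (f z) = z"
    using holomorphic_has_inverse[OF fh open_ball fi] fU by metis
  obtain g' where g'h: "g' holomorphic_on U" and g': "\<And>z. z \<in> ball 0 1 \<Longrightarrow> g' (g z) = z"
    using holomorphic_has_inverse[OF gh open_ball gi] gU by metis
  have f'U: "f' w \<in> ball 0 1 \<and> f (f' w) = w" if "w \<in> U" for w
    using that fU f' by (metis imageE)
  have g'U: "g' w \<in> ball 0 1 \<and> g (g' w) = w" if "w \<in> U" for w
    using that gU g' by (metis imageE)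
  define h where "h = g' \<circ> f"
  define k where "k = f' \<circ> g"
  have hh: "h holomorphic_on ball 0 1" unfolding h_def
    using fh g'h fU by (auto intro!: holomorphic_on_compose)
  have kh: "k holomorphic_on ball 0 1" unfolding k_def
    using gh f'h gU by (auto intro!: holomorphic_on_compose)
  have fin: "f z \<in> U" and gin: "g z \<in> U" if "cmod z < 1" for z
    using that fU gU by auto
  have h1: "cmod (h z) < 1" and k1: "cmod (k z) < 1" if "cmod z < 1" for z
    using g'U[OF fin[OF that]] f'U[OF gin[OF that]] by (auto simp: h_def k_def)
  have h0: "h 0 = 0" and k0: "k 0 = 0"
    using f'[of 0] g'[of 0] f0 g0 by (auto simp: h_def k_def)
  have kh_id: "k (h z) = z" if "cmod z < 1" for z
    using g'U[OF fin[OF that]] f'[of z] that by (auto simp: h_def k_def)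
  have eq: "cmod (h z) = cmod z" if "cmod z < 1" for z
    using Schwarz_Lemma(1)[OF hh h0 h1 that] Schwarz_Lemma(1)[OF kh k0 k1 h1[OF that]] kh_id[OF that]
    by auto
  have "\<exists>z. cmod z < 1 \<and> z \<noteq> 0 \<and> cmod (h z) = cmod z"
    using eq[of "1/2"] by (intro exI[of _ "1/2"]) simp
  then obtain \<alpha> where \<alpha>: "\<And>z. cmod z < 1 \<Longrightarrow> h z = \<alpha> * z" "cmod \<alpha> = 1"
    using Schwarz_Lemma(3)[OF hh h0 h1, of 0] by auto
  have "f z = g (\<alpha> * z)" if "cmod z < 1" for z
    using g'U[OF fin[OF that]] \<alpha>(1)[OF that] by (simp add: h_def)
  with \<alpha>(2) show ?thesis by (rule that)
qed

lemma coeff_energy_unique: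
  assumes f: "univalent_onto f U" and g: "univalent_onto g U"
  shows "coeff_energy f = coeff_energy g"
proof -
  obtain \<alpha> where \<alpha>: "cmod \<alpha> = 1" "\<And>z. cmod z < 1 \<Longrightarrow> f z = g (\<alpha> * z)"
    using univalent_onto_rotation[OF f g] by blast
  have gh: "g holomorphic_on ball 0 1" using g by (simp add: univalent_onto_def)
  have fh: "f holomorphic_on ball 0 1" using f by (simp add: univalent_onto_def)
  have gah: "(\<lambda>z. g (\<alpha> * z)) holomorphic_on ball 0 1"
    using fh by (rule holomorphic_transform) (simp add: \<alpha>(2))
  have "(deriv ^^ n) f 0 = \<alpha> ^ n * (deriv ^^ n) g 0" for n
  proof -
    have "(deriv ^^ n) f 0 = (deriv ^^ n) (\<lambda>z. g (\<alpha> * z)) 0"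
      by (rule higher_deriv_transform_within_open[OF fh gah open_ball]) (auto simp: \<alpha>(2))
    also have "\<dots> = \<alpha> ^ n * (deriv ^^ n) g (\<alpha> * 0)"
      by (rule higher_deriv_compose_linear[OF gh open_ball[of 0 1] open_ball])
         (auto simp: norm_mult \<alpha>(1))
    finally show ?thesis by simp
  qed
  then have "cmod (taylor_coeff f n) = cmod (taylor_coeff g n)" for n
    by (simp add: taylor_coeff_def norm_mult norm_divide norm_power \<alpha>(1))
  then show ?thesis by (simp add: coeff_energy_def)
qed

lemma skorokhod_energy_eq:
  assumes "univalent_onto f U"
  shows "skorokhod_energy U = coeff_energy f"
  unfolding skorokhod_energy_def
  by (rule coeff_energy_unique[OF someI[of "\<lambda>f. univalent_onto f U", OF assms] assms])

lemma univalent_onto_exists: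
  assumes "open U" "simply_connected U" "0 \<in> U" "U \<noteq> UNIV"
  shows "\<exists>f. univalent_onto f U"
proof -
  obtain f g where fg: "f holomorphic_on U" "g holomorphic_on ball 0 1"
      "\<forall>z\<in>U. f z \<in> ball 0 1 \<and> g (f z) = z" "\<forall>z\<in>ball 0 1. g z \<in> U \<and> f (g z) = z"
    using Riemann_mapping_theorem[of U] assms by blast
  have f0: "cmod (f 0) < 1" using fg(3) assms(3) by auto
  obtain m m' where m: "m (f 0) = 0" "m ` ball 0 1 \<subseteq> ball 0 1"
      and m': "m' holomorphic_on ball 0 1" "m' ` ball 0 1 \<subseteq> ball 0 1"
      and mm': "\<And>z. z \<in> ball 0 1 \<Longrightarrow> m (m' z) = z" "\<And>z. z \<in> ball 0 1 \<Longrightarrow> m' (m z) = z"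
    using f0 by (rule_tac ball_biholomorphism_exists[of "f 0"]) auto
  have "univalent_onto (g \<circ> m') U"
    unfolding univalent_onto_def
  proof (intro conjI)
    show "g \<circ> m' holomorphic_on ball 0 1"
      by (rule holomorphic_on_compose[OF m'(1) holomorphic_on_subset[OF fg(2) m'(2)]])
    show "inj_on (g \<circ> m') (ball 0 1)"
    proof (rule inj_on_inverseI)
      fix z :: complex assume z: "z \<in> ball 0 1"
      then have "f (g (m' z)) = m' z" using fg(4) m'(2) by blast
      then show "(m \<circ> f) ((g \<circ> m') z) = z" using mm'(1)[OF z] by simp
    qed
    show "(g \<circ> m') ` ball 0 1 = U"
    proof
      show "(g \<circ> m') ` ball 0 1 \<subseteq> U" using fg(4) m'(2) by force
      show "U \<subseteq> (g \<circ> m') ` ball 0 1"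
      proof
        fix w assume "w \<in> U"
        then have fw: "f w \<in> ball 0 1" "g (f w) = w" using fg(3) by blast+
        then have "w = (g \<circ> m') (m (f w))" using mm'(2) by simp
        moreover have "m (f w) \<in> ball 0 1" using m(2) fw by blast
        ultimately show "w \<in> (g \<circ> m') ` ball 0 1" by (rule image_eqI)
      qed
    qed
    have "m' 0 = f 0" using m(1) mm'(2)[of "f 0"] f0 by simp
    then show "(g \<circ> m') 0 = 0" using fg(3) assms(3) by simp
  qed
  then show ?thesis by blast
qed


section \<open>Gross domain\<close>

definition quantile :: "real measure \<Rightarrow> real \<Rightarrow> real" where
  "quantile \<mu> u = Inf {x. cdf \<mu> x \<ge> u}"

definition gross_coeff :: "real measure \<Rightarrow> nat \<Rightarrow> real" where
  "gross_coeff \<mu> n =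
     (LBINT \<theta>:{-pi<..<pi}. quantile \<mu> (\<bar>\<theta>\<bar> / pi) * cos (real n * \<theta>)) / pi"

definition gross_map :: "real measure \<Rightarrow> complex \<Rightarrow> complex" where
  "gross_map \<mu> z = (\<Sum>n. of_real (gross_coeff \<mu> (Suc n)) * z ^ Suc n)"

definition gross_domain :: "real measure \<Rightarrow> complex set" where
  "gross_domain \<mu> = gross_map \<mu> ` ball 0 1"

definition nondegenerate :: "real measure \<Rightarrow> bool" where
  "nondegenerate \<mu> \<longleftrightarrow> \<not> (\<exists>c. AE x in \<mu>. x = c)"

end

theory Submission
  imports Defs
begin

text \<open>
  If \<open>\<Lambda>(U)\<close> is finite, the Riemann map \<open>f\<close> of \<open>U\<close> has absolutely summable coefficients, hence extends
  continuously to the closed disc, and \<open>\<mu>\<^sub>U\<close> is the law of \<open>h(t) = Re f(e\<^sup>i\<^sup>t)\<close> for \<open>t\<close> uniform on the circle. Indeed,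
  for a polynomial \<open>P\<close> the function \<open>Re P(f\<^sup>-\<^sup>1(w))\<close> is harmonic on \<open>U\<close>, so its mean at the exit
  point is \<open>Re P(0)\<close>, and these functions approximate any continuous function of \<open>Re w\<close> near the boundary.
  The mean value identity is obtained from discretely sampled Brownian motion: one Gaussian step of variance \<open>d\<close>
  changes the mean of a harmonic function only by \<open>O(d powr (3/2))\<close>, and the number of steps is \<open>O(1/d)\<close> up to a slowly growing factor.

  The layer-cake formula gives \<open>n a\<^sub>n = -(2/pi) \<integral> sin(n pi F(x)) dx\<close>. Consequently
  \<open>Re((1 - z\<^sup>2) \<Psi>'(z)) < 0\<close>, which makes \<open>\<Psi>\<close> univalent, and \<open>\<Sum> n\<^sup>2 a\<^sub>n\<^sup>2 = -(2/pi) \<integral> S(pi F(x)) dx\<close>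
  with \<open>S(\<theta>) = \<Sum> n a\<^sub>n sin(n \<theta>)\<close>. Since \<open>h\<close> takes each of its intermediate values at least twice on the circle, the last integral is at
  most \<open>\<integral> \<bar>S(pi F(h(t)))\<bar> \<bar>h'(t)\<bar> dt / 2\<close>, and the uniform distribution of \<open>F(h)\<close> yields
  \<open>\<Sum> n\<^sup>2 a\<^sub>n\<^sup>2 \<le> \<Sum> n\<^sup>2 \<bar>c\<^sub>n\<bar>\<^sup>2\<close>. This is done for the partial sums of \<open>f\<close>, whose
  distribution functions are continuous, and then passed to the limit.
\<close>

section \<open>Fourier coefficients of the quantile function\<close>

text \<open>If the energy of U is infinite, the bound is trivial; otherwise the summable
  coefficients supply all boundary regularity that the proof uses. Two obstacles shape the
  probabilistic half. Derivatives of the harmonic test functions are controlled only on compact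
  subsets of U, and a sampled path can jump across the boundary. The walk is therefore frozen when
  it leaves the image of a smaller closed disc, the test function is set to zero off U, and limits
  are taken twice: in the mesh, then in the exhausting compact sets. In the analytic half, equality
  of square norms needs F(h) to be exactly uniform, so levels of positive measure must be excluded.
  A trigonometric polynomial whose first coefficient is nonzero has finite level sets, and uniformly
  close functions have uniformly close quantile functions, which brings each Fourier coefficient to
  the limit. The constant 1 in the inequality arises by absorption: the pairing of S with h' is
  bounded by half of each square norm, and the half belonging to S is half of the quantity being
  estimated.\<close>

lemma pair_integrable_bounded:
  fixes f :: "'a \<times> 'b \<Rightarrow> 'c::{banach, second_countable_topology}"
  assumes "finite_measure A" "finite_measure B" "f \<in> borel_measurable (A \<Otimes>\<^sub>M B)"
    "\<And>x. norm (f x) \<le> C"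
  shows "integrable (A \<Otimes>\<^sub>M B) f"
proof -
  interpret A: finite_measure A by fact
  interpret B: finite_measure B by fact
  interpret P: pair_sigma_finite A B by standard
  interpret F: finite_measure "A \<Otimes>\<^sub>M B" by (rule finite_measure_pair_measure[OF assms(2,1)])
  show ?thesis
    by (rule F.integrable_const_bound[where B=C]) (use assms in auto)
qed

lemma finite_measure_restrict_lborel_Icc:
  "finite_measure (restrict_space lborel {a..b::real})"
  by (rule finite_measureI) (simp add: emeasure_restrict_space space_restrict_space emeasure_lborel_Icc_eq)

lemma set_integrable_bounded_Icc:
  fixes f :: "real \<Rightarrow> 'a::{banach, second_countable_topology}"
  assumes "f \<in> borel_measurable borel" "\<And>x. norm (f x) \<le> B"
  shows "set_integrable lborel {a..b} f"
  unfolding set_integrable_def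
  by (rule integrableI_bounded_set_indicator[where B=B]) (use assms in \<open>auto simp: emeasure_lborel_Icc_eq\<close>)

lemma integral_cos_Icc:
  assumes "a \<le> b" "n > 0"
  shows "(LBINT t:{a..b}. cos (real n * t)) = (sin (real n * b) - sin (real n * a)) / real n"
proof -
  have "(LBINT t:{a..b}. cos (real n * t)) = sin (real n * b) / real n - sin (real n * a) / real n"
    unfolding set_lebesgue_integral_def
    by (rule integral_FTC_atLeastAtMost[OF assms(1)])
       (use assms in \<open>auto intro!: derivative_eq_intros continuous_intros
          simp: has_real_derivative_iff_has_vector_derivative[symmetric]\<close>)
  then show ?thesis by (simp add: diff_divide_distrib)
qed

text \<open>The two values say that all mass lies in \<open>(L, R]\<close>, with no atom at
  \<open>L\<close>. This keeps every integral over levels on a finite interval and confines the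
  quantile function to \<open>[L, R]\<close> for arguments in (0, 1).\<close>

locale bounded_real_distribution = cdf_distribution +
  fixes L R :: real
  assumes cdf_L: "cdf M L = 0" and cdf_R: "cdf M R = 1"
begin

lemma L_less_R: "L < R"
  using cdf_nondecreasing[of R L] cdf_L cdf_R by (cases "L < R") auto

lemma quantile_le_iff: "0 < u \<Longrightarrow> u < 1 \<Longrightarrow> quantile M u \<le> x \<longleftrightarrow> u \<le> cdf M x"
  using pseudoinverse[of u x] by (simp add: quantile_def)

lemma quantile_bounds: "0 < u \<Longrightarrow> u < 1 \<Longrightarrow> L \<le> quantile M u \<and> quantile M u \<le> R"
  using quantile_le_iff[of u L] quantile_le_iff[of u R] cdf_L cdf_R by auto

text \<open>F(x) < u holds exactly for x below the quantile Q(u), so the levels in question form an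
  interval of length Q(u) - L.\<close>

lemma quantile_layer_cake:
  assumes "0 < u" "u < 1"
  shows "quantile M u = L + (LINT x|restrict_space lborel {L..R}. of_bool (cdf M x < u))"
proof -
  have "(LINT x|restrict_space lborel {L..R}. of_bool (cdf M x < u) :: real)
     = (LINT x|lborel. indicator {L..<quantile M u} x)"
  proof -
    have "cdf M x < u \<longleftrightarrow> x < quantile M u" for x
      using quantile_le_iff[OF assms, of x] by (simp add: not_le[symmetric])
    then have "indicator {L..R} x *\<^sub>R of_bool (cdf M x < u) = (indicator {L..<quantile M u} x :: real)" for x
      using quantile_bounds[OF assms] by (simp add: indicator_def)
    then show ?thesis
      by (subst integral_restrict_space) simp_all
  qed
  also have "\<dots> = quantile M u - L"
    using quantile_bounds[OF assms] by simp
  finally show ?thesis by simp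
qed

lemma borel_measurable_quantile:
  "(\<lambda>u. indicator {0<..<1} u * quantile M u) \<in> borel_measurable borel"
proof -
  have "(\<lambda>u. if u \<in> {0<..<1} then quantile M u else 0) \<in> borel_measurable borel"
    using measurable_CI unfolding quantile_def
    by (subst (asm) measurable_restrict_space_iff[where c=0]) auto
  also have "(\<lambda>u. if u \<in> {0<..<1} then quantile M u else 0) = (\<lambda>u. indicator {0<..<1} u * quantile M u)"
    by (auto simp: fun_eq_iff)
  finally show ?thesis .
qed

text \<open>Inserting the layer-cake formula and exchanging the integrals leaves, for each level x,
  the integral of cos(n t) over pi F(x) < |t| <= pi. The constant \<open>L\<close> drops out because
  the cosine has mean zero over a period.\<close>

lemma gross_coeff_eq:
  assumes n: "n > 0"
  shows "gross_coeff M n = - (2 / (pi * real n)) * (LBINT x:{L..R}. sin (real n * pi * cdf M x))"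
proof -
  define X where "X = restrict_space lborel {L..R}"
  define T where "T = restrict_space lborel {-pi..pi}"
  interpret X: finite_measure X unfolding X_def by (rule finite_measure_restrict_lborel_Icc)
  interpret T: finite_measure T unfolding T_def by (rule finite_measure_restrict_lborel_Icc)
  interpret P: pair_sigma_finite T X by standard
  have [measurable]: "cdf M \<in> borel_measurable X"
    unfolding X_def by (auto intro!: measurable_restrict_space1)
  have idT: "(\<lambda>x. x) \<in> borel_measurable T"
    unfolding T_def by (auto intro!: measurable_restrict_space1)
  have inner: "(LINT t|T. of_bool (cdf M x < \<bar>t\<bar> / pi) * cos (real n * t))
      = - (2 / real n) * sin (real n * pi * cdf M x)" for x
  proof -
    define c where "c = pi * cdf M x"
    have c: "0 \<le> c" "c \<le> pi"
      using cdf_nonneg[of x] cdf_bounded_prob[of x] by (auto simp: c_def mult_left_le)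
    \<comment> \<open>The region is written as [-pi, pi] minus [-c, c]; the integral over the whole
      period vanishes.\<close>
    have "(LINT t|T. of_bool (cdf M x < \<bar>t\<bar> / pi) * cos (real n * t))
       = (LINT t|lborel. indicator {-pi..pi} t *\<^sub>R cos (real n * t) - indicator {-c..c} t *\<^sub>R cos (real n * t))"
    proof -
      have "cdf M x < \<bar>t\<bar> / pi \<longleftrightarrow> c < \<bar>t\<bar>" for t
        by (simp add: c_def pos_less_divide_eq mult.commute)
      moreover have "indicator {-c..c} t = (if c < \<bar>t\<bar> then 0 else 1 :: real)" for t
        by (auto simp: indicator_def)
      moreover have "\<bar>t\<bar> \<le> c \<Longrightarrow> t \<in> {-pi..pi}" for t
        using c by auto
      ultimately have "indicator {-pi..pi} t *\<^sub>R (of_bool (cdf M x < \<bar>t\<bar> / pi) * cos (real n * t)) =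
          indicator {-pi..pi} t *\<^sub>R cos (real n * t) - indicator {-c..c} t *\<^sub>R cos (real n * t)" for t
        by (cases "c < \<bar>t\<bar>") (simp_all only: if_True if_False, simp_all)
      then have eq: "(\<lambda>t. indicator {-pi..pi} t *\<^sub>R (of_bool (cdf M x < \<bar>t\<bar> / pi) * cos (real n * t))) =
          (\<lambda>t. indicator {-pi..pi} t *\<^sub>R cos (real n * t) - indicator {-c..c} t *\<^sub>R cos (real n * t))"
        by (rule ext)
      show ?thesis
        unfolding T_def by (subst integral_restrict_space) (simp, simp only: eq)
    qed
    also have "\<dots> = (LBINT t:{-pi..pi}. cos (real n * t)) - (LBINT t:{-c..c}. cos (real n * t))"
      unfolding set_lebesgue_integral_def
      by (intro Bochner_Integration.integral_diff borel_integrable_compact compact_Icc continuous_intros)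
    also have "\<dots> = - (2 / real n) * sin (real n * c)"
      using c n by (simp add: integral_cos_Icc)
    finally show ?thesis by (simp add: c_def mult.assoc)
  qed
  have "pi * gross_coeff M n = (LINT t|lborel. indicator {-pi<..<pi} t *\<^sub>R (quantile M (\<bar>t\<bar>/pi) * cos (real n * t)))"
    by (simp add: gross_coeff_def set_lebesgue_integral_def)
  also have "\<dots> = (LINT t|lborel. indicator {-pi..pi} t *\<^sub>R
        ((L + (LINT x|X. of_bool (cdf M x < \<bar>t\<bar>/pi))) * cos (real n * t)))"
  proof (rule integral_cong_AE)
    \<comment> \<open>The layer-cake formula fails at t = 0, where the quantile has a default value,
      and the open and closed intervals differ at the ends.\<close>
    have "AE t in lborel. t \<noteq> 0 \<and> t \<noteq> pi \<and> t \<noteq> -pi" 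
      using AE_lborel_singleton[of 0] AE_lborel_singleton[of pi] AE_lborel_singleton[of "-pi"] by eventually_elim auto
    then show "AE t in lborel. indicator {-pi<..<pi} t *\<^sub>R (quantile M (\<bar>t\<bar>/pi) * cos (real n * t)) = 
        indicator {-pi..pi} t *\<^sub>R
        ((L + (LINT x|X. of_bool (cdf M x < \<bar>t\<bar>/pi))) * cos (real n * t))"
    proof eventually_elim
      case (elim t)
      show ?case
      proof (cases "-pi < t \<and> t < pi")
        case True
        then have "quantile M (\<bar>t\<bar>/pi) = L + (LINT x|X. of_bool (cdf M x < \<bar>t\<bar>/pi))"
          unfolding X_def using elim by (intro quantile_layer_cake) auto
        then show ?thesis using True by simp
      qed (use elim in \<open>auto simp: indicator_def\<close>)
    qed
    have Q: "(\<lambda>t. indicator {-pi<..<pi} t * quantile M (\<bar>t\<bar>/pi)) \<in> borel_measurable lborel"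
    proof -
      have "(\<lambda>t. indicator {0<..<1} (\<bar>t\<bar>/pi) * quantile M (\<bar>t\<bar>/pi)) \<in> borel_measurable borel"
        by (rule measurable_compose[OF _ borel_measurable_quantile]) simp
      \<comment> \<open>Measurability of the quantile function is available on (0, 1) only, so its
        value at 0 is added back as a function supported at one point.\<close>
      then have "(\<lambda>t. indicator {0<..<1} (\<bar>t\<bar>/pi) * quantile M (\<bar>t\<bar>/pi) + (if t = 0 then quantile M 0 else 0)) \<in> borel_measurable borel"
        by (rule borel_measurable_add) simp
      also have "(\<lambda>t. indicator {0<..<1} (\<bar>t\<bar>/pi) * quantile M (\<bar>t\<bar>/pi) + (if t = 0 then quantile M 0 else 0)) =
         (\<lambda>t. indicator {-pi<..<pi} t * quantile M (\<bar>t\<bar>/pi))"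
        by (auto simp: fun_eq_iff indicator_def abs_real_def)
      finally show ?thesis by simp
    qed
    show "(\<lambda>t. indicator {-pi<..<pi} t *\<^sub>R (quantile M (\<bar>t\<bar>/pi) * cos (real n * t))) \<in> borel_measurable lborel"
      unfolding real_scaleR_def mult.assoc[symmetric]
      by (rule borel_measurable_times[OF Q]) simp
    have m: "(\<lambda>(t,x). of_bool (cdf M x < \<bar>t\<bar>/pi) :: real) \<in> borel_measurable (lborel \<Otimes>\<^sub>M X)"
      by measurable
    show "(\<lambda>t. indicator {-pi..pi} t *\<^sub>R
        ((L + (LINT x|X. of_bool (cdf M x < \<bar>t\<bar>/pi))) * cos (real n * t))) \<in> borel_measurable lborel"
      using X.borel_measurable_lebesgue_integral[OF m] by measurable
  qed
  also have "\<dots> = (LINT t|T. (L + (LINT x|X. of_bool (cdf M x < \<bar>t\<bar>/pi))) * cos (real n * t))"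
    unfolding T_def by (subst integral_restrict_space) auto
  also have "\<dots> = (LINT t|T. L * cos (real n * t)) +
      (LINT t|T. (LINT x|X. of_bool (cdf M x < \<bar>t\<bar>/pi) * cos (real n * t)))"
  proof -
    note idT [measurable]
    have i: "integrable (T \<Otimes>\<^sub>M X) (\<lambda>(t,x). of_bool (cdf M x < \<bar>t\<bar>/pi) * cos (real n * t))"
      by (rule pair_integrable_bounded[where C=1]) (auto simp: T.finite_measure_axioms X.finite_measure_axioms)
    have j: "integrable T (\<lambda>t. L * cos (real n * t))"
      by (intro integrable_mult_right T.integrable_const_bound[where B=1]) auto
    show ?thesis
      using P.integrable_fst'[OF i] j
      by (subst Bochner_Integration.integral_add[symmetric]) (auto simp: distrib_right)
  qed
  also have "(LINT t|T. L * cos (real n * t)) = 0"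
    unfolding T_def using integral_cos_Icc[of "-pi" pi n] n
    by (subst integral_restrict_space) (auto simp: set_lebesgue_integral_def algebra_simps)
  also have "(LINT t|T. (LINT x|X. of_bool (cdf M x < \<bar>t\<bar>/pi) * cos (real n * t)))
     = (LINT x|X. (LINT t|T. of_bool (cdf M x < \<bar>t\<bar>/pi) * cos (real n * t)))"
  proof -
    note idT [measurable]
    show ?thesis
      by (rule P.Fubini_integral[symmetric], rule pair_integrable_bounded[where C=1])
         (auto simp: T.finite_measure_axioms X.finite_measure_axioms)
  qed
  also have "\<dots> = (LINT x|X. - (2 / real n) * sin (real n * pi * cdf M x))"
    by (simp only: inner)
  also have "\<dots> = - (2 / real n) * (LBINT x:{L..R}. sin (real n * pi * cdf M x))"
    unfolding X_def by (subst integral_restrict_space) (auto simp: set_lebesgue_integral_def mult.left_commute)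
  finally have "pi * gross_coeff M n = - (2 / real n) * (LBINT x:{L..R}. sin (real n * pi * cdf M x))"
    by (simp only: add_0)
  moreover have "g = - (2 / (pi * k)) * i" if "pi * g = - (2 / k) * i" for g k i :: real
  proof -
    have "g = (pi * g) / pi" by simp
    also have "\<dots> = - (2 / (pi * k)) * i" unfolding that by simp
    finally show ?thesis .
  qed
  ultimately show ?thesis by blast
qed

end

section \<open>Univalence of the Gross map\<close>

lemma Re_one_plus_div_one_minus_pos:
  fixes w :: complex
  assumes "cmod w < 1"
  shows "Re ((1 + w) / (1 - w)) > 0"
proof -
  have "w \<noteq> 1" using assms by auto
  then have "Re ((1 + w) / (1 - w)) = (1 - (cmod w)\<^sup>2) / (cmod (1 - w))\<^sup>2"
    unfolding Re_divide cmod_power2 by (simp add: algebra_simps power2_eq_square)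
  also have "\<dots> > 0"
    using assms \<open>w \<noteq> 1\<close> by (intro divide_pos_pos) (auto simp: power_less_one_iff)
  finally show ?thesis .
qed

text \<open>The generating function of sin((n + 1) t), with its denominator 1 - 2 z cos t + z^2 kept
  in factored form.\<close>

definition sin_kernel :: "complex \<Rightarrow> real \<Rightarrow> complex" where
  "sin_kernel z t = of_real (sin t) / ((1 - z * cis t) * (1 - z * cis (- t)))"

lemma sin_kernel_sums:
  assumes "cmod z < 1"
  shows "(\<lambda>n. of_real (sin (real (Suc n) * t)) * z ^ n) sums sin_kernel z t"
proof -
  have geo: "(\<lambda>n. cis s * (z * cis s) ^ n) sums (cis s * (1 / (1 - z * cis s)))" for s
    by (intro sums_mult geometric_sums) (use assms in \<open>simp add: norm_mult\<close>)
  have nz: "1 - z * cis s \<noteq> 0" for s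
    using assms by (metis eq_iff_diff_eq_0 less_irrefl mult.right_neutral norm_cis norm_mult norm_one)
  have "(\<lambda>n. (cis t * (z * cis t) ^ n - cis (-t) * (z * cis (-t)) ^ n) / (2 * \<i>)) sums
      ((cis t * (1 / (1 - z * cis t)) - cis (-t) * (1 / (1 - z * cis (-t)))) / (2 * \<i>))"
    by (intro sums_divide sums_diff geo)
  also have "(\<lambda>n. (cis t * (z * cis t) ^ n - cis (-t) * (z * cis (-t)) ^ n) / (2 * \<i>)) =
     (\<lambda>n. of_real (sin (real (Suc n) * t)) * z ^ n)"
  proof
    fix n
    have "cis s * (z * cis s) ^ n = z ^ n * cis (real (Suc n) * s)" for s
    proof -
      have "cis s * (z * cis s) ^ n = z ^ n * (cis s * cis (real n * s))"
        by (simp only: power_mult_distrib mult.left_commute[of "cis s"] Complex.DeMoivre)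
      then show ?thesis by (simp add: cis_mult distrib_right)
    qed
    then have "cis t * (z * cis t) ^ n - cis (-t) * (z * cis (-t)) ^ n =
        z ^ n * (cis (real (Suc n) * t) - cis (- (real (Suc n) * t)))"
      by (simp only: right_diff_distrib mult_minus_right)
    also have "cis (real (Suc n) * t) - cis (- (real (Suc n) * t)) = 2 * \<i> * of_real (sin (real (Suc n) * t))"
      by (simp add: complex_eq_iff)
    finally have *: "cis t * (z * cis t) ^ n - cis (-t) * (z * cis (-t)) ^ n =
        z ^ n * (2 * \<i> * of_real (sin (real (Suc n) * t)))" .
    have "x * (c * y) / c = y * x" if "c \<noteq> 0" for x y c :: complex
      using that by simp
    from this[of "2 * \<i>"] show "(cis t * (z * cis t) ^ n - cis (-t) * (z * cis (-t)) ^ n) / (2 * \<i>) =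
        of_real (sin (real (Suc n) * t)) * z ^ n"
      unfolding * by simp
  qed
  also have "(cis t * (1 / (1 - z * cis t)) - cis (-t) * (1 / (1 - z * cis (-t)))) / (2 * \<i>) = sin_kernel z t"
  proof -
    have "cis t * (1 / (1 - z * cis t)) - cis (-t) * (1 / (1 - z * cis (-t))) =
        (cis t * (1 - z * cis (-t)) - cis (-t) * (1 - z * cis t)) / ((1 - z * cis t) * (1 - z * cis (-t)))"
      using nz[of t] nz[of "-t"] by (simp add: divide_simps)
    also have "cis t * (1 - z * cis (-t)) - cis (-t) * (1 - z * cis t) = cis t - cis (-t)"
      by (simp add: algebra_simps)
    also have "\<dots> = 2 * \<i> * of_real (sin t)"
      by (simp add: complex_eq_iff)
    finally show ?thesis by (simp add: sin_kernel_def)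
  qed
  finally show ?thesis .
qed

text \<open>The factor 1 - z^2 turns the kernel into sin t times the mean of the half-plane map (1 +
  w) / (1 - w) at w = z e^(it) and w = z e^(-it). Both values have positive real part.\<close>

lemma Re_sin_kernel:
  assumes "cmod z < 1"
  obtains c where "c > 0" "Re ((1 - z\<^sup>2) * sin_kernel z t) = c * sin t"
proof -
  have nz: "1 - z * cis s \<noteq> 0" for s
    using assms by (metis eq_iff_diff_eq_0 less_irrefl mult.right_neutral norm_cis norm_mult norm_one)
  let ?w = "z * cis t" and ?v = "z * cis (-t)"
  have num: "(1 + ?w) * (1 - ?v) + (1 + ?v) * (1 - ?w) = 2 * (1 - z\<^sup>2)"
    by (simp add: algebra_simps power2_eq_square cis_mult)
  have "of_real (sin t) * (((1 + ?w) / (1 - ?w) + (1 + ?v) / (1 - ?v)) / 2) =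
      of_real (sin t) * ((((1 + ?w) * (1 - ?v) + (1 + ?v) * (1 - ?w)) / ((1 - ?w) * (1 - ?v))) / 2)"
    by (subst add_frac_eq[OF nz nz]) (rule refl)
  also have "\<dots> = (1 - z\<^sup>2) * sin_kernel z t"
    unfolding num sin_kernel_def by (simp del: distrib_left_numeral right_diff_distrib_numeral)
  finally have eq: "(1 - z\<^sup>2) * sin_kernel z t = of_real (sin t) * (((1 + ?w) / (1 - ?w) + (1 + ?v) / (1 - ?v)) / 2)"
    by (rule sym)
  show thesis
  proof (rule that)
    show "Re (((1 + ?w) / (1 - ?w) + (1 + ?v) / (1 - ?v)) / 2) > 0"
      using Re_one_plus_div_one_minus_pos[of ?w] Re_one_plus_div_one_minus_pos[of ?v] assms
      by (simp add: norm_mult)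
    show "Re ((1 - z\<^sup>2) * sin_kernel z t) = Re (((1 + ?w) / (1 - ?w) + (1 + ?v) / (1 - ?v)) / 2) * sin t"
      unfolding eq by simp
  qed
qed

text \<open>
  The map \<open>\<zeta> \<mapsto> tanh (\<zeta> / 2)\<close> carries the convex strip \<open>\<bar>Im \<zeta>\<bar> < pi / 2\<close> onto the disc and has derivative
  \<open>(1 - tanh\<^sup>2 (\<zeta> / 2)) / 2\<close>, so after composition the derivative has negative real part on a convex set.
\<close>

lemma inj_on_disc_of_Re_deriv_neg:
  fixes f f' :: "complex \<Rightarrow> complex"
  assumes der: "\<And>z. cmod z < 1 \<Longrightarrow> (f has_field_derivative f' z) (at z)"
    and neg: "\<And>z. cmod z < 1 \<Longrightarrow> Re ((1 - z\<^sup>2) * f' z) < 0"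
  shows "inj_on f (ball 0 1)"
proof (rule inj_onI, rule ccontr)
  fix z w :: complex
  assume zw: "z \<in> ball 0 1" "w \<in> ball 0 1" and eq: "f z = f w" and ne: "z \<noteq> w"
  \<comment> \<open>\<open>E\<close> is tanh(\<zeta> / 2), and \<open>l\<close> is a right inverse
    of it on the disc with values in the strip.\<close>
  define E where "E \<zeta> = (exp \<zeta> - 1) / (exp \<zeta> + 1)" for \<zeta> :: complex
  define l where "l z = Ln ((1 + z) / (1 - z))" for z :: complex
  have n1: "z \<noteq> 1" "z \<noteq> -1" if "cmod z < 1" for z :: complex using that by auto
  have El: "E (l z) = z" if "cmod z < 1" for z
  proof -
    have "(1 + z) / (1 - z) \<noteq> 0" using n1[OF that] by (simp add: add_eq_0_iff)
    then have "exp (l z) = (1 + z) / (1 - z)" by (simp add: l_def)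
    moreover have "(1 + z) / (1 - z) - 1 = 2 * z / (1 - z)" "(1 + z) / (1 - z) + 1 = 2 / (1 - z)"
      using n1[OF that] by (simp_all add: field_simps)
    ultimately show ?thesis using n1[OF that] by (simp add: E_def)
  qed
  have Iml: "\<bar>Im (l z)\<bar> < pi / 2" if "cmod z < 1" for z
  proof -
    have "(1 + z) / (1 - z) \<noteq> 0" using n1[OF that] by (simp add: add_eq_0_iff)
    then show ?thesis
      using Re_one_plus_div_one_minus_pos[OF that] Re_Ln_pos_lt unfolding l_def by blast
  qed
  have Re_exp: "Re (exp \<zeta>) > 0" if "\<bar>Im \<zeta>\<bar> < pi / 2" for \<zeta>
  proof -
    have "cos (Im \<zeta>) > 0" using that by (intro cos_gt_zero_pi) auto
    then show ?thesis by (simp add: Re_exp)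
  qed
  have nz: "exp \<zeta> + 1 \<noteq> 0" if "\<bar>Im \<zeta>\<bar> < pi / 2" for \<zeta>
  proof
    assume "exp \<zeta> + 1 = 0"
    then have "exp \<zeta> = -1" by (simp add: add_eq_0_iff2)
    then show False using Re_exp[OF that] by simp
  qed
  have E1: "cmod (E \<zeta>) < 1" if "\<bar>Im \<zeta>\<bar> < pi / 2" for \<zeta>
  proof -
    have "(cmod (exp \<zeta> - 1))\<^sup>2 < (cmod (exp \<zeta> + 1))\<^sup>2"
      using Re_exp[OF that] unfolding cmod_power2 by (simp add: algebra_simps power2_eq_square del: Re_exp)
    then have "cmod (exp \<zeta> - 1) < cmod (exp \<zeta> + 1)" by (rule power_less_imp_less_base) simp
    then show ?thesis using nz[OF that] by (simp add: E_def norm_divide)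
  qed
  have E': "(E has_field_derivative (1 - (E \<zeta>)\<^sup>2) / 2) (at \<zeta>)" if "\<bar>Im \<zeta>\<bar> < pi / 2" for \<zeta>
  proof -
    have "(E has_field_derivative (exp \<zeta> * (exp \<zeta> + 1) - (exp \<zeta> - 1) * exp \<zeta>) / ((exp \<zeta> + 1) * (exp \<zeta> + 1))) (at \<zeta>)"
      unfolding E_def
      by (rule DERIV_divide) (auto intro!: derivative_eq_intros nz[OF that])
    also have "(exp \<zeta> * (exp \<zeta> + 1) - (exp \<zeta> - 1) * exp \<zeta>) / ((exp \<zeta> + 1) * (exp \<zeta> + 1)) = (1 - (E \<zeta>)\<^sup>2) / 2"
    proof -
      have "(e * (e + 1) - (e - 1) * e) / ((e + 1) * (e + 1)) = (1 - ((e - 1) / (e + 1))\<^sup>2) / 2"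
        if "e + 1 \<noteq> 0" for e :: complex
      proof -
        have "1 - ((e - 1) / (e + 1))\<^sup>2 = 1 - (e - 1)\<^sup>2 / (e + 1)\<^sup>2"
          by (simp only: power_divide)
        also have "\<dots> = ((e + 1)\<^sup>2 - (e - 1)\<^sup>2) / (e + 1)\<^sup>2"
          using that by (simp add: diff_divide_distrib)
        also have "(e + 1)\<^sup>2 - (e - 1)\<^sup>2 = 2 * (e * (e + 1) - (e - 1) * e)"
          by (simp add: algebra_simps power2_eq_square)
        finally have *: "1 - ((e - 1) / (e + 1))\<^sup>2 = 2 * (e * (e + 1) - (e - 1) * e) / (e + 1)\<^sup>2" .
        have "x / (y * y) = (2 * x / y\<^sup>2) / 2" for x y :: complex
          by (simp add: power2_eq_square)
        then show ?thesis unfolding * .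
      qed
      then show ?thesis using nz[OF that] unfolding E_def by blast
    qed
    finally show ?thesis .
  qed
  define d where "d = l w - l z"
  have "d \<noteq> 0" using El[of z] El[of w] zw ne by (auto simp: d_def)
  define \<gamma> where "\<gamma> s = l z + of_real s * d" for s :: real
  have Im\<gamma>: "\<bar>Im (\<gamma> s)\<bar> < pi / 2" if "0 \<le> s" "s \<le> 1" for s
  proof -
    have "Im (\<gamma> s) = (1 - s) * Im (l z) + s * Im (l w)"
      by (simp add: \<gamma>_def d_def algebra_simps)
    moreover have "\<bar>(1 - s) * Im (l z) + s * Im (l w)\<bar> \<le>
        (1 - s) * max \<bar>Im (l z)\<bar> \<bar>Im (l w)\<bar> + s * max \<bar>Im (l z)\<bar> \<bar>Im (l w)\<bar>"
      using that by (intro order_trans[OF abs_triangle_ineq] add_mono) (auto simp: abs_mult intro!: mult_left_mono)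
    moreover have "\<dots> = max \<bar>Im (l z)\<bar> \<bar>Im (l w)\<bar>" by (simp add: algebra_simps)
    moreover have "\<dots> < pi / 2" using Iml[of z] Iml[of w] zw by simp
    ultimately show ?thesis by simp
  qed
  \<comment> \<open>Multiplying by \<open>cnj d\<close> removes the direction of the segment: the
    derivative of \<open>g\<close> is |d|^2 / 2 times the real part assumed negative, so the two
    ends of the segment cannot have the same image.\<close>
  define g where "g s = Re (f (E (\<gamma> s)) * cnj d)" for s
  have dg: "\<exists>y. DERIV g s :> y \<and> y < 0" if s: "0 \<le> s" "s \<le> 1" for s
  proof -
    note I = Im\<gamma>[OF s]
    let ?D = "f' (E (\<gamma> s)) * ((1 - (E (\<gamma> s))\<^sup>2) / 2)"
    have "((\<lambda>\<zeta>. f (E \<zeta>)) has_field_derivative ?D) (at (\<gamma> s))"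
      by (rule DERIV_chain2[OF der[OF E1[OF I]] E'[OF I]])
    moreover have "(\<gamma> has_vector_derivative d) (at s)"
      unfolding \<gamma>_def by (auto intro!: derivative_eq_intros simp: has_vector_derivative_def scaleR_conv_of_real)
    ultimately have "((\<lambda>s. f (E (\<gamma> s))) has_vector_derivative (d * ?D)) (at s)"
      using field_vector_diff_chain_at[of \<gamma> d s "\<lambda>\<zeta>. f (E \<zeta>)" ?D] by (simp add: o_def)
    then have "((\<lambda>s. f (E (\<gamma> s)) * cnj d) has_vector_derivative (d * ?D) * cnj d) (at s)"
      by (rule has_vector_derivative_mult_left)
    then have 4: "(g has_real_derivative Re ((d * ?D) * cnj d)) (at s)"
      unfolding g_def has_real_derivative_iff_has_vector_derivative
      by (rule bounded_linear.has_vector_derivative[OF bounded_linear_Re])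
    have 5: "Re ((d * ?D) * cnj d) < 0"
    proof -
      have 1: "(d * (x * (y / 2))) * cnj d = of_real ((cmod d)\<^sup>2 / 2) * (y * x)" for x y
        unfolding of_real_divide complex_norm_square by simp
      have 2: "Re (of_real r * v) < 0" if "Re v < 0" "r > 0" for r v
        using that by (simp add: mult_pos_neg)
      have 3: "(cmod d)\<^sup>2 / 2 > 0" using \<open>d \<noteq> 0\<close> by simp
      show ?thesis unfolding 1[of "f' (E (\<gamma> s))"] by (rule 2[OF neg[OF E1[OF I]] 3])
    qed
    show ?thesis by (intro exI conjI) (rule 4, rule 5)
  qed
  have "g 1 < g 0"
    by (rule DERIV_neg_imp_decreasing[OF zero_less_one dg])
  moreover have "E (\<gamma> 0) = z" "E (\<gamma> 1) = w"
    using El zw by (simp_all add: \<gamma>_def d_def)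
  ultimately show False using eq by (simp add: g_def)
qed

context bounded_real_distribution
begin

text \<open>A crude bound from |sin| <= 1 and 2 / (pi n) <= 1; it gives convergence of the defining
  series in the whole disc.\<close>

lemma gross_coeff_bound:
  assumes "n > 0" shows "\<bar>gross_coeff M n\<bar> \<le> R - L"
proof -
  have "\<bar>LBINT x:{L..R}. sin (real n * pi * cdf M x)\<bar> \<le> (LBINT x:{L..R}. 1)"
    unfolding set_lebesgue_integral_def real_norm_def[symmetric]
    by (rule Bochner_Integration.integral_norm_bound_integral)
       (use set_integrable_bounded_Icc[of "\<lambda>x. sin (real n * pi * cdf M x)" 1 L R]
          set_integrable_bounded_Icc[of "\<lambda>x. 1::real" 1 L R] in
         \<open>auto simp: set_integrable_def indicator_def\<close>)
  also have "\<dots> = R - L"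
    using L_less_R by (simp add: set_lebesgue_integral_def)
  finally have "\<bar>gross_coeff M n\<bar> \<le> 2 / (pi * real n) * (R - L)"
    unfolding gross_coeff_eq[OF assms] abs_mult using assms by (intro mult_mono) auto
  also have "\<dots> \<le> 1 * (R - L)"
  proof (intro mult_right_mono)
    have "2 * 1 \<le> pi * real n"
      using assms pi_ge_two by (intro mult_mono) auto
    then show "2 / (pi * real n) \<le> 1" by simp
  qed (use L_less_R in auto)
  finally show ?thesis by simp
qed

end

context bounded_real_distribution
begin

lemma sums_gross_map:
  assumes z: "cmod z < 1"
  shows "(\<lambda>n. of_real (if n = 0 then 0 else gross_coeff M n) * z ^ n) sums gross_map M z"
proof -
  have "summable (\<lambda>n. of_real (gross_coeff M (Suc n)) * z ^ Suc n)"
  proof (rule summable_comparison_test')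
    show "summable (\<lambda>n. (R - L) * cmod z ^ Suc n)"
      using z by (intro summable_mult summable_geometric[THEN summable_Suc_iff[THEN iffD2]]) simp
    show "norm (of_real (gross_coeff M (Suc n)) * z ^ Suc n) \<le> (R - L) * cmod z ^ Suc n" if "n \<ge> 0" for n
      unfolding norm_mult norm_power norm_of_real by (intro mult_right_mono gross_coeff_bound) auto
  qed
  then have "(\<lambda>n. of_real (gross_coeff M (Suc n)) * z ^ Suc n) sums gross_map M z"
    unfolding gross_map_def by (rule summable_sums)
  then have "(\<lambda>n. (\<lambda>n. of_real (if n = 0 then 0 else gross_coeff M n) * z ^ n) (Suc n)) sums gross_map M z"
    by simp
  from sums_Suc_imp[OF _ this] show ?thesis
    by simp
qed

lemma gross_map_0: "gross_map M 0 = 0"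
  by (simp add: gross_map_def)

lemma gross_map_holomorphic: "gross_map M holomorphic_on ball 0 1"
  by (rule power_series_holomorphic[where a="\<lambda>n. of_real (if n = 0 then 0 else gross_coeff M n)"])
     (use sums_gross_map in simp)

lemma taylor_coeff_gross_map:
  "taylor_coeff (gross_map M) n = (if n = 0 then 0 else gross_coeff M n)"
proof -
  have "gross_map M has_fps_expansion Abs_fps (\<lambda>n. of_real (if n = 0 then 0 else gross_coeff M n))"
  proof (rule has_fps_expansionI)
    have "\<forall>\<^sub>F z in nhds (0::complex). cmod z < 1"
      by (rule order_tendstoD) (auto intro!: tendsto_eq_intros filterlim_ident)
    then show "\<forall>\<^sub>F u in nhds 0. (\<lambda>n. fps_nth (Abs_fps (\<lambda>n. of_real (if n = 0 then 0 else gross_coeff M n))) n * u ^ n) sums gross_map M u"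
      by eventually_elim (use sums_gross_map in simp)
  qed
  from fps_nth_fps_expansion[OF this, of n] show ?thesis
    by (simp add: taylor_coeff_def)
qed

text \<open>Differentiation multiplies the n-th coefficient by n, which cancels the factor 1/n of
  the sine formula. The remaining sum is the kernel, and it may be exchanged with the integral since
  its terms are dominated by |z|^n.\<close>

lemma gross_map_deriv:
  assumes z: "cmod z < 1"
  shows "(gross_map M has_field_derivative
     - of_real (2 / pi) * (CLINT x|restrict_space lborel {L..R}. sin_kernel z (pi * cdf M x))) (at z)"
proof -
  define X where "X = restrict_space lborel {L..R}"
  interpret X: finite_measure X unfolding X_def by (rule finite_measure_restrict_lborel_Icc)
  have [measurable]: "cdf M \<in> borel_measurable X"
    unfolding X_def by (auto intro!: measurable_restrict_space1)
  define a where "a n = complex_of_real (if n = 0 then 0 else gross_coeff M n)" for n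
  have "((\<lambda>z. \<Sum>n. a n * z ^ n) has_field_derivative (\<Sum>n. diffs a n * z ^ n)) (at z)"
    by (rule termdiffs_strong'[OF _ z]) (use sums_gross_map in \<open>auto simp: a_def sums_iff\<close>)
  then have "(gross_map M has_field_derivative (\<Sum>n. diffs a n * z ^ n)) (at z)"
    by (rule has_field_derivative_transform_within_open[where S="ball 0 1"])
       (use sums_gross_map z in \<open>auto simp: a_def sums_iff\<close>)
  moreover have "(\<Sum>n. diffs a n * z ^ n) = - of_real (2 / pi) * (CLINT x|X. sin_kernel z (pi * cdf M x))"
  proof -
    define f where "f n x = of_real (sin (real (Suc n) * (pi * cdf M x))) * z ^ n" for n x
    have fb: "cmod (f n x) \<le> cmod z ^ n" for n x
      unfolding f_def norm_mult norm_power norm_of_real by (simp add: mult_left_le_one_le)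
    have [measurable]: "f n \<in> borel_measurable X" for n
      unfolding f_def by measurable
    have fi: "integrable X (f n)" for n
      by (rule X.integrable_const_bound[where B="cmod z ^ n"]) (use fb in auto)
    have geo: "summable (\<lambda>n. cmod z ^ n)" using z by (intro summable_geometric) simp
    have "(\<lambda>n. CLINT x|X. f n x) sums (CLINT x|X. \<Sum>n. f n x)"
    proof (rule sums_integral[OF fi])
      show "AE x in X. summable (\<lambda>n. cmod (f n x))"
        using fb by (intro AE_I2 summable_comparison_test'[OF geo]) simp
      show "summable (\<lambda>n. LINT x|X. cmod (f n x))"
      proof (rule summable_comparison_test')
        show "summable (\<lambda>n. measure X (space X) * cmod z ^ n)" by (intro summable_mult geo)
        show "norm (LINT x|X. cmod (f n x)) \<le> measure X (space X) * cmod z ^ n" for n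
        proof -
          have "(LINT x|X. cmod (f n x)) \<le> (LINT x|X. cmod z ^ n)"
            using fi fb by (intro integral_mono) auto
          then show ?thesis by simp
        qed
      qed
    qed
    moreover have "(\<Sum>n. f n x) = sin_kernel z (pi * cdf M x)" for x
      using sin_kernel_sums[OF z] unfolding f_def by (rule sums_unique[symmetric])
    ultimately have "(\<lambda>n. CLINT x|X. f n x) sums (CLINT x|X. sin_kernel z (pi * cdf M x))"
      by simp
    then have "(\<lambda>n. - of_real (2 / pi) * (CLINT x|X. f n x)) sums
        (- of_real (2 / pi) * (CLINT x|X. sin_kernel z (pi * cdf M x)))"
      by (rule sums_mult)
    also have "(\<lambda>n. - of_real (2 / pi) * (CLINT x|X. f n x)) = (\<lambda>n. diffs a n * z ^ n)"
    proof
      fix n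
      have "(CLINT x|X. f n x) = of_real (LBINT x:{L..R}. sin (real (Suc n) * pi * cdf M x)) * z ^ n"
        unfolding f_def integral_mult_left_zero integral_complex_of_real X_def
        by (subst integral_restrict_space) (auto simp: set_lebesgue_integral_def mult.assoc)
      moreover have "diffs a n = of_real (real (Suc n) * gross_coeff M (Suc n))"
        by (simp add: diffs_def a_def)
      moreover have "real (Suc n) * gross_coeff M (Suc n) = - (2 / pi) * (LBINT x:{L..R}. sin (real (Suc n) * pi * cdf M x))"
        by (subst gross_coeff_eq) (simp_all add: divide_simps del: of_nat_Suc)
      ultimately show "- of_real (2 / pi) * (CLINT x|X. f n x) = diffs a n * z ^ n"
        by (simp only: of_real_mult of_real_minus mult.assoc)
    qed
    finally show ?thesis by (simp add: sums_iff)
  qed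
  ultimately show ?thesis by (simp add: X_def)
qed

lemma sin_cdf_nonneg: "0 \<le> sin (pi * cdf M x)"
  using cdf_nonneg[of x] cdf_bounded_prob[of x] by (intro sin_ge_zero) (auto simp: mult_left_le)

text \<open>The integrand is nonnegative, so a vanishing integral forces F to be 0 or 1 almost
  everywhere, then everywhere, and such an F belongs to a point mass. The weight \<open>k\<close> is
  left general because the factor supplied by the kernel varies with the level.\<close>

lemma integral_sin_cdf_pos:
  fixes k :: "real \<Rightarrow> real"
  assumes nd: "nondegenerate M" and k: "\<And>x. k x > 0"
    and i: "integrable (restrict_space lborel {L..R}) (\<lambda>x. k x * sin (pi * cdf M x))"
  shows "(LINT x|restrict_space lborel {L..R}. k x * sin (pi * cdf M x)) > 0"
proof (rule ccontr)
  let ?X = "restrict_space lborel {L..R}"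
  assume "\<not> ?thesis"
  moreover have nonneg: "0 \<le> k x * sin (pi * cdf M x)" for x
    using sin_cdf_nonneg[of x] less_imp_le[OF k[of x]] by simp
  then have "(LINT x|?X. k x * sin (pi * cdf M x)) \<ge> 0"
    by (intro Bochner_Integration.integral_nonneg)
  ultimately have "(LINT x|?X. k x * sin (pi * cdf M x)) = 0" by simp
  then have "AE x in ?X. k x * sin (pi * cdf M x) = 0"
    using integral_nonneg_eq_0_iff_AE[OF i] nonneg by simp
  then have "AE x in ?X. cdf M x = 0 \<or> cdf M x = 1"
  proof eventually_elim
    case (elim x)
    then have "sin (pi * cdf M x) = 0" using k[of x] by simp
    moreover have "sin (pi * cdf M x) > 0" if "0 < cdf M x" "cdf M x < 1"
      using that by (intro sin_gt_zero) auto
    ultimately show ?case using cdf_nonneg[of x] cdf_bounded_prob[of x] by force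
  qed
  then have ae: "AE x in lborel. x \<in> {L..R} \<longrightarrow> cdf M x = 0 \<or> cdf M x = 1"
    by (subst (asm) AE_restrict_space_iff) auto
  have F01: "cdf M x = 0 \<or> cdf M x = 1" for x
  proof (rule ccontr)
    assume c: "\<not> ?thesis"
    then have x: "0 < cdf M x" "cdf M x < 1"
      using cdf_nonneg[of x] cdf_bounded_prob[of x] by linarith+
    then have LR: "L \<le> x" "x < R"
      using cdf_nondecreasing[of x L] cdf_nondecreasing[of R x] cdf_L cdf_R by force+
    have "\<forall>\<^sub>F y in at_right x. cdf M y < 1"
      using cdf_is_right_cont[of x] x(2) by (intro order_tendstoD(2)[of _ "cdf M x"]) (auto simp: continuous_within)
    \<comment> \<open>Right continuity keeps F below 1 just to the right of \<open>x\<close> and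
      monotonicity keeps it above 0, so an interval of positive length would contradict the
      almost-everywhere statement.\<close>
    then obtain b where b: "b > x" "\<And>y. x < y \<Longrightarrow> y < b \<Longrightarrow> cdf M y < 1"
      unfolding eventually_at_right_field by auto
    have "AE y in lborel. y \<notin> {x<..<min b R}"
      using ae
    proof eventually_elim
      case (elim y)
      show ?case
      proof
        assume y: "y \<in> {x<..<min b R}"
        then have "cdf M x \<le> cdf M y" "cdf M y < 1"
          using b by (auto intro: cdf_nondecreasing)
        then show False using elim y LR x by auto
      qed
    qed
    then have "emeasure lborel {x<..<min b R} = 0"
      by (subst (asm) AE_iff_measurable[where N="{x<..<min b R}"]) auto
    then show False using b LR by simp
  qed
  \<comment> \<open>Once F jumps directly from 0 to 1, every quantile with argument in (0, 1) is the
    location of the jump; 1/2 is one choice.\<close>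
  define c where "c = quantile M (1/2)"
  have "cdf M x = (if c \<le> x then 1 else 0)" for x
    using F01[of x] quantile_le_iff[of "1/2" x] by (auto simp: c_def)
  then have "cdf M = cdf (return borel c)"
    by (auto simp: fun_eq_iff cdf_def measure_return indicator_def)
  moreover have "real_distribution (return borel c)"
    by (rule real_distribution.intro[OF prob_space_return]) (simp_all add: real_distribution_axioms_def)
  ultimately have "M = return borel c"
    using cdf_unique[OF real_distribution_axioms] by blast
  moreover have "AE x in return borel c. x = c" by (subst AE_return) simp_all
  ultimately have "AE x in M. x = c" by (simp only:)
  then show False using nd by (auto simp: nondegenerate_def)
qed

text \<open>For each level the real part of (1 - z^2) times the kernel is a positive multiple of
  sin(pi F(x)), which is nonnegative. Integration therefore preserves the sign, strictly for a
  nondegenerate law.\<close>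

lemma gross_map_inj:
  assumes "nondegenerate M"
  shows "inj_on (gross_map M) (ball 0 1)"
proof (rule inj_on_disc_of_Re_deriv_neg[OF gross_map_deriv])
  fix z :: complex assume z: "cmod z < 1"
  define X where "X = restrict_space lborel {L..R}"
  interpret X: finite_measure X unfolding X_def by (rule finite_measure_restrict_lborel_Icc)
  have [measurable]: "cdf M \<in> borel_measurable X"
    unfolding X_def by (auto intro!: measurable_restrict_space1)
  define C where "C = 1 / ((1 - cmod z) * (1 - cmod z))"
  have bound: "cmod (sin_kernel z t) \<le> C" for t
  proof -
    have "1 - cmod z \<le> cmod (1 - z * cis s)" for s
      using norm_triangle_ineq2[of 1 "z * cis s"] by (simp add: norm_mult)
    then have "(1 - cmod z) * (1 - cmod z) \<le> cmod (1 - z * cis t) * cmod (1 - z * cis (-t))"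
      using z by (intro mult_mono) auto
    then show ?thesis
      unfolding sin_kernel_def norm_divide norm_mult norm_of_real C_def using z
      by (intro frac_le) auto
  qed
  have int: "integrable X (\<lambda>x. (1 - z\<^sup>2) * sin_kernel z (pi * cdf M x))"
  proof (intro integrable_mult_right X.integrable_const_bound[where B=C])
    show "(\<lambda>x. sin_kernel z (pi * cdf M x)) \<in> borel_measurable X"
      unfolding sin_kernel_def cis_conv_exp by measurable
  qed (use bound in auto)
  have "\<exists>k. \<forall>x. k x > 0 \<and> Re ((1 - z\<^sup>2) * sin_kernel z (pi * cdf M x)) = k x * sin (pi * cdf M x)"
    by (intro choice allI) (metis Re_sin_kernel[OF z])
  then obtain k where k: "\<And>x. k x > 0"
    "\<And>x. Re ((1 - z\<^sup>2) * sin_kernel z (pi * cdf M x)) = k x * sin (pi * cdf M x)" by blast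
  have "Re ((1 - z\<^sup>2) * (CLINT x|X. sin_kernel z (pi * cdf M x))) =
      (LINT x|X. k x * sin (pi * cdf M x))"
    using integral_Re[OF int] unfolding k(2) integral_mult_right_zero by simp
  also have "\<dots> > 0"
    using integral_sin_cdf_pos[OF assms k(1)] integrable_Re[OF int] unfolding k(2) X_def by simp
  finally have pos: "Re ((1 - z\<^sup>2) * (CLINT x|X. sin_kernel z (pi * cdf M x))) > 0" .
  have "Re ((1 - z\<^sup>2) * (- of_real (2 / pi) * (CLINT x|X. sin_kernel z (pi * cdf M x)))) =
      - (2 / pi) * Re ((1 - z\<^sup>2) * (CLINT x|X. sin_kernel z (pi * cdf M x)))"
  proof -
    have "Re (w * (- of_real r * v)) = - r * Re (w * v)" for r w v
      by (simp add: algebra_simps)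
    then show ?thesis .
  qed
  also have "\<dots> < 0" using pos by (intro mult_neg_pos) auto
  finally show "Re ((1 - z\<^sup>2) * (- of_real (2 / pi) *
      (CLINT x|restrict_space lborel {L..R}. sin_kernel z (pi * cdf M x)))) < 0"
    unfolding X_def .
qed

lemma skorokhod_energy_gross_domain:
  assumes "nondegenerate M"
  shows "skorokhod_energy (gross_domain M) = (\<Sum>n. ennreal ((real n)\<^sup>2 * (gross_coeff M n)\<^sup>2)) / 4"
proof -
  have "univalent_onto (gross_map M) (gross_domain M)"
    unfolding univalent_onto_def gross_domain_def
    using gross_map_holomorphic gross_map_inj[OF assms] gross_map_0 by simp
  then have "skorokhod_energy (gross_domain M) = coeff_energy (gross_map M)"
    by (rule skorokhod_energy_eq)
  also have "\<dots> = (\<Sum>n. ennreal ((real n)\<^sup>2 * (gross_coeff M n)\<^sup>2)) / 4"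
    unfolding coeff_energy_def taylor_coeff_gross_map
    by (intro arg_cong2[where f="(/)"] suminf_cong) auto
  finally show ?thesis .
qed

end

section \<open>The inequality of Polya and Szego\<close>

lemma has_integral_cis:
  "((\<lambda>t. cis (of_int m * t)) has_integral (if m = 0 then of_real (2 * pi) else 0)) {-pi..pi}"
proof (cases "m = 0")
  case True
  then show ?thesis using has_integral_const_real[of "1::complex" "-pi" pi]
    by (simp add: scaleR_conv_of_real)
next
  case False
  have "((\<lambda>t. cis (of_int m * t)) has_integral
      (cis (of_int m * pi) / (\<i> * of_int m) - cis (of_int m * (-pi)) / (\<i> * of_int m))) {-pi..pi}"
  proof (rule fundamental_theorem_of_calculus)
    show "((\<lambda>t. cis (of_int m * t) / (\<i> * of_int m)) has_vector_derivative cis (of_int m * x)) (at x within {-pi..pi})" for x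
    proof -
      have "((\<lambda>z. exp (\<i> * (of_int m * z)) / (\<i> * of_int m)) has_field_derivative exp (\<i> * (of_int m * of_real x))) (at (of_real x))"
      proof -
        have "((\<lambda>z. exp (c * z) / c) has_field_derivative exp (c * y)) (at y)" if "c \<noteq> 0" for c y :: complex
          using that by (auto intro!: derivative_eq_intros)
        from this[of "\<i> * of_int m" "of_real x"] show ?thesis using False by (simp add: mult.assoc)
      qed
      from has_vector_derivative_real_field[OF this] show ?thesis
        by (simp add: cis_conv_exp)
    qed
  qed simp
  moreover have "cis (of_int m * pi) = cis (of_int m * (-pi))"
    using sin_integer_2pi[of "of_int m / 2"] by (simp add: cis.ctr sin_times_pi_eq_0 sin_zero_iff_int2)
  ultimately show ?thesis using False by simp
qed

text \<open>Re v Re w = Re(v w + v conj(w)) / 2 splits each product into the frequencies j + k and j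
  - k. Indices are positive, so j + k never vanishes and only the diagonal terms survive.\<close>

lemma has_integral_Re_trig_poly_square:
  fixes d :: "nat \<Rightarrow> complex"
  shows "((\<lambda>t. (Re (\<Sum>k\<in>{1..N}. d k * cis (real k * t)))\<^sup>2) has_integral pi * (\<Sum>k\<in>{1..N}. (cmod (d k))\<^sup>2)) {-pi..pi}"
proof -
  let ?I = "\<lambda>m. if m = 0 then of_real (2 * pi) else (0::complex)"
  have prod: "Re v * Re w = Re ((v * w + v * cnj w) / 2)" for v w
    by (simp add: algebra_simps)
  have pair: "((\<lambda>t. Re (d j * cis (real j * t)) * Re (d k * cis (real k * t))) has_integral
      (if j = k then pi * (cmod (d j))\<^sup>2 else 0)) {-pi..pi}" if "j \<in> {1..N}" for j k
  proof -
    have "((\<lambda>t. (d j * d k * cis (of_int (int j + int k) * t) + d j * cnj (d k) * cis (of_int (int j - int k) * t)) / 2)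
       has_integral (d j * d k * ?I (int j + int k) + d j * cnj (d k) * ?I (int j - int k)) / 2) {-pi..pi}"
      by (intro has_integral_divide has_integral_add has_integral_mult_right has_integral_cis)
    from has_integral_linear[OF this bounded_linear_Re]
    have "((\<lambda>t. Re ((d j * d k * cis (of_int (int j + int k) * t) + d j * cnj (d k) * cis (of_int (int j - int k) * t)) / 2))
       has_integral Re ((d j * d k * ?I (int j + int k) + d j * cnj (d k) * ?I (int j - int k)) / 2)) {-pi..pi}"
      by (simp only: o_def)
    also have "Re ((d j * d k * ?I (int j + int k) + d j * cnj (d k) * ?I (int j - int k)) / 2) =
        (if j = k then pi * (cmod (d j))\<^sup>2 else 0)"
      unfolding cmod_power2 using that by (auto simp: power2_eq_square algebra_simps)
    also have "(\<lambda>t. Re ((d j * d k * cis (of_int (int j + int k) * t) + d j * cnj (d k) * cis (of_int (int j - int k) * t)) / 2)) =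
        (\<lambda>t. Re (d j * cis (real j * t)) * Re (d k * cis (real k * t)))"
    proof
      fix t
      have "cis (of_int (int j + int k) * t) = cis (real j * t) * cis (real k * t)"
        "cis (of_int (int j - int k) * t) = cis (real j * t) * cnj (cis (real k * t))"
        by (simp_all add: cis_mult cis_cnj algebra_simps)
      then have "d j * d k * cis (of_int (int j + int k) * t) = (d j * cis (real j * t)) * (d k * cis (real k * t))"
        "d j * cnj (d k) * cis (of_int (int j - int k) * t) = (d j * cis (real j * t)) * cnj (d k * cis (real k * t))"
        by (simp_all only: complex_cnj_mult mult_ac)
      then show "Re ((d j * d k * cis (of_int (int j + int k) * t) + d j * cnj (d k) * cis (of_int (int j - int k) * t)) / 2) =
        Re (d j * cis (real j * t)) * Re (d k * cis (real k * t))"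
        by (simp only: prod)
    qed
    finally show ?thesis .
  qed
  have "((\<lambda>t. \<Sum>j\<in>{1..N}. \<Sum>k\<in>{1..N}. Re (d j * cis (real j * t)) * Re (d k * cis (real k * t))) has_integral
      (\<Sum>j\<in>{1..N}. \<Sum>k\<in>{1..N}. if j = k then pi * (cmod (d j))\<^sup>2 else 0)) {-pi..pi}"
    by (intro has_integral_sum pair) auto
  also have "(\<Sum>j\<in>{1..N}. \<Sum>k\<in>{1..N}. if j = k then pi * (cmod (d j))\<^sup>2 else 0) = pi * (\<Sum>k\<in>{1..N}. (cmod (d k))\<^sup>2)"
    by (simp add: sum_distrib_left)
  also have "(\<lambda>t. \<Sum>j\<in>{1..N}. \<Sum>k\<in>{1..N}. Re (d j * cis (real j * t)) * Re (d k * cis (real k * t))) =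
     (\<lambda>t. (Re (\<Sum>k\<in>{1..N}. d k * cis (real k * t)))\<^sup>2)"
    by (simp only: power2_eq_square Re_sum sum_product)
  finally show ?thesis .
qed

text \<open>A closed curve crosses every level between two of its values at least twice.\<close>

lemma two_arcs_bound:
  fixes g h h' :: "real \<Rightarrow> real"
  assumes g: "continuous_on UNIV g"
    and h: "\<And>t. (h has_real_derivative h' t) (at t)" and h': "continuous_on UNIV h'"
    and per: "h a = h b" and p: "p \<in> {a..b}" and q: "q \<in> {a..b}" and le: "h p \<le> h q"
  shows "2 * \<bar>integral {h p..h q} g\<bar> \<le> integral {a..b} (\<lambda>t. \<bar>g (h t) * h' t\<bar>)"
proof -
  have hc: "continuous_on S h" for S
    using h by (intro continuous_at_imp_continuous_on ballI) (blast intro: DERIV_isCont)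
  \<comment> \<open>Strict bounds leave room on both sides of every value of \<open>h\<close>, so
    the antiderivative \<open>A\<close> has a two-sided derivative there and the chain rule
    applies.\<close>
  obtain c1 c2 where c: "\<And>t. t \<in> {a..b} \<Longrightarrow> c1 < h t \<and> h t < c2"
  proof -
    have "bounded (h ` {a..b})"
      by (intro compact_imp_bounded compact_continuous_image hc compact_Icc)
    then obtain B where B: "\<forall>x\<in>h ` {a..b}. norm x \<le> B" unfolding bounded_iff by blast
    show thesis
      by (rule that[of "-B-1" "B+1"]) (use B in force)
  qed
  define A where "A x = integral {c1..x} g" for x
  have A: "(A has_real_derivative g x) (at x)" if "c1 < x" "x < c2" for x
  proof -
    have "(A has_real_derivative g x) (at x within {c1..c2})"
      unfolding A_def by (rule integral_has_real_derivative) (use that g continuous_on_subset in auto)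
    then show ?thesis using that by (simp add: at_within_Icc_at)
  qed
  define H where "H t = A (h t)" for t
  have gh: "continuous_on S (\<lambda>t. g (h t) * h' t)" for S
    by (intro continuous_intros continuous_on_compose2[OF g hc] continuous_on_subset[OF h']) auto
  have FTC: "\<bar>H v - H u\<bar> \<le> integral {u..v} (\<lambda>t. \<bar>g (h t) * h' t\<bar>)" if "a \<le> u" "u \<le> v" "v \<le> b" for u v
  proof -
    have "((\<lambda>t. g (h t) * h' t) has_integral (H v - H u)) {u..v}"
    proof (rule fundamental_theorem_of_calculus[OF \<open>u \<le> v\<close>])
      fix t assume t: "t \<in> {u..v}"
      have "(H has_real_derivative g (h t) * h' t) (at t)"
        unfolding H_def by (rule DERIV_chain2[OF A h]) (use c[of t] t that in auto)
      then show "(H has_vector_derivative g (h t) * h' t) (at t within {u..v})"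
        by (simp add: has_real_derivative_iff_has_vector_derivative has_vector_derivative_at_within)
    qed
    then have "H v - H u = integral {u..v} (\<lambda>t. g (h t) * h' t)" by (simp add: integral_unique)
    also have "\<bar>\<dots>\<bar> \<le> integral {u..v} (\<lambda>t. \<bar>g (h t) * h' t\<bar>)"
      unfolding real_norm_def[symmetric]
      by (rule Henstock_Kurzweil_Integration.integral_norm_bound_integral)
         (auto intro!: integrable_continuous_real gh continuous_intros continuous_on_subset[OF g] continuous_on_subset[OF h'] simp del: real_norm_def)
    finally show ?thesis .
  qed
  define u where "u = min p q" 
  define v where "v = max p q"
  have uv: "a \<le> u" "u \<le> v" "v \<le> b" using p q by (auto simp: u_def v_def)
  have int: "(\<lambda>t. \<bar>g (h t) * h' t\<bar>) integrable_on {x..y}" for x y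
    by (intro integrable_continuous_real continuous_intros gh)
  \<comment> \<open>By periodicity the increment of \<open>H\<close> over [u, v] is the negative of
    its total increment over the two outer pieces, so the same amount is counted twice in the full
    integral.\<close>
  have "H a = H b" by (simp add: H_def per)
  then have "H v - H u = - ((H u - H a) + (H b - H v))" by simp
  then have "\<bar>H v - H u\<bar> \<le> \<bar>H u - H a\<bar> + \<bar>H b - H v\<bar>"
    by (metis abs_minus_cancel abs_triangle_ineq)
  then have "2 * \<bar>H v - H u\<bar> \<le> \<bar>H u - H a\<bar> + \<bar>H v - H u\<bar> + \<bar>H b - H v\<bar>" by simp
  also have "\<dots> \<le> integral {a..u} (\<lambda>t. \<bar>g (h t) * h' t\<bar>) + integral {u..v} (\<lambda>t. \<bar>g (h t) * h' t\<bar>)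
      + integral {v..b} (\<lambda>t. \<bar>g (h t) * h' t\<bar>)"
    using uv by (intro add_mono FTC) auto
  also have "\<dots> = integral {a..b} (\<lambda>t. \<bar>g (h t) * h' t\<bar>)"
    using uv by (simp add: Henstock_Kurzweil_Integration.integral_combine int)
  also have "\<bar>H v - H u\<bar> = \<bar>A (h q) - A (h p)\<bar>"
    by (auto simp: H_def u_def v_def min_def max_def)
  also have "A (h q) - A (h p) = integral {h p..h q} g"
    using Henstock_Kurzweil_Integration.integral_combine[of c1 "h p" "h q" g] c[OF p] le
      integrable_continuous_real[OF continuous_on_subset[OF g]]
    by (simp add: A_def)
  finally show ?thesis .
qed

text \<open>On the circle conj(z) = 1/z, so multiplying the level equation by 2 z^N turns it into a
  polynomial equation. Its coefficient at N + 1 is \<open>c 1\<close>, hence it has finitely many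
  roots.\<close>

lemma finite_trig_poly_level:
  fixes c :: "nat \<Rightarrow> complex"
  assumes "c 1 \<noteq> 0" "N \<ge> 1"
  shows "finite {t \<in> {-pi..pi}. Re (\<Sum>k\<in>{1..N}. c k * cis (real k * t)) = x}"
proof -
  define P where "P = (\<Sum>k\<in>{1..N}. monom (c k) (N + k) + monom (cnj (c k)) (N - k)) - monom (of_real (2 * x)) N"
  have "coeff P (N + 1) = c 1"
  proof -
    have "coeff P (N + 1) = (\<Sum>k\<in>{1..N}. coeff (monom (c k) (N + k) + monom (cnj (c k)) (N - k)) (N + 1))"
      by (simp add: P_def coeff_sum)
    also have "\<dots> = (\<Sum>k\<in>{1..N}. if k = 1 then c 1 else 0)"
      by (rule sum.cong) auto
    also have "\<dots> = c 1" using assms by simp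
    finally show ?thesis .
  qed
  then have "P \<noteq> 0" using assms by auto
  then have fin: "finite {z. poly P z = 0}" by (rule poly_roots_finite)
  have root: "poly P (cis t) = 0" if "Re (\<Sum>k\<in>{1..N}. c k * cis (real k * t)) = x" for t
  proof -
    have minus: "cis t ^ (N - k) = cis t ^ N * cnj (cis (real k * t))" if "k \<in> {1..N}" for k
      using that by (simp add: Complex.DeMoivre cis_cnj cis_mult of_nat_diff algebra_simps)
    have plus: "cis t ^ (N + k) = cis t ^ N * cis (real k * t)" for k
      by (simp only: power_add Complex.DeMoivre)
    have "poly P (cis t) = (\<Sum>k\<in>{1..N}. c k * cis t ^ (N + k) + cnj (c k) * cis t ^ (N - k)) - of_real (2 * x) * cis t ^ N"
      by (simp add: P_def poly_sum poly_monom)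
    also have "(\<Sum>k\<in>{1..N}. c k * cis t ^ (N + k) + cnj (c k) * cis t ^ (N - k)) =
        (\<Sum>k\<in>{1..N}. cis t ^ N * (c k * cis (real k * t) + cnj (c k * cis (real k * t))))"
      by (rule sum.cong) (simp_all only: plus minus complex_cnj_mult distrib_left mult.left_commute refl)
    also have "\<dots> = cis t ^ N * ((\<Sum>k\<in>{1..N}. c k * cis (real k * t)) + cnj (\<Sum>k\<in>{1..N}. c k * cis (real k * t)))"
      by (simp only: sum_distrib_left[symmetric] sum.distrib cnj_sum)
    also have "\<dots> = cis t ^ N * of_real (2 * x)"
      unfolding complex_add_cnj that ..
    finally show ?thesis by simp
  qed
  have "inj_on cis {-pi<..pi}"
  proof (rule inj_onI)
    fix s t assume st: "s \<in> {-pi<..pi}" "t \<in> {-pi<..pi}" "cis s = cis t"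
    then show "s = t" using Arg_cis[of s] Arg_cis[of t] by metis
  qed
  then have "finite (cis -` {z. poly P z = 0} \<inter> {-pi<..pi})"
    using fin by (rule finite_vimage_IntI[rotated])
  \<comment> \<open>\<open>cis\<close> is injective on the half-open interval only; the endpoint -pi
    is added by hand.\<close>
  then show ?thesis
    by (rule finite_subset[rotated, OF finite.insertI[of _ "-pi"]]) (use root in force)
qed

section \<open>Laws of functions on the circle and stability of their quantiles\<close>

definition circle_distr :: "(real \<Rightarrow> real) \<Rightarrow> real measure" where
  "circle_distr h = distr (uniform_measure lborel {-pi..pi}) borel h"

lemma prob_space_uniform_circle: "prob_space (uniform_measure lborel {-pi..pi::real})"
  by (rule prob_space_uniform_measure) auto

lemma real_distribution_circle_distr:
  assumes "h \<in> borel_measurable borel"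
  shows "real_distribution (circle_distr h)"
proof -
  interpret prob_space "uniform_measure lborel {-pi..pi::real}" by (rule prob_space_uniform_circle)
  show ?thesis unfolding circle_distr_def using assms by (intro real_distribution_distr) simp
qed

lemma measure_circle_distr:
  assumes "h \<in> borel_measurable borel" "A \<in> sets borel"
  shows "measure (circle_distr h) A = measure lborel ({-pi..pi} \<inter> h -` A) / (2 * pi)"
proof -
  have "h -` A \<in> sets borel" using assms measurable_sets[of h borel borel A] by simp
  then show ?thesis unfolding circle_distr_def using assms
    by (subst measure_distr) simp_all
qed

lemma integral_circle_distr:
  fixes g :: "real \<Rightarrow> 'a::{banach, second_countable_topology}"
  assumes "h \<in> borel_measurable borel" "g \<in> borel_measurable borel"
  shows "integral\<^sup>L (circle_distr h) g = (1 / (2 * pi)) *\<^sub>R (LBINT t:{-pi..pi}. g (h t))"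
proof -
  have gh: "(\<lambda>t. g (h t)) \<in> borel_measurable lborel"
    using measurable_compose[OF assms] by simp
  have "integral\<^sup>L (circle_distr h) g = integral\<^sup>L (uniform_measure lborel {-pi..pi}) (\<lambda>t. g (h t))"
    unfolding circle_distr_def using assms by (intro integral_distr) simp_all
  also have "uniform_measure lborel {-pi..pi} = density lborel (\<lambda>t. ennreal (indicator {-pi..pi} t / (2 * pi)))"
    unfolding uniform_measure_def by (intro density_cong) (auto simp: indicator_def divide_ennreal[symmetric])
  also have "integral\<^sup>L \<dots> (\<lambda>t. g (h t)) = (LINT t|lborel. (indicator {-pi..pi} t / (2 * pi)) *\<^sub>R g (h t))"
    using gh by (intro integral_density) auto
  also have "\<dots> = (1 / (2 * pi)) *\<^sub>R (LBINT t:{-pi..pi}. g (h t))"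
    unfolding set_lebesgue_integral_def by (simp flip: integral_scaleR_right)
  finally show ?thesis .
qed

lemma bounded_real_distribution_circle_distr:
  assumes "h \<in> borel_measurable borel" "\<And>t. t \<in> {-pi..pi} \<Longrightarrow> h t \<le> R"
    "measure lborel {t \<in> {-pi..pi}. h t \<le> L} = 0"
  shows "bounded_real_distribution (circle_distr h) L R"
proof -
  interpret real_distribution "circle_distr h" by (rule real_distribution_circle_distr[OF assms(1)])
  show ?thesis
  proof (unfold_locales)
    have "{-pi..pi} \<inter> h -` {..L} = {t \<in> {-pi..pi}. h t \<le> L}" by auto
    then show "cdf (circle_distr h) L = 0"
      using assms by (simp add: cdf_def measure_circle_distr)
    have "{-pi..pi} \<inter> h -` {..R} = {-pi..pi}" using assms by auto
    then show "cdf (circle_distr h) R = 1"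
      using assms by (simp add: cdf_def measure_circle_distr)
  qed
qed

context bounded_real_distribution
begin

lemma set_integrable_gross:
  "set_integrable lborel ({-pi<..<pi} - {0}) (\<lambda>t. quantile M (\<bar>t\<bar> / pi) * cos (real n * t))"
proof -
  have m: "(\<lambda>t. (indicator {0<..<1} (\<bar>t\<bar> / pi) * quantile M (\<bar>t\<bar> / pi)) * cos (real n * t)) \<in> borel_measurable borel"
    by (intro borel_measurable_times measurable_compose[OF _ borel_measurable_quantile] borel_measurable_continuous_onI continuous_intros) auto
  have "set_integrable lborel {-pi..pi} (\<lambda>t. (indicator {0<..<1} (\<bar>t\<bar> / pi) * quantile M (\<bar>t\<bar> / pi)) * cos (real n * t))"
  proof (rule set_integrable_bounded_Icc[OF m])
    fix t
    have "\<bar>indicator {0<..<1} (\<bar>t\<bar> / pi) * quantile M (\<bar>t\<bar> / pi)\<bar> \<le> \<bar>L\<bar> + \<bar>R\<bar>"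
      using quantile_bounds[of "\<bar>t\<bar> / pi"] by (cases "\<bar>t\<bar> / pi \<in> {0<..<1}") auto
    then have "\<bar>indicator {0<..<1} (\<bar>t\<bar> / pi) * quantile M (\<bar>t\<bar> / pi)\<bar> * \<bar>cos (real n * t)\<bar> \<le> (\<bar>L\<bar> + \<bar>R\<bar>) * 1"
      by (intro mult_mono) auto
    then show "norm ((indicator {0<..<1} (\<bar>t\<bar> / pi) * quantile M (\<bar>t\<bar> / pi)) * cos (real n * t)) \<le> \<bar>L\<bar> + \<bar>R\<bar>"
      by (simp add: abs_mult)
  qed
  moreover have "indicator {-pi..pi} t *\<^sub>R ((indicator {0<..<1} (\<bar>t\<bar> / pi) * quantile M (\<bar>t\<bar> / pi)) * cos (real n * t)) =
     indicator ({-pi<..<pi} - {0}) t *\<^sub>R (quantile M (\<bar>t\<bar> / pi) * cos (real n * t))" for t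
  proof -
    have "\<bar>t\<bar> / pi \<in> {0<..<1} \<longleftrightarrow> t \<in> {-pi<..<pi} - {0}"
      by (auto simp: divide_less_eq)
    then show ?thesis by (auto simp: indicator_def)
  qed
  ultimately show ?thesis unfolding set_integrable_def by (simp only:)
qed

text \<open>At \<open>t = 0\<close> the quantile function has the junk value \<open>Inf UNIV\<close>.\<close>

lemma gross_coeff_punctured:
  "gross_coeff M n = (LBINT t:{-pi<..<pi} - {0}. quantile M (\<bar>t\<bar> / pi) * cos (real n * t)) / pi"
proof -
  let ?f = "\<lambda>t. quantile M (\<bar>t\<bar> / pi) * cos (real n * t)"
  have "set_integrable lborel {0} ?f" by simp
  then have "(LBINT t:({-pi<..<pi} - {0}) \<union> {0}. ?f t) = (LBINT t:{-pi<..<pi} - {0}. ?f t) + (LBINT t:{0}. ?f t)"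
    by (intro set_integral_Un set_integrable_gross) auto
  moreover have "(LBINT t:{0}. ?f t) = 0"
    unfolding set_lebesgue_integral_def
    by (rule integral_eq_zero_AE) (use AE_lborel_singleton[of 0] in eventually_elim, auto)
  moreover have "({-pi<..<pi} - {0}) \<union> {0} = {-pi<..<pi}" by auto
  ultimately show ?thesis by (simp add: gross_coeff_def)
qed

text \<open>Below the quantile F is less than u, so its left limit there is at most u; continuity
  excludes a jump past u. This is what makes F(h) uniform.\<close>

lemma cdf_quantile:
  assumes "isCont (cdf M) (quantile M u)" "0 < u" "u < 1"
  shows "cdf M (quantile M u) = u"
proof (rule antisym)
  show "u \<le> cdf M (quantile M u)" using quantile_le_iff[OF assms(2,3)] by blast
  have "(cdf M \<longlongrightarrow> cdf M (quantile M u)) (at_left (quantile M u))"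
    using assms(1) by (auto simp: isCont_def filterlim_at_split)
  moreover have "\<forall>\<^sub>F x in at_left (quantile M u). cdf M x \<le> u"
    unfolding eventually_at_left_field
  proof (intro exI[of _ "quantile M u - 1"] conjI allI impI)
    fix y assume "y < quantile M u"
    then have "\<not> u \<le> cdf M y" using quantile_le_iff[OF assms(2,3), of y] by simp
    then show "cdf M y \<le> u" by simp
  qed simp
  ultimately show "cdf M (quantile M u) \<le> u"
    by (intro tendsto_upperbound) auto
qed

end

text \<open>The factor 2 is the length 2 pi of the interval divided by pi. On the punctured interval
  the arguments of both quantile functions stay in (0, 1).\<close>

lemma gross_coeff_close:
  assumes "bounded_real_distribution \<mu> L R" "bounded_real_distribution \<nu> L' R'"
    and close: "\<And>u. 0 < u \<Longrightarrow> u < 1 \<Longrightarrow> \<bar>quantile \<mu> u - quantile \<nu> u\<bar> \<le> e"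
  shows "\<bar>gross_coeff \<mu> n - gross_coeff \<nu> n\<bar> \<le> 2 * e"
proof -
  interpret m: bounded_real_distribution \<mu> L R by fact
  interpret n: bounded_real_distribution \<nu> L' R' by fact
  let ?S = "{-pi<..<pi} - {0::real}"
  have e: "e \<ge> 0" using close[of "1/2"] by simp
  have c: "\<bar>(quantile \<mu> (\<bar>t\<bar> / pi) - quantile \<nu> (\<bar>t\<bar> / pi)) * cos (real n * t)\<bar> \<le> e" if "t \<in> ?S" for t
  proof -
    have "\<bar>quantile \<mu> (\<bar>t\<bar> / pi) - quantile \<nu> (\<bar>t\<bar> / pi)\<bar> * \<bar>cos (real n * t)\<bar> \<le> e * 1"
      using that e by (intro mult_mono close) auto
    then show ?thesis by (simp add: abs_mult)
  qed
  have "pi * (gross_coeff \<mu> n - gross_coeff \<nu> n) =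
      (LBINT t:?S. quantile \<mu> (\<bar>t\<bar> / pi) * cos (real n * t) - quantile \<nu> (\<bar>t\<bar> / pi) * cos (real n * t))"
    by (subst set_integral_diff[OF m.set_integrable_gross n.set_integrable_gross])
       (simp add: m.gross_coeff_punctured n.gross_coeff_punctured right_diff_distrib)
  also have "\<dots> = (LBINT t:?S. (quantile \<mu> (\<bar>t\<bar> / pi) - quantile \<nu> (\<bar>t\<bar> / pi)) * cos (real n * t))"
    by (simp add: left_diff_distrib)
  finally have eq: "pi * (gross_coeff \<mu> n - gross_coeff \<nu> n) =
     (LBINT t:?S. (quantile \<mu> (\<bar>t\<bar> / pi) - quantile \<nu> (\<bar>t\<bar> / pi)) * cos (real n * t))" .
  have "\<bar>LBINT t:?S. (quantile \<mu> (\<bar>t\<bar> / pi) - quantile \<nu> (\<bar>t\<bar> / pi)) * cos (real n * t)\<bar> \<le> (LBINT t:{-pi..pi}. e)"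
    unfolding set_lebesgue_integral_def
  proof (rule integral_abs_bound_integral)
    show "integrable lborel (\<lambda>t. indicator ?S t *\<^sub>R ((quantile \<mu> (\<bar>t\<bar> / pi) - quantile \<nu> (\<bar>t\<bar> / pi)) * cos (real n * t)))"
      using set_integral_diff(1)[OF m.set_integrable_gross[of n] n.set_integrable_gross[of n]]
      by (simp add: set_integrable_def left_diff_distrib)
    show "integrable lborel (\<lambda>t. indicator {-pi..pi} t *\<^sub>R e)" by simp
    show "\<bar>indicator ?S t *\<^sub>R ((quantile \<mu> (\<bar>t\<bar> / pi) - quantile \<nu> (\<bar>t\<bar> / pi)) * cos (real n * t))\<bar> \<le> indicator {-pi..pi} t *\<^sub>R e" for t
      using c[of t] e by (cases "t \<in> ?S") (auto simp: indicator_def)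
  qed
  also have "(LBINT t:{-pi..pi}. e) = pi * (2 * e)" by (simp add: set_lebesgue_integral_def)
  finally have "pi * \<bar>gross_coeff \<mu> n - gross_coeff \<nu> n\<bar> \<le> pi * (2 * e)"
    unfolding eq[symmetric] by (simp add: abs_mult)
  then show ?thesis by simp
qed

text \<open>Both laws are images of the same uniform variable t, which couples them: k(t) <= x
  implies h(t) <= x + e, and the resulting comparison of distribution functions is inverted.\<close>

lemma quantile_circle_distr_close:
  assumes "bounded_real_distribution (circle_distr h) L R" "bounded_real_distribution (circle_distr k) L' R'"
    and "h \<in> borel_measurable borel" "k \<in> borel_measurable borel"
    and close: "\<And>t. t \<in> {-pi..pi} \<Longrightarrow> \<bar>h t - k t\<bar> \<le> e" and u: "0 < u" "u < 1"
  shows "quantile (circle_distr h) u \<le> quantile (circle_distr k) u + e"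
proof -
  interpret h: bounded_real_distribution "circle_distr h" L R by fact
  interpret k: bounded_real_distribution "circle_distr k" L' R' by fact
  have fm: "{-pi..pi} \<inter> h -` {..y} \<in> fmeasurable lborel" for y
  proof (rule fmeasurableI)
    show "{-pi..pi} \<inter> h -` {..y} \<in> sets lborel"
      using measurable_sets[OF assms(3), of "{..y}"] by auto
    have "emeasure lborel ({-pi..pi} \<inter> h -` {..y}) \<le> emeasure lborel {-pi..pi}"
      by (rule emeasure_mono) auto
    also have "\<dots> < \<infinity>" by simp
    finally show "emeasure lborel ({-pi..pi} \<inter> h -` {..y}) < \<infinity>" .
  qed
  let ?x = "quantile (circle_distr k) u"
  have "u \<le> cdf (circle_distr k) ?x" using k.quantile_le_iff[OF u] by blast
  also have "\<dots> \<le> cdf (circle_distr h) (?x + e)"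
  proof -
    have "{-pi..pi} \<inter> k -` {..?x} \<subseteq> {-pi..pi} \<inter> h -` {..?x + e}"
      using close by (force simp: abs_le_iff)
    then have "measure lborel ({-pi..pi} \<inter> k -` {..?x}) \<le> measure lborel ({-pi..pi} \<inter> h -` {..?x + e})"
      using measurable_sets[OF assms(4), of "{..?x}"] by (intro measure_mono_fmeasurable fm) auto
    then show ?thesis
      using assms(3,4) by (simp add: cdf_def measure_circle_distr divide_right_mono)
  qed
  finally show ?thesis using h.quantile_le_iff[OF u] by blast
qed

text \<open>A sine polynomial is the real part of the trigonometric polynomial with coefficients -i
  b_k. Its square is even, so [0, 1] carries half of the rescaled integral.\<close>

lemma has_integral_sin_poly_square:
  fixes b :: "nat \<Rightarrow> real"
  shows "((\<lambda>u. (\<Sum>k\<in>{1..K}. b k * sin (real k * (pi * u)))\<^sup>2) has_integral (\<Sum>k\<in>{1..K}. (b k)\<^sup>2) / 2) {0..1}"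
proof -
  define S where "S u = (\<Sum>k\<in>{1..K}. b k * sin (real k * u))\<^sup>2" for u
  define B where "B = (\<Sum>k\<in>{1..K}. (b k)\<^sup>2)"
  have "Re (\<Sum>k\<in>{1..K}. (- \<i> * of_real (b k)) * cis (real k * t)) = (\<Sum>k\<in>{1..K}. b k * sin (real k * t))" for t
    unfolding Re_sum by (rule sum.cong) simp_all
  moreover have "cmod (- \<i> * of_real (b k)) = \<bar>b k\<bar>" for k by (simp add: norm_mult)
  ultimately have "(S has_integral pi * B) {-pi..pi}"
    using has_integral_Re_trig_poly_square[of "\<lambda>k. - \<i> * of_real (b k)" K] unfolding S_def B_def by simp
  then have "((\<lambda>u. S (pi * u)) has_integral (1 / \<bar>pi\<bar>) *\<^sub>R (pi * B)) ((\<lambda>x. x / pi) ` {-pi..pi})"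
    by (rule has_integral_stretch_real) simp
  moreover have "(\<lambda>x. x / pi) ` {-pi..pi} = {-1..1}"
    using image_affinity_atLeastAtMost_div[of pi 0 "-pi" pi] by simp
  ultimately have full: "integral {-1..1} (\<lambda>u. S (pi * u)) = B"
    by (simp add: integral_unique)
  have cont: "continuous_on A (\<lambda>u. S (pi * u))" for A
    unfolding S_def by (intro continuous_intros)
  have int: "(\<lambda>u. S (pi * u)) integrable_on {x..y}" for x y
    by (intro integrable_continuous_real cont)
  have even: "S (- t) = S t" for t
    by (simp add: S_def sum_negf)
  have "integral {-1..0} (\<lambda>u. S (pi * u)) = integral {-1..-0} (\<lambda>u. S (pi * - u))"
    by (simp add: even)
  also have "\<dots> = integral {0..1} (\<lambda>u. S (pi * u))"
    by (rule Henstock_Kurzweil_Integration.integral_reflect_real[of 1 0 "\<lambda>u. S (pi * u)"])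
  finally have "2 * integral {0..1} (\<lambda>u. S (pi * u)) = B"
    using Henstock_Kurzweil_Integration.integral_combine[of "-1" 0 1, OF _ _ int] full by simp
  then have "B / 2 = integral {0..1} (\<lambda>u. S (pi * u))" by simp
  then have "((\<lambda>u. S (pi * u)) has_integral B / 2) {0..1}"
    using integrable_integral[OF int[of 0 1]] by (simp only:)
  then show ?thesis by (simp add: S_def B_def)
qed

lemma trig_poly_has_derivative:
  fixes c :: "nat \<Rightarrow> complex"
  shows "((\<lambda>t. Re (\<Sum>k\<in>A. c k * cis (real k * t))) has_real_derivative
     Re (\<Sum>k\<in>A. (\<i> * of_nat k * c k) * cis (real k * t))) (at t)"
proof -
  have "((\<lambda>t. c k * cis (real k * t)) has_vector_derivative (\<i> * of_nat k * c k) * cis (real k * t)) (at t)" for k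
  proof -
    have "((\<lambda>z. a * exp (d * z)) has_field_derivative d * a * exp (d * y)) (at y)" for a d y :: complex
      by (auto intro!: derivative_eq_intros)
    from has_vector_derivative_real_field[OF this[of "c k" "\<i> * of_nat k" "of_real t"]] show ?thesis
      by (simp add: cis_conv_exp mult.assoc)
  qed
  then have "((\<lambda>t. \<Sum>k\<in>A. c k * cis (real k * t)) has_vector_derivative (\<Sum>k\<in>A. (\<i> * of_nat k * c k) * cis (real k * t))) (at t)"
    by (intro has_vector_derivative_sum)
  from bounded_linear.has_vector_derivative[OF bounded_linear_Re this] show ?thesis
    by (simp add: has_real_derivative_iff_has_vector_derivative)
qed

text \<open>
  The derivative of the rearrangement is paired with the sine polynomial \<open>S\<close> that has the same
  first \<open>K\<close> coefficients.
\<close>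

lemma polya_szego_trig_poly:
  fixes c :: "nat \<Rightarrow> complex" and N :: nat
  defines "h \<equiv> \<lambda>t. Re (\<Sum>k\<in>{1..N}. c k * cis (real k * t))"
  assumes c1: "c 1 \<noteq> 0" and N: "N \<ge> 1"
  shows "(\<Sum>k\<in>{1..K}. (real k)\<^sup>2 * (gross_coeff (circle_distr h) k)\<^sup>2) \<le> (\<Sum>k\<in>{1..N}. (real k)\<^sup>2 * (cmod (c k))\<^sup>2)"
proof -
  define h' where "h' t = Re (\<Sum>k\<in>{1..N}. (\<i> * of_nat k * c k) * cis (real k * t))" for t
  have h: "(h has_real_derivative h' t) (at t)" for t
    unfolding h_def h'_def by (rule trig_poly_has_derivative)
  have hc: "continuous_on A h" for A
    unfolding h_def by (intro continuous_intros)
  have h'c: "continuous_on A h'" for A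
    unfolding h'_def by (intro continuous_intros)
  have hb: "h \<in> borel_measurable borel" by (rule borel_measurable_continuous_onI[OF hc])
  have level: "measure lborel {t \<in> {-pi..pi}. h t = x} = 0" for x
    using finite_imp_null_set_lborel[OF finite_trig_poly_level[of c N x]] c1 N unfolding h_def
    by (simp add: null_sets_def measure_def)
  obtain p where p: "p \<in> {-pi..pi}" "\<And>t. t \<in> {-pi..pi} \<Longrightarrow> h p \<le> h t"
    using continuous_attains_inf[OF compact_Icc _ hc, of "-pi" pi] by auto
  obtain q where q: "q \<in> {-pi..pi}" "\<And>t. t \<in> {-pi..pi} \<Longrightarrow> h t \<le> h q"
    using continuous_attains_sup[OF compact_Icc _ hc, of "-pi" pi] by auto
  let ?\<mu> = "circle_distr h"
  interpret B: bounded_real_distribution ?\<mu> "h p" "h q"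
  proof (rule bounded_real_distribution_circle_distr[OF hb q(2)])
    have "{t \<in> {-pi..pi}. h t \<le> h p} = {t \<in> {-pi..pi}. h t = h p}"
      using p(2) by force
    then show "measure lborel {t \<in> {-pi..pi}. h t \<le> h p} = 0" using level by simp
  qed
  have cdf_cont: "isCont (cdf ?\<mu>) x" for x
  proof -
    have "{-pi..pi} \<inter> h -` {x} = {t \<in> {-pi..pi}. h t = x}" by auto
    then have "measure ?\<mu> {x} = 0" using level by (simp add: measure_circle_distr hb)
    then show ?thesis by (simp add: B.isCont_cdf)
  qed
  then have F: "continuous_on A (cdf ?\<mu>)" for A
    by (intro continuous_at_imp_continuous_on) simp
  define b where "b k = real k * gross_coeff ?\<mu> k" for k
  define S where "S u = (\<Sum>k\<in>{1..K}. b k * sin (real k * (pi * u)))" for u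
  define G where "G x = S (cdf ?\<mu> x)" for x
  have Sc: "continuous_on A S" for A
    unfolding S_def by (intro continuous_intros)
  have Gc: "continuous_on A G" for A
    unfolding G_def by (intro continuous_on_compose2[OF Sc F]) auto
  have Ghc: "continuous_on A (\<lambda>t. G (h t))" for A
    by (rule continuous_on_compose2[OF Gc[of UNIV] hc]) simp
  define BB where "BB = (\<Sum>k\<in>{1..K}. (b k)\<^sup>2)"
  define E where "E = (\<Sum>k\<in>{1..N}. (real k)\<^sup>2 * (cmod (c k))\<^sup>2)"
  have le: "h p \<le> h q" using p(2)[OF q(1)] .
  have bk: "b k = - (2 / pi) * integral {h p..h q} (\<lambda>x. sin (real k * (pi * cdf ?\<mu> x)))" if "k \<in> {1..K}" for k
  proof -
    have cs: "continuous_on {h p..h q} (\<lambda>x. sin (real k * (pi * cdf ?\<mu> x)))"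
      by (intro continuous_intros F)
    have "(LBINT x:{h p..h q}. sin (real k * pi * cdf ?\<mu> x)) = integral {h p..h q} (\<lambda>x. sin (real k * (pi * cdf ?\<mu> x)))"
      unfolding mult.assoc
      by (intro set_borel_integral_eq_integral(2)) (simp add: set_integrable_def borel_integrable_compact[OF compact_Icc cs, unfolded real_scaleR_def])
    then show ?thesis
      using that B.gross_coeff_eq[of k] by (simp add: b_def)
  qed
  \<comment> \<open>Only one factor of each square is replaced by its sine integral; the other stays
    as a coefficient, and the sum assembles \<open>G\<close>, which is S evaluated at F.\<close>
  have "BB = (\<Sum>k\<in>{1..K}. - (2 / pi) * integral {h p..h q} (\<lambda>x. b k * sin (real k * (pi * cdf ?\<mu> x))))"
    unfolding BB_def
  proof (rule sum.cong[OF refl])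
    fix k assume k: "k \<in> {1..K}"
    have "(b k)\<^sup>2 = b k * (- (2 / pi) * integral {h p..h q} (\<lambda>x. sin (real k * (pi * cdf ?\<mu> x))))"
      unfolding power2_eq_square by (subst (2) bk[OF k]) simp
    then show "(b k)\<^sup>2 = - (2 / pi) * integral {h p..h q} (\<lambda>x. b k * sin (real k * (pi * cdf ?\<mu> x)))"
      by simp
  qed
  also have "\<dots> = - (2 / pi) * (\<Sum>k\<in>{1..K}. integral {h p..h q} (\<lambda>x. b k * sin (real k * (pi * cdf ?\<mu> x))))"
    by (simp only: sum_distrib_left)
  also have "(\<Sum>k\<in>{1..K}. integral {h p..h q} (\<lambda>x. b k * sin (real k * (pi * cdf ?\<mu> x)))) = integral {h p..h q} G"
    unfolding G_def S_def
    by (intro Henstock_Kurzweil_Integration.integral_sum[symmetric] integrable_continuous_real continuous_intros F) simp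
  finally have BB: "BB = - (2 / pi) * integral {h p..h q} G" .
  have "2 * \<bar>integral {h p..h q} G\<bar> \<le> integral {-pi..pi} (\<lambda>t. \<bar>G (h t) * h' t\<bar>)"
  proof (rule two_arcs_bound[OF Gc h h'c _ p(1) q(1) le])
    have "cis (real k * -pi) = cis (real k * pi)" for k
      by (simp add: complex_eq_iff)
    then show "h (-pi) = h pi" unfolding h_def by (simp only:)
  qed
  \<comment> \<open>The square integral of \<open>G\<close> along \<open>h\<close> will be
    \<open>pi * BB\<close>, so half of it can be absorbed into the left-hand side, which is at least
    \<open>pi * BB\<close>.\<close>
  also have "\<dots> \<le> integral {-pi..pi} (\<lambda>t. (G (h t))\<^sup>2 / 2 + (h' t)\<^sup>2 / 2)"
  proof (rule integral_le)
    show "(\<lambda>t. \<bar>G (h t) * h' t\<bar>) integrable_on {-pi..pi}" "(\<lambda>t. (G (h t))\<^sup>2 / 2 + (h' t)\<^sup>2 / 2) integrable_on {-pi..pi}"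
      by (intro integrable_continuous_real continuous_intros Ghc h'c; simp)+
    fix t
    have "2 * \<bar>G (h t)\<bar> * \<bar>h' t\<bar> \<le> \<bar>G (h t)\<bar>\<^sup>2 + \<bar>h' t\<bar>\<^sup>2" by (rule sum_squares_bound)
    then show "\<bar>G (h t) * h' t\<bar> \<le> (G (h t))\<^sup>2 / 2 + (h' t)\<^sup>2 / 2" by (simp add: abs_mult)
  qed
  also have "\<dots> = integral {-pi..pi} (\<lambda>t. (G (h t))\<^sup>2) / 2 + integral {-pi..pi} (\<lambda>t. (h' t)\<^sup>2) / 2"
    by (subst Henstock_Kurzweil_Integration.integral_add)
       (auto intro!: integrable_continuous_real continuous_intros Ghc h'c)
  also have "integral {-pi..pi} (\<lambda>t. (h' t)\<^sup>2) = pi * E"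
    using has_integral_Re_trig_poly_square[of "\<lambda>k. \<i> * of_nat k * c k" N] unfolding h'_def E_def
    by (simp add: integral_unique norm_mult power_mult_distrib)
  \<comment> \<open>The law of \<open>h\<close> is also the image of Lebesgue measure on (0, 1)
    under its quantile function. Composing F with that function gives the identity, so the integral
    becomes that of the square of \<open>S\<close> over [0, 1].\<close>
  also have "integral {-pi..pi} (\<lambda>t. (G (h t))\<^sup>2) = pi * BB"
  proof -
    have gh: "continuous_on {-pi..pi} (\<lambda>t. (G (h t))\<^sup>2)"
      by (intro continuous_intros Ghc)
    have "integral {-pi..pi} (\<lambda>t. (G (h t))\<^sup>2) = (LBINT t:{-pi..pi}. (G (h t))\<^sup>2)"
      by (intro set_borel_integral_eq_integral(2)[symmetric]) (simp add: set_integrable_def borel_integrable_compact[OF compact_Icc gh, unfolded real_scaleR_def])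
    also have "\<dots> = 2 * pi * (LINT x|?\<mu>. (G x)\<^sup>2)"
      by (subst integral_circle_distr[OF hb]) (auto intro!: borel_measurable_continuous_onI continuous_intros Gc)
    also have "(LINT x|?\<mu>. (G x)\<^sup>2) = (LINT u|restrict_space lborel {0<..<1}. (G (quantile ?\<mu> u))\<^sup>2)"
      unfolding quantile_def
      by (subst (1) B.distr_I_eq_M[symmetric], rule integral_distr)
         (use B.measurable_CI in \<open>auto intro!: borel_measurable_continuous_onI continuous_intros Gc simp: measurable_lborel1\<close>)
    also have "\<dots> = (LBINT u:{0<..<1}. (G (quantile ?\<mu> u))\<^sup>2)"
      by (subst integral_restrict_space) (auto simp: set_lebesgue_integral_def)
    also have "\<dots> = (LBINT u:{0<..<1}. (S u)\<^sup>2)"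
      unfolding G_def using B.cdf_quantile[OF cdf_cont] by (intro set_lebesgue_integral_cong) auto
    also have "\<dots> = integral {0<..<1} (\<lambda>u. (S u)\<^sup>2)"
    proof (rule set_borel_integral_eq_integral(2))
      have "continuous_on {0..1} (\<lambda>u. (S u)\<^sup>2)" by (intro continuous_intros Sc)
      then have "set_integrable lborel {0..1} (\<lambda>u. (S u)\<^sup>2)"
        unfolding set_integrable_def by (rule borel_integrable_compact[OF compact_Icc])
      then show "set_integrable lborel {0<..<1} (\<lambda>u. (S u)\<^sup>2)" 
        by (rule set_integrable_subset) auto
    qed
    also have "\<dots> = integral {0..1} (\<lambda>u. (S u)\<^sup>2)"
      by (rule integral_open_interval_real[symmetric])
    also have "\<dots> = BB / 2"
      using has_integral_sin_poly_square[of b K] unfolding S_def BB_def by (rule integral_unique)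
    finally show ?thesis by simp
  qed
  finally have "2 * \<bar>integral {h p..h q} G\<bar> \<le> pi * BB / 2 + pi * E / 2" .
  moreover have "pi * BB \<le> 2 * \<bar>integral {h p..h q} G\<bar>" unfolding BB by simp
  ultimately have "pi * BB \<le> pi * E" by linarith
  then have "BB \<le> E" by simp
  then show ?thesis by (simp add: BB_def E_def b_def power_mult_distrib)
qed

section \<open>From trigonometric polynomials to series of finite energy\<close>

text \<open>2 |c_k| = 2 (k |c_k|) (1/k) <= k^2 |c_k|^2 + 1/k^2 for k >= 1.\<close>

lemma summable_norm_of_dirichlet:
  fixes c :: "nat \<Rightarrow> complex"
  assumes "summable (\<lambda>k. (real k)\<^sup>2 * (cmod (c k))\<^sup>2)"
  shows "summable (\<lambda>k. cmod (c k))"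
proof (rule summable_comparison_test')
  show "summable (\<lambda>k. (real k)\<^sup>2 * (cmod (c k))\<^sup>2 + inverse (real k ^ 2))"
    by (intro summable_add assms inverse_power_summable) simp
  fix k :: nat assume "k \<ge> 1"
  then have k: "real k > 0" by simp
  have "2 * (real k * cmod (c k)) * inverse (real k) \<le> (real k * cmod (c k))\<^sup>2 + (inverse (real k))\<^sup>2"
    by (rule sum_squares_bound)
  also have "2 * (real k * cmod (c k)) * inverse (real k) = 2 * cmod (c k)" using k by simp
  finally have "2 * cmod (c k) \<le> (real k)\<^sup>2 * (cmod (c k))\<^sup>2 + inverse (real k ^ 2)"
    by (simp add: power_mult_distrib power_inverse)
  then show "norm (cmod (c k)) \<le> (real k)\<^sup>2 * (cmod (c k))\<^sup>2 + inverse (real k ^ 2)"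
    using norm_ge_zero[of "c k"] unfolding real_norm_def abs_norm_cancel by linarith
qed

text \<open>The lower end is \<open>- C - 1\<close> because \<open>h\<close> may equal
  \<open>- C\<close> on a set of positive measure, while the distribution function has to vanish at
  the lower end.\<close>

lemma bounded_real_distribution_of_bounded:
  assumes "h \<in> borel_measurable borel" "\<And>t. \<bar>h t\<bar> \<le> C"
  shows "bounded_real_distribution (circle_distr h) (- C - 1) C"
proof (rule bounded_real_distribution_circle_distr[OF assms(1)])
  show "h t \<le> C" for t using assms(2)[of t] by simp
  have "\<not> h t \<le> - C - 1" for t using assms(2)[of t] by linarith
  then have "{t \<in> {-pi..pi}. h t \<le> - C - 1} = {}" by blast
  then show "measure lborel {t \<in> {-pi..pi}. h t \<le> - C - 1} = 0" by (simp only: measure_empty)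
qed

lemma uniform_limit_cis_series:
  fixes c :: "nat \<Rightarrow> complex"
  assumes "summable (\<lambda>k. cmod (c k))"
  shows "uniform_limit UNIV (\<lambda>n t. \<Sum>k<n. c k * cis (real k * t)) (\<lambda>t. \<Sum>k. c k * cis (real k * t)) sequentially"
  by (rule Weierstrass_m_test[OF _ assms]) (simp add: norm_mult)

lemma borel_measurable_cis_series:
  fixes c :: "nat \<Rightarrow> complex"
  assumes "summable (\<lambda>k. cmod (c k))"
  shows "(\<lambda>t. Re (\<Sum>k. c k * cis (real k * t))) \<in> borel_measurable borel"
proof -
  have "continuous_on UNIV (\<lambda>t. \<Sum>k. c k * cis (real k * t))"
    by (rule uniform_limit_theorem[OF _ uniform_limit_cis_series[OF assms]])
       (auto intro!: always_eventually continuous_intros)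
  then show ?thesis by (intro borel_measurable_continuous_onI continuous_on_Re)
qed

lemma abs_cis_series_le:
  fixes c :: "nat \<Rightarrow> complex"
  assumes "summable (\<lambda>k. cmod (c k))"
  shows "\<bar>Re (\<Sum>k. c k * cis (real k * t))\<bar> \<le> (\<Sum>k. cmod (c k))"
proof -
  have nrm: "cmod (c k * cis (real k * t)) = cmod (c k)" for k by (simp add: norm_mult)
  have s: "summable (\<lambda>k. cmod (c k * cis (real k * t)))" using assms by (simp only: nrm)
  have "\<bar>Re (\<Sum>k. c k * cis (real k * t))\<bar> \<le> cmod (\<Sum>k. c k * cis (real k * t))" by (rule abs_Re_le_cmod)
  also have "\<dots> \<le> (\<Sum>k. cmod (c k * cis (real k * t)))" by (rule summable_norm[OF s])
  finally show ?thesis by (simp only: nrm)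
qed

lemma bounded_real_distribution_cis_series:
  fixes c :: "nat \<Rightarrow> complex"
  assumes "summable (\<lambda>k. cmod (c k))"
  shows "bounded_real_distribution (circle_distr (\<lambda>t. Re (\<Sum>k. c k * cis (real k * t))))
     (- (\<Sum>k. cmod (c k)) - 1) (\<Sum>k. cmod (c k))"
  by (rule bounded_real_distribution_of_bounded[OF borel_measurable_cis_series[OF assms] abs_cis_series_le[OF assms]])

text \<open>The law of the full series may have atoms, so the polynomial argument is applied to
  partial sums. For a fixed number of coefficients the bound passes to the limit, and nonnegative
  terms then allow that number to grow.\<close>

lemma polya_szego_series:
  fixes c :: "nat \<Rightarrow> complex"
  defines "h \<equiv> \<lambda>t. Re (\<Sum>k. c k * cis (real k * t))"
  assumes c1: "c 1 \<noteq> 0" and c0: "c 0 = 0" and sum: "summable (\<lambda>k. (real k)\<^sup>2 * (cmod (c k))\<^sup>2)"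
  shows "(\<Sum>k. ennreal ((real k)\<^sup>2 * (gross_coeff (circle_distr h) k)\<^sup>2)) \<le> (\<Sum>k. ennreal ((real k)\<^sup>2 * (cmod (c k))\<^sup>2))"
proof -
  define hn where "hn n t = Re (\<Sum>k<n. c k * cis (real k * t))" for n t
  define C where "C = (\<Sum>k. cmod (c k))"
  note sc = summable_norm_of_dirichlet[OF sum]
  have nrm: "cmod (c k * cis (real k * t)) = cmod (c k)" for k t by (simp add: norm_mult)
  note unif = uniform_limit_cis_series[OF sc]
  have hb: "h \<in> borel_measurable borel" unfolding h_def by (rule borel_measurable_cis_series[OF sc])
  have hnb: "hn n \<in> borel_measurable borel" for n
    unfolding hn_def by (intro borel_measurable_continuous_onI continuous_intros)
  have hC: "\<bar>h t\<bar> \<le> C" for t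
    unfolding h_def C_def by (rule abs_cis_series_le[OF sc])
  have hnC: "\<bar>hn n t\<bar> \<le> C" for n t
  proof -
    have "\<bar>hn n t\<bar> \<le> cmod (\<Sum>k<n. c k * cis (real k * t))" unfolding hn_def by (rule abs_Re_le_cmod)
    also have "\<dots> \<le> (\<Sum>k<n. cmod (c k * cis (real k * t)))" by (rule norm_sum)
    also have "\<dots> \<le> C" unfolding nrm C_def by (intro sum_le_suminf sc) auto
    finally show ?thesis .
  qed
  note B = bounded_real_distribution_of_bounded[OF hb hC] and Bn = bounded_real_distribution_of_bounded[OF hnb hnC]
  have lim: "(\<lambda>n. gross_coeff (circle_distr (hn n)) k) \<longlonglongrightarrow> gross_coeff (circle_distr h) k" for k
  proof (rule LIMSEQ_I)
    fix e :: real assume e: "e > 0"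
    have "\<forall>\<^sub>F n in sequentially. \<forall>t\<in>UNIV. dist (\<Sum>k<n. c k * cis (real k * t)) (\<Sum>k. c k * cis (real k * t)) < e / 4"
      by (rule uniform_limitD[OF unif]) (use e in simp)
    then obtain n0 where n0: "\<And>n t. n \<ge> n0 \<Longrightarrow> dist (\<Sum>k<n. c k * cis (real k * t)) (\<Sum>k. c k * cis (real k * t)) < e / 4"
      unfolding eventually_sequentially by blast
    show "\<exists>n0. \<forall>n\<ge>n0. norm (gross_coeff (circle_distr (hn n)) k - gross_coeff (circle_distr h) k) < e"
    proof (intro exI allI impI)
      fix n assume n: "n \<ge> n0"
      have cl: "\<bar>hn n t - h t\<bar> \<le> e / 4" for t
        using abs_Re_le_cmod[of "(\<Sum>k<n. c k * cis (real k * t)) - (\<Sum>k. c k * cis (real k * t))"] n0[OF n, of t]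
        unfolding hn_def h_def dist_norm minus_complex.sel by linarith
      have "\<bar>quantile (circle_distr (hn n)) u - quantile (circle_distr h) u\<bar> \<le> e / 4" if u: "0 < u" "u < 1" for u
        using quantile_circle_distr_close[OF Bn B hnb hb cl u]
          quantile_circle_distr_close[OF B Bn hb hnb cl[unfolded abs_minus_commute[of "hn n _"]] u]
        by linarith
      then have "\<bar>gross_coeff (circle_distr (hn n)) k - gross_coeff (circle_distr h) k\<bar> \<le> 2 * (e / 4)"
        by (rule gross_coeff_close[OF Bn B])
      then show "norm (gross_coeff (circle_distr (hn n)) k - gross_coeff (circle_distr h) k) < e"
        using e by simp
    qed
  qed
  have bound: "(\<Sum>k\<in>{1..K}. (real k)\<^sup>2 * (gross_coeff (circle_distr h) k)\<^sup>2) \<le> (\<Sum>k. (real k)\<^sup>2 * (cmod (c k))\<^sup>2)" for K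
  proof (rule LIMSEQ_le_const2)
    show "(\<lambda>n. \<Sum>k\<in>{1..K}. (real k)\<^sup>2 * (gross_coeff (circle_distr (hn n)) k)\<^sup>2) \<longlonglongrightarrow>
        (\<Sum>k\<in>{1..K}. (real k)\<^sup>2 * (gross_coeff (circle_distr h) k)\<^sup>2)"
      by (intro tendsto_intros lim)
    show "\<exists>N. \<forall>n\<ge>N. (\<Sum>k\<in>{1..K}. (real k)\<^sup>2 * (gross_coeff (circle_distr (hn n)) k)\<^sup>2) \<le> (\<Sum>k. (real k)\<^sup>2 * (cmod (c k))\<^sup>2)"
    \<comment> \<open>From 2 on, the partial sum contains the term of index 1, whose coefficient is
      nonzero; the term of index 0 vanishes.\<close>
    proof (intro exI[of _ 2] allI impI)
      fix n :: nat assume "n \<ge> 2"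
      then obtain N where N: "n = Suc N" "N \<ge> 1" by (cases n) auto
      have "{..<n} = insert 0 {1..N}" using N by auto
      then have "hn n = (\<lambda>t. Re (\<Sum>k\<in>{1..N}. c k * cis (real k * t)))"
        by (simp add: hn_def fun_eq_iff c0)
      then have "(\<Sum>k\<in>{1..K}. (real k)\<^sup>2 * (gross_coeff (circle_distr (hn n)) k)\<^sup>2) \<le> (\<Sum>k\<in>{1..N}. (real k)\<^sup>2 * (cmod (c k))\<^sup>2)"
        using polya_szego_trig_poly[of c N K] c1 N by simp
      also have "\<dots> \<le> (\<Sum>k. (real k)\<^sup>2 * (cmod (c k))\<^sup>2)"
        by (intro sum_le_suminf sum) auto
      finally show "(\<Sum>k\<in>{1..K}. (real k)\<^sup>2 * (gross_coeff (circle_distr (hn n)) k)\<^sup>2) \<le> (\<Sum>k. (real k)\<^sup>2 * (cmod (c k))\<^sup>2)" .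
    qed
  qed
  have "(\<Sum>k. ennreal ((real k)\<^sup>2 * (gross_coeff (circle_distr h) k)\<^sup>2)) =
      (SUP n. \<Sum>k<n. ennreal ((real k)\<^sup>2 * (gross_coeff (circle_distr h) k)\<^sup>2))"
    by (rule suminf_eq_SUP)
  also have "\<dots> \<le> ennreal (\<Sum>k. (real k)\<^sup>2 * (cmod (c k))\<^sup>2)"
  proof (rule SUP_least)
    fix n
    have "(\<Sum>k<n. (real k)\<^sup>2 * (gross_coeff (circle_distr h) k)\<^sup>2) \<le> (\<Sum>k\<in>insert 0 {1..n}. (real k)\<^sup>2 * (gross_coeff (circle_distr h) k)\<^sup>2)"
      by (intro sum_mono2) auto
    also have "\<dots> \<le> (\<Sum>k. (real k)\<^sup>2 * (cmod (c k))\<^sup>2)" using bound[of n] by simp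
    finally show "(\<Sum>k<n. ennreal ((real k)\<^sup>2 * (gross_coeff (circle_distr h) k)\<^sup>2)) \<le> ennreal (\<Sum>k. (real k)\<^sup>2 * (cmod (c k))\<^sup>2)"
      by (subst sum_ennreal) (auto intro: ennreal_leI)
  qed
  also have "\<dots> = (\<Sum>k. ennreal ((real k)\<^sup>2 * (cmod (c k))\<^sup>2))"
    by (intro suminf_ennreal2[symmetric] sum) auto
  finally show ?thesis .
qed

section \<open>Harmonic functions along sampled Brownian paths\<close>

text \<open>The sum of the increments \<open>w\<close>, stopped at its first position outside
  \<open>K\<close>. Encoding the stopping by zero increments makes position j a function of the
  first j increments, without a random index.\<close>

primrec frozen_walk :: "complex set \<Rightarrow> (nat \<Rightarrow> complex) \<Rightarrow> nat \<Rightarrow> complex" where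
  "frozen_walk K w 0 = 0"
| "frozen_walk K w (Suc j) = frozen_walk K w j + (if frozen_walk K w j \<in> K then w j else 0)"

lemma frozen_walk_restrict: "j \<le> n \<Longrightarrow> frozen_walk K (restrict w {..<n}) j = frozen_walk K w j"
  by (induction j) auto

lemma measurable_frozen_walk_PiM:
  assumes "K \<in> sets borel" "j \<le> n"
  shows "(\<lambda>w. frozen_walk K w j) \<in> borel_measurable (Pi\<^sub>M {..<n} (\<lambda>_. borel))"
  using assms(2)
proof (induction j)
  case (Suc j)
  note [measurable] = Suc.IH assms(1)
  have [measurable]: "(\<lambda>w. w j) \<in> borel_measurable (Pi\<^sub>M {..<n} (\<lambda>_. borel))"
    using Suc.prems by (intro measurable_component_singleton) simp
  show ?case using Suc.prems by simp
qed simp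

context prob_space
begin

text \<open>Position j reads only increments with index below j. This independence takes the place
  of conditioning on the past.\<close>

lemma indep_frozen_walk:
  assumes ind: "indep_vars (\<lambda>_. borel) W {..<n}" and K: "K \<in> sets borel" and j: "j < n"
  shows "indep_var borel (\<lambda>\<omega>. frozen_walk K (\<lambda>i. W i \<omega>) j) borel (W j)"
proof -
  have "indep_var (PiM {..<j} (\<lambda>_. borel)) (\<lambda>\<omega>. restrict (\<lambda>i. W i \<omega>) {..<j})
      (PiM {j} (\<lambda>_. borel)) (\<lambda>\<omega>. restrict (\<lambda>i. W i \<omega>) {j})"
    by (rule indep_var_restrict[OF ind]) (use j in auto)
  then have "indep_var borel ((\<lambda>w. frozen_walk K w j) \<circ> (\<lambda>\<omega>. restrict (\<lambda>i. W i \<omega>) {..<j}))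
      borel ((\<lambda>w. w j) \<circ> (\<lambda>\<omega>. restrict (\<lambda>i. W i \<omega>) {j}))"
    by (rule indep_var_compose) (auto intro!: measurable_frozen_walk_PiM K measurable_component_singleton)
  then show ?thesis by (simp add: o_def frozen_walk_restrict)
qed

lemma measurable_frozen_walk:
  assumes "\<And>i. i < n \<Longrightarrow> W i \<in> borel_measurable M" and K: "K \<in> sets borel" and "j \<le> n"
  shows "(\<lambda>\<omega>. frozen_walk K (\<lambda>i. W i \<omega>) j) \<in> borel_measurable M"
proof -
  have "(\<lambda>\<omega>. restrict (\<lambda>i. W i \<omega>) {..<n}) \<in> measurable M (PiM {..<n} (\<lambda>_. borel))"
    by (intro measurable_restrict) (use assms in auto)
  from measurable_compose[OF this measurable_frozen_walk_PiM[OF K \<open>j \<le> n\<close>]]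
  show ?thesis using \<open>j \<le> n\<close> by (simp add: frozen_walk_restrict)
qed

text \<open>At a position in \<open>K\<close> the first- and second-order Taylor terms have mean
  zero, because their coefficients depend on the past and W and its complex square are centred. The
  form Re(d1 w + d2 w^2), with no |w|^2 term, expresses harmonicity. Each step thus costs at most
  the cubic remainder.\<close>

lemma frozen_walk_almost_martingale:
  fixes u :: "complex \<Rightarrow> real" and W :: "nat \<Rightarrow> 'a \<Rightarrow> complex"
  assumes ind: "indep_vars (\<lambda>_. borel) W {..<n}" and K[measurable]: "K \<in> sets borel"
    and W1: "\<And>i. i < n \<Longrightarrow> integrable M (W i)" "\<And>i. i < n \<Longrightarrow> expectation (W i) = 0"
    and W2: "\<And>i. i < n \<Longrightarrow> integrable M (\<lambda>\<omega>. (W i \<omega>)\<^sup>2)" "\<And>i. i < n \<Longrightarrow> expectation (\<lambda>\<omega>. (W i \<omega>)\<^sup>2) = 0"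
    and W3: "\<And>i. i < n \<Longrightarrow> integrable M (\<lambda>\<omega>. cmod (W i \<omega>) ^ 3)"
      "\<And>i. i < n \<Longrightarrow> expectation (\<lambda>\<omega>. cmod (W i \<omega>) ^ 3) \<le> \<kappa>"
    and u[measurable]: "u \<in> borel_measurable borel" and ub: "\<And>z. \<bar>u z\<bar> \<le> B"
    and d1[measurable]: "d1 \<in> borel_measurable borel" and d1b: "\<And>z. cmod (d1 z) \<le> B1"
    and d2[measurable]: "d2 \<in> borel_measurable borel" and d2b: "\<And>z. cmod (d2 z) \<le> B2"
    and C: "C \<ge> 0"
    and taylor: "\<And>z w. z \<in> K \<Longrightarrow> \<bar>u (z + w) - u z - Re (d1 z * w + d2 z * w\<^sup>2)\<bar> \<le> C * cmod w ^ 3"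
    and j: "j \<le> n"
  shows "\<bar>expectation (\<lambda>\<omega>. u (frozen_walk K (\<lambda>i. W i \<omega>) j)) - u 0\<bar> \<le> real j * (C * \<kappa>)"
  using j
proof (induction j)
  case 0
  then show ?case by (simp add: prob_space)
next
  case (Suc j)
  then have j: "j < n" "j \<le> n" by auto
  have Wm: "i < n \<Longrightarrow> W i \<in> borel_measurable M" for i using ind by (auto simp: indep_vars_def)
  define V where "V = (\<lambda>\<omega>. frozen_walk K (\<lambda>i. W i \<omega>) j)"
  define V' where "V' = (\<lambda>\<omega>. frozen_walk K (\<lambda>i. W i \<omega>) (Suc j))"
  have [measurable]: "V \<in> borel_measurable M" "V' \<in> borel_measurable M" "W j \<in> borel_measurable M"
    unfolding V_def V'_def using Wm j Suc.prems by (auto intro!: measurable_frozen_walk[of n] K simp del: frozen_walk.simps)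
  have V': "V' \<omega> = V \<omega> + (if V \<omega> \<in> K then W j \<omega> else 0)" for \<omega>
    by (simp add: V'_def V_def)
  have indVW: "indep_var borel V borel (W j)"
    unfolding V_def by (rule indep_frozen_walk[OF ind K j(1)])
  \<comment> \<open>With the coefficients cut off outside \<open>K\<close>, a frozen step has zero
    increment and zero Taylor polynomial, so one estimate covers both cases.\<close>
  define a where "a z = (if z \<in> K then d1 z else 0)" for z
  define b where "b z = (if z \<in> K then d2 z else 0)" for z
  have [measurable]: "a \<in> borel_measurable borel" "b \<in> borel_measurable borel"
    unfolding a_def b_def by measurable
  have ab: "cmod (a z) \<le> \<bar>B1\<bar>" "cmod (b z) \<le> \<bar>B2\<bar>" for z
    using d1b[of z] d2b[of z] by (auto simp: a_def b_def)
  have ia: "integrable M (\<lambda>\<omega>. a (V \<omega>))" "integrable M (\<lambda>\<omega>. b (V \<omega>))"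
    by (rule integrable_const_bound[where B="\<bar>B1\<bar>"] integrable_const_bound[where B="\<bar>B2\<bar>"];
        use ab in simp)+
  have iu: "integrable M (\<lambda>\<omega>. u (V \<omega>))" "integrable M (\<lambda>\<omega>. u (V' \<omega>))"
    using ub by (auto intro!: integrable_const_bound[where B=B])
  have ind1: "indep_var borel (\<lambda>\<omega>. a (V \<omega>)) borel (W j)"
    using indep_var_compose[OF indVW, of a borel id borel] by (simp add: o_def)
  have ind2: "indep_var borel (\<lambda>\<omega>. b (V \<omega>)) borel (\<lambda>\<omega>. (W j \<omega>)\<^sup>2)"
    using indep_var_compose[OF indVW, of b borel "\<lambda>w. w\<^sup>2" borel] by (simp add: o_def)
  have i1: "integrable M (\<lambda>\<omega>. a (V \<omega>) * W j \<omega>)" "expectation (\<lambda>\<omega>. a (V \<omega>) * W j \<omega>) = 0"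
    using indep_var_integrable[OF ind1 ia(1) W1(1)[OF j(1)]]
      indep_var_lebesgue_integral[OF ind1 ia(1) W1(1)[OF j(1)]] W1(2)[OF j(1)] by auto
  have i2: "integrable M (\<lambda>\<omega>. b (V \<omega>) * (W j \<omega>)\<^sup>2)" "expectation (\<lambda>\<omega>. b (V \<omega>) * (W j \<omega>)\<^sup>2) = 0"
    using indep_var_integrable[OF ind2 ia(2) W2(1)[OF j(1)]]
      indep_var_lebesgue_integral[OF ind2 ia(2) W2(1)[OF j(1)]] W2(2)[OF j(1)] by auto
  define q where "q \<omega> = a (V \<omega>) * W j \<omega> + b (V \<omega>) * (W j \<omega>)\<^sup>2" for \<omega>
  have q: "integrable M q" "expectation q = 0"
    unfolding q_def using i1 i2 by auto
  have D: "\<bar>u (V' \<omega>) - u (V \<omega>) - Re (q \<omega>)\<bar> \<le> C * cmod (W j \<omega>) ^ 3" for \<omega>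
    using taylor[of "V \<omega>" "W j \<omega>"] C by (auto simp: V' q_def a_def b_def)
  have "expectation (\<lambda>\<omega>. u (V' \<omega>)) - expectation (\<lambda>\<omega>. u (V \<omega>)) =
      expectation (\<lambda>\<omega>. u (V' \<omega>) - u (V \<omega>) - Re (q \<omega>))"
    using iu q by simp
  also have "\<bar>\<dots>\<bar> \<le> expectation (\<lambda>\<omega>. \<bar>u (V' \<omega>) - u (V \<omega>) - Re (q \<omega>)\<bar>)"
    by (rule integral_abs_bound)
  also have "\<dots> \<le> expectation (\<lambda>\<omega>. C * cmod (W j \<omega>) ^ 3)"
    using D iu q W3(1)[OF j(1)] by (intro integral_mono) auto
  also have "\<dots> \<le> C * \<kappa>"
    using W3(2)[OF j(1)] C by (simp add: mult_left_mono)
  finally have "\<bar>expectation (\<lambda>\<omega>. u (V' \<omega>)) - expectation (\<lambda>\<omega>. u (V \<omega>))\<bar> \<le> C * \<kappa>" .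
  moreover have "\<bar>expectation (\<lambda>\<omega>. u (V \<omega>)) - u 0\<bar> \<le> real j * (C * \<kappa>)"
    using Suc.IH[OF j(2)] by (simp add: V_def)
  ultimately have "\<bar>expectation (\<lambda>\<omega>. u (V' \<omega>)) - u 0\<bar> \<le> real j * (C * \<kappa>) + C * \<kappa>" by linarith
  then show ?case by (simp add: V'_def algebra_simps)
qed

end

section \<open>Exit positions along refining grids\<close>

lemma frozen_walk_telescope:
  assumes "x 0 = 0" and "m \<le> j" and "\<And>i. i < m \<Longrightarrow> x i \<in> K" and "x m \<notin> K"
  shows "frozen_walk K (\<lambda>i. x (Suc i) - x i) j = x m"
proof -
  have "i \<le> m \<Longrightarrow> frozen_walk K (\<lambda>i. x (Suc i) - x i) i = x i" for i
    by (induction i) (use assms(1,3) in auto)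
  moreover have "m \<le> j \<Longrightarrow> frozen_walk K (\<lambda>i. x (Suc i) - x i) j = frozen_walk K (\<lambda>i. x (Suc i) - x i) m" for j
  proof (induction j)
    case (Suc j)
    show ?case
    proof (cases "m \<le> j")
      case True
      with Suc calculation[of m] assms(4) show ?thesis by simp
    next
      case False
      with Suc.prems have "m = Suc j" by simp
      then show ?thesis by simp
    qed
  qed simp
  ultimately show ?thesis using assms(2) by simp
qed

text \<open>The complement of \<open>K\<close> is open, so shortly after \<sigma> the path spends a
  whole time interval outside \<open>K\<close>. A fine grid hits that interval, and the first grid
  time outside \<open>K\<close> is close to \<sigma>; \<open>n * 4 ^ n\<close> steps cover the time
  span n, which is eventually long enough.\<close>

lemma frozen_walk_grid_limit:
  fixes x :: "real \<Rightarrow> complex"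
  assumes x: "continuous_on {0..} x" and x0: "x 0 = 0" and K: "closed K"
    and ex: "\<exists>t\<ge>0. x t \<notin> K"
  defines "\<sigma> \<equiv> Inf {t. 0 \<le> t \<and> x t \<notin> K}"
  shows "(\<lambda>n. frozen_walk K (\<lambda>i. x (real (Suc i) / 4 ^ n) - x (real i / 4 ^ n)) (n * 4 ^ n)) \<longlonglongrightarrow> x \<sigma>"
proof (rule LIMSEQ_I)
  fix e :: real assume e: "e > 0"
  let ?E = "{t. 0 \<le> t \<and> x t \<notin> K}"
  have ne: "?E \<noteq> {}" and bdd: "bdd_below ?E" using ex by (auto intro!: bdd_belowI[of _ 0])
  have \<sigma>0: "\<sigma> \<ge> 0" unfolding \<sigma>_def using ne by (intro cInf_greatest) auto
  obtain d where d: "d > 0" "\<And>t. t \<ge> 0 \<Longrightarrow> \<bar>t - \<sigma>\<bar> < d \<Longrightarrow> cmod (x t - x \<sigma>) < e"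
    using x \<sigma>0 e unfolding continuous_on_iff by (metis atLeast_iff dist_norm real_norm_def)
  obtain s where s: "s \<in> ?E" "s < \<sigma> + d"
    using cInf_lessD[OF ne, of "\<sigma> + d"] d(1) unfolding \<sigma>_def by auto
  have "open (- K)" using K by (rule open_Compl)
  moreover have "x s \<in> - K" using s by simp
  ultimately obtain e' where e': "e' > 0" "ball (x s) e' \<subseteq> - K" by (rule openE)
  obtain c where c: "c > 0" "\<And>t. t \<ge> 0 \<Longrightarrow> \<bar>t - s\<bar> < c \<Longrightarrow> cmod (x t - x s) < e'"
    using x s e'(1) unfolding continuous_on_iff by (metis (mono_tags) mem_Collect_eq atLeast_iff dist_norm real_norm_def)
  \<comment> \<open>The first bound keeps the path outside \<open>K\<close> after \<open>s\<close>,
    the second keeps times within \<open>d\<close> of \<sigma>.\<close>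
  define \<eta> where "\<eta> = min c (\<sigma> + d - s)"
  have \<eta>: "\<eta> > 0" using c(1) s by (simp add: \<eta>_def)
  have out: "x t \<notin> K" if "s \<le> t" "t < s + \<eta>" for t
  proof -
    have "cmod (x t - x s) < e'" using that s by (intro c(2)) (auto simp: \<eta>_def)
    then have "x t \<in> ball (x s) e'" by (simp add: dist_norm norm_minus_commute)
    then show ?thesis using e'(2) by auto
  qed
  have "\<forall>\<^sub>F n in sequentially. (1/4::real) ^ n < \<eta>"
    by (rule order_tendstoD[OF LIMSEQ_power_zero]) (use \<eta> in auto)
  moreover have "\<forall>\<^sub>F n in sequentially. s + \<eta> < real n"
    by (rule eventually_gt_at_top[THEN eventually_compose_filterlim[OF _ filterlim_real_sequentially]])
  ultimately have "\<forall>\<^sub>F n in sequentially. norm (frozen_walk K (\<lambda>i. x (real (Suc i) / 4 ^ n) - x (real i / 4 ^ n)) (n * 4 ^ n) - x \<sigma>) < e"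
  proof eventually_elim
    case (elim n)
    define g where "g i = real i / 4 ^ n" for i
    \<comment> \<open>The first grid index strictly after time \<open>s\<close>, hence at most one
      mesh width later.\<close>
    define k where "k = nat \<lfloor>s * 4 ^ n\<rfloor> + 1"
    have s0: "s * 4 ^ n \<ge> 0" using s by simp
    have k: "s * 4 ^ n < real k" "real k \<le> s * 4 ^ n + 1"
      using s0 by (auto simp: k_def) linarith+
    have k1: "s \<le> g k" using k(1) by (simp add: g_def pos_le_divide_eq less_imp_le)
    have "g k \<le> s + (1/4) ^ n" using k(2) by (simp add: g_def divide_le_eq power_divide distrib_right)
    then have k2: "g k < s + \<eta>" using elim by simp
    define m where "m = (LEAST i. x (g i) \<notin> K)"
    have m1: "x (g m) \<notin> K" unfolding m_def by (rule LeastI[of _ k]) (rule out[OF k1 k2])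
    have mk: "m \<le> k" unfolding m_def by (rule Least_le) (rule out[OF k1 k2])
    have m2: "x (g i) \<in> K" if "i < m" for i using not_less_Least[of i "\<lambda>i. x (g i) \<notin> K"] that by (auto simp: m_def)
    have g0: "g i \<ge> 0" for i by (simp add: g_def)
    have "real k < real n * 4 ^ n" using k2 elim by (simp add: g_def divide_less_eq)
        (smt (verit) mult_strict_right_mono zero_less_power)
    then have "real k < real (n * 4 ^ n)" by simp
    then have "m \<le> n * 4 ^ n" using mk by linarith
    then have "frozen_walk K (\<lambda>i. (\<lambda>i. x (g i)) (Suc i) - (\<lambda>i. x (g i)) i) (n * 4 ^ n) = x (g m)"
      using m1 m2 x0 by (intro frozen_walk_telescope) (auto simp: g_def)
    moreover have "\<sigma> \<le> g m" unfolding \<sigma>_def using m1 g0 by (intro cInf_lower bdd) auto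
    moreover have "g m \<le> g k" using mk by (simp add: g_def divide_right_mono)
    then have "g m < \<sigma> + d" using k2 by (simp add: \<eta>_def)
    ultimately show ?case using d(2)[of "g m"] g0 by (simp add: g_def)
  qed
  then show "\<exists>n0. \<forall>n\<ge>n0. norm (frozen_walk K (\<lambda>i. x (real (Suc i) / 4 ^ n) - x (real i / 4 ^ n)) (n * 4 ^ n) - x \<sigma>) < e"
    by (simp add: eventually_sequentially)
qed

section \<open>Independence and moments of planar Gaussian steps\<close>

context prob_space
begin

text \<open>All 2n real variables are merged into one independent family: \<open>XY\<close>
  separates the two components, \<open>X\<close> and \<open>Y\<close> factor each of them.
  Regrouping that family by step index gives the pairs.\<close>

lemma indep_vars_Complex:
  fixes X Y :: "nat \<Rightarrow> 'a \<Rightarrow> real"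
  assumes X: "indep_vars (\<lambda>_. borel) X {..<n}" and Y: "indep_vars (\<lambda>_. borel) Y {..<n}"
    and XY: "indep_var (Pi\<^sub>M {..<n} (\<lambda>_. borel)) (\<lambda>\<omega>. \<lambda>i\<in>{..<n}. X i \<omega>)
      (Pi\<^sub>M {..<n} (\<lambda>_. borel)) (\<lambda>\<omega>. \<lambda>i\<in>{..<n}. Y i \<omega>)"
  shows "indep_vars (\<lambda>_. borel) (\<lambda>i \<omega>. Complex (X i \<omega>) (Y i \<omega>)) {..<n}"
proof (cases "n = 0")
  case True
  then show ?thesis by (simp add: indep_vars_def indep_sets_def)
next
  case False
  then have ne: "{..<n} \<noteq> {}" by auto
  define XX where "XX j = (case j of (b, i) \<Rightarrow> if b then X i else Y i)" for j
  let ?I = "(UNIV :: bool set) \<times> {..<n}"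
  have [measurable]: "i < n \<Longrightarrow> X i \<in> borel_measurable M" "i < n \<Longrightarrow> Y i \<in> borel_measurable M" for i
    using X Y by (auto simp: indep_vars_def)
  have I: "?I = Pair True ` {..<n} \<union> Pair False ` {..<n}" by (auto simp: image_iff)
  have "indep_vars (\<lambda>_. borel) XX ?I"
  proof (subst indep_vars_finite[where E="\<lambda>_. sets borel"])
    show "?I \<noteq> {}" using ne by auto
    show "finite ?I" by simp
    show "j \<in> ?I \<Longrightarrow> random_variable borel (XX j)" for j by (auto simp: XX_def)
    show "sets (borel::real measure) = sigma_sets (space borel) (sets borel)"
      by (rule sets.sigma_sets_eq[symmetric])
    show "Int_stable (sets (borel::real measure))" by (rule sets.Int_stable)
    show "space (borel::real measure) \<in> sets borel" by simp
    show "sets (borel::real measure) \<subseteq> Pow (space borel)" by (rule sets.space_closed)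
    show "\<forall>A\<in>\<Pi> i\<in>?I. sets borel. prob (\<Inter>j\<in>?I. XX j -` A j \<inter> space M) = (\<Prod>j\<in>?I. prob (XX j -` A j \<inter> space M))"
    proof
      fix A assume "A \<in> (\<Pi> i\<in>?I. sets (borel::real measure))"
      then have A: "i < n \<Longrightarrow> A (b, i) \<in> sets borel" for b i by auto
      let ?P = "\<lambda>b. PiE {..<n} (\<lambda>i. A (b, i))"
      have P: "?P b \<in> sets (Pi\<^sub>M {..<n} (\<lambda>_. borel))" for b
        using A by (intro sets_PiM_I_finite) auto
      have pre: "(\<lambda>\<omega>. \<lambda>i\<in>{..<n}. X i \<omega>) -` ?P True \<inter> space M = (\<Inter>i\<in>{..<n}. X i -` A (True, i) \<inter> space M)"
        "(\<lambda>\<omega>. \<lambda>i\<in>{..<n}. Y i \<omega>) -` ?P False \<inter> space M = (\<Inter>i\<in>{..<n}. Y i -` A (False, i) \<inter> space M)"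
        using False by (auto simp: PiE_iff) 
      have "(\<Inter>j\<in>?I. XX j -` A j \<inter> space M) =
          (\<Inter>i\<in>{..<n}. X i -` A (True, i) \<inter> space M) \<inter> (\<Inter>i\<in>{..<n}. Y i -` A (False, i) \<inter> space M)"
        unfolding I by (simp add: INF_union XX_def image_image) blast
      also have "prob \<dots> = prob (\<Inter>i\<in>{..<n}. X i -` A (True, i) \<inter> space M) * prob (\<Inter>i\<in>{..<n}. Y i -` A (False, i) \<inter> space M)"
      proof -
        have "S -` D \<inter> space M \<inter> (T -` E \<inter> space M) = (\<lambda>\<omega>. (S \<omega>, T \<omega>)) -` (D \<times> E) \<inter> space M"
          for S T :: "'a \<Rightarrow> nat \<Rightarrow> real" and D E by auto
        then show ?thesis
          unfolding pre[symmetric] by (simp only: indep_varD[OF XY P P])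
      qed
      also have "prob (\<Inter>i\<in>{..<n}. X i -` A (True, i) \<inter> space M) = (\<Prod>i<n. prob (X i -` A (True, i) \<inter> space M))"
        using A ne by (intro indep_varsD_finite[OF X]) auto
      also have "prob (\<Inter>i\<in>{..<n}. Y i -` A (False, i) \<inter> space M) = (\<Prod>i<n. prob (Y i -` A (False, i) \<inter> space M))"
        using A ne by (intro indep_varsD_finite[OF Y]) auto
      also have "(\<Prod>i<n. prob (X i -` A (True, i) \<inter> space M)) * (\<Prod>i<n. prob (Y i -` A (False, i) \<inter> space M)) =
          (\<Prod>j\<in>?I. prob (XX j -` A j \<inter> space M))"
        unfolding I by (subst prod.union_disjoint) (auto simp: prod.reindex inj_on_def XX_def)
      finally show "prob (\<Inter>j\<in>?I. XX j -` A j \<inter> space M) = (\<Prod>j\<in>?I. prob (XX j -` A j \<inter> space M))" .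
    qed
  qed
  then have "indep_vars (\<lambda>i. PiM (UNIV \<times> {i}) (\<lambda>_. borel)) (\<lambda>i \<omega>. restrict (\<lambda>j. XX j \<omega>) (UNIV \<times> {i})) {..<n}"
    by (rule indep_vars_restrict) (auto simp: disjoint_family_on_def)
  then have "indep_vars (\<lambda>_. borel) (\<lambda>i \<omega>. (\<lambda>f. Complex (f (True, i)) (f (False, i))) (restrict (\<lambda>j. XX j \<omega>) (UNIV \<times> {i}))) {..<n}"
  proof (rule indep_vars_compose2)
    fix i
    have [measurable]: "(\<lambda>f. f (b, i)) \<in> borel_measurable (PiM (UNIV \<times> {i}) (\<lambda>_. borel :: real measure))" for b
      by (intro measurable_component_singleton) simp
    show "(\<lambda>f. Complex (f (True, i)) (f (False, i))) \<in> borel_measurable (PiM (UNIV \<times> {i}) (\<lambda>_. borel))"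
      by (subst borel_measurable_complex_iff) simp
  qed
  then show ?thesis by (simp add: XX_def)
qed

text \<open>
  The vanishing of the second complex moment is what makes harmonic functions almost invariant
  under a small Gaussian step.
\<close>

lemma complex_gaussian_moments:
  fixes A B :: "'a \<Rightarrow> real"
  assumes A: "distributed M lborel A (normal_density 0 \<sigma>)" and B: "distributed M lborel B (normal_density 0 \<sigma>)"
    and AB: "indep_var borel A borel B" and \<sigma>: "\<sigma> > 0"
  defines "W \<equiv> \<lambda>\<omega>. Complex (A \<omega>) (B \<omega>)"
  shows "integrable M W" "expectation W = 0"
    "integrable M (\<lambda>\<omega>. (W \<omega>)\<^sup>2)" "expectation (\<lambda>\<omega>. (W \<omega>)\<^sup>2) = 0"
    "integrable M (\<lambda>\<omega>. cmod (W \<omega>) ^ 3)" "expectation (\<lambda>\<omega>. cmod (W \<omega>) ^ 3) \<le> 16 * \<sigma> ^ 3"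
proof -
  have gen: "integrable M X \<and> expectation X = 0 \<and> integrable M (\<lambda>\<omega>. (X \<omega>)\<^sup>2) \<and> expectation (\<lambda>\<omega>. (X \<omega>)\<^sup>2) = \<sigma>\<^sup>2 \<and>
     integrable M (\<lambda>\<omega>. \<bar>X \<omega>\<bar> ^ 3) \<and> expectation (\<lambda>\<omega>. \<bar>X \<omega>\<bar> ^ 3) \<le> 2 * \<sigma> ^ 3"
    if X: "distributed M lborel X (normal_density 0 \<sigma>)" for X :: "'a \<Rightarrow> real"
  proof -
    note I = distributed_integrable[OF X] and E = distributed_integral[OF X]
    have m1: "(LBINT x. normal_density 0 \<sigma> x * x) = 0"
      using integral_normal_moment_odd[OF \<sigma>, of 0 0] by simp
    have m2: "(LBINT x. normal_density 0 \<sigma> x * x\<^sup>2) = \<sigma>\<^sup>2"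
      using integral_normal_moment_even[OF \<sigma>, of 0 1] by simp
    \<comment> \<open>The third absolute moment of the centred normal law is 2 \<sigma>^3 sqrt(2 /
      pi).\<close>
    have "sqrt (2 / pi) \<le> 1" using pi_ge_two by simp
    then have "2 * \<sigma> ^ 3 * sqrt (2 / pi) \<le> 2 * \<sigma> ^ 3 * 1"
      using \<sigma> by (intro mult_left_mono) auto
    then have m3: "(LBINT x. normal_density 0 \<sigma> x * \<bar>x\<bar> ^ 3) \<le> 2 * \<sigma> ^ 3"
      using integral_normal_moment_abs_odd[OF \<sigma>, of 0 1] by (simp add: eval_nat_numeral)
    show ?thesis
    proof (intro conjI)
      show "integrable M X" using I[of "\<lambda>x. x"] integrable_normal_moment[OF \<sigma>, of 0 1] by (simp add: normal_density_nonneg)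
      show "expectation X = 0" using E[of "\<lambda>x. x"] m1 by (simp add: normal_density_nonneg)
      show "integrable M (\<lambda>\<omega>. (X \<omega>)\<^sup>2)"
        using I[of "\<lambda>x. x\<^sup>2"] integrable_normal_moment[OF \<sigma>, of 0 2] by (simp add: normal_density_nonneg)
      show "expectation (\<lambda>\<omega>. (X \<omega>)\<^sup>2) = \<sigma>\<^sup>2" using E[of "\<lambda>x. x\<^sup>2"] m2 by (simp add: normal_density_nonneg)
      show "integrable M (\<lambda>\<omega>. \<bar>X \<omega>\<bar> ^ 3)"
        using I[of "\<lambda>x. \<bar>x\<bar> ^ 3"] integrable_normal_moment_abs[OF \<sigma>, of 0 3] by (simp add: normal_density_nonneg)
      show "expectation (\<lambda>\<omega>. \<bar>X \<omega>\<bar> ^ 3) \<le> 2 * \<sigma> ^ 3" using E[of "\<lambda>x. \<bar>x\<bar> ^ 3"] m3 by (simp add: normal_density_nonneg)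
    qed
  qed
  note a = gen[OF A] and b = gen[OF B]
  have mA: "A \<in> borel_measurable M" "B \<in> borel_measurable M"
    using distributed_measurable[OF A] distributed_measurable[OF B] by simp_all
  have W: "W \<omega> = of_real (A \<omega>) + \<i> * of_real (B \<omega>)" for \<omega>
    by (simp add: W_def complex_eq_iff)
  define P where "P \<omega> = (A \<omega>)\<^sup>2 - (B \<omega>)\<^sup>2" for \<omega>
  define Q where "Q \<omega> = 2 * (A \<omega> * B \<omega>)" for \<omega>
  have W2: "(W \<omega>)\<^sup>2 = of_real (P \<omega>) + \<i> * of_real (Q \<omega>)" for \<omega>
    by (simp add: W_def P_def Q_def complex_eq_iff power2_eq_square)
  have ab: "integrable M (\<lambda>\<omega>. A \<omega> * B \<omega>)" "expectation (\<lambda>\<omega>. A \<omega> * B \<omega>) = 0"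
    using indep_var_integrable[OF AB] indep_var_lebesgue_integral[OF AB] a b by auto
  have PQ: "integrable M P" "expectation P = 0" "integrable M Q" "expectation Q = 0"
    unfolding P_def Q_def using a b ab by auto
  show "integrable M W" unfolding W using a b by auto
  show "expectation W = 0" unfolding W using a b by simp
  show "integrable M (\<lambda>\<omega>. (W \<omega>)\<^sup>2)" unfolding W2 using PQ by auto
  show "expectation (\<lambda>\<omega>. (W \<omega>)\<^sup>2) = 0" unfolding W2 using PQ by simp
  \<comment> \<open>The constant 16 arises as 4 * 2 + 4 * 2, with weight 4 from this convexity bound
    and third moments at most 2 \<sigma>^3.\<close>
  have cube: "cmod (W \<omega>) ^ 3 \<le> 4 * \<bar>A \<omega>\<bar> ^ 3 + 4 * \<bar>B \<omega>\<bar> ^ 3" for \<omega>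
  proof -
    have "(s + t) ^ 3 \<le> 4 * s ^ 3 + 4 * t ^ 3" if "s \<ge> 0" "t \<ge> 0" for s t :: real
    proof -
      have "4 * s ^ 3 + 4 * t ^ 3 - (s + t) ^ 3 = 3 * (s + t) * (s - t)\<^sup>2"
        by (simp add: power2_eq_square power3_eq_cube algebra_simps)
      also have "\<dots> \<ge> 0" using that by simp
      finally show ?thesis by simp
    qed
    then have "(\<bar>A \<omega>\<bar> + \<bar>B \<omega>\<bar>) ^ 3 \<le> 4 * \<bar>A \<omega>\<bar> ^ 3 + 4 * \<bar>B \<omega>\<bar> ^ 3" by simp
    moreover have "cmod (W \<omega>) ^ 3 \<le> (\<bar>A \<omega>\<bar> + \<bar>B \<omega>\<bar>) ^ 3"
      using cmod_le[of "W \<omega>"] by (intro power_mono) (auto simp: W_def)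
    ultimately show ?thesis by linarith
  qed
  have Wm: "W \<in> borel_measurable M" unfolding W_def using mA by (subst borel_measurable_complex_iff) simp
  have iab: "integrable M (\<lambda>\<omega>. 4 * \<bar>A \<omega>\<bar> ^ 3 + 4 * \<bar>B \<omega>\<bar> ^ 3)" using a b by simp
  show i3: "integrable M (\<lambda>\<omega>. cmod (W \<omega>) ^ 3)"
    by (rule Bochner_Integration.integrable_bound[OF iab])
       (use cube Wm in \<open>auto intro!: AE_I2 borel_measurable_power borel_measurable_norm\<close>)
  have "expectation (\<lambda>\<omega>. cmod (W \<omega>) ^ 3) \<le> expectation (\<lambda>\<omega>. 4 * \<bar>A \<omega>\<bar> ^ 3 + 4 * \<bar>B \<omega>\<bar> ^ 3)"
    using i3 iab cube by (intro integral_mono) auto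
  also have "\<dots> = 4 * expectation (\<lambda>\<omega>. \<bar>A \<omega>\<bar> ^ 3) + 4 * expectation (\<lambda>\<omega>. \<bar>B \<omega>\<bar> ^ 3)"
    using a b by simp
  also have "\<dots> \<le> 16 * \<sigma> ^ 3" using a b by linarith
  finally show "expectation (\<lambda>\<omega>. cmod (W \<omega>) ^ 3) \<le> 16 * \<sigma> ^ 3" .
qed

end

text \<open>Independence of the real and imaginary parts is given for whole paths; \<phi> reads the
  grid increments off a path measurably and so transports it to finite families.\<close>

lemma (in planar_brownian_motion) grid_increments:
  fixes d :: real and n :: nat
  assumes d: "d > 0"
  defines "W \<equiv> \<lambda>i \<omega>. Z (real (Suc i) * d) \<omega> - Z (real i * d) \<omega>"
  shows "indep_vars (\<lambda>_. borel) W {..<n}"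
    "integrable M (W i)" "expectation (W i) = 0"
    "integrable M (\<lambda>\<omega>. (W i \<omega>)\<^sup>2)" "expectation (\<lambda>\<omega>. (W i \<omega>)\<^sup>2) = 0"
    "integrable M (\<lambda>\<omega>. cmod (W i \<omega>) ^ 3)" "expectation (\<lambda>\<omega>. cmod (W i \<omega>) ^ 3) \<le> 16 * sqrt d ^ 3"
proof -
  interpret R: standard_brownian_motion M "\<lambda>t \<omega>. Re (Z t \<omega>)" by (rule Re_brownian)
  interpret I: standard_brownian_motion M "\<lambda>t \<omega>. Im (Z t \<omega>)" by (rule Im_brownian)
  define X where "X i \<omega> = Re (Z (real (Suc i) * d) \<omega>) - Re (Z (real i * d) \<omega>)" for i \<omega>
  define Y where "Y i \<omega> = Im (Z (real (Suc i) * d) \<omega>) - Im (Z (real i * d) \<omega>)" for i \<omega>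
  have W: "W i = (\<lambda>\<omega>. Complex (X i \<omega>) (Y i \<omega>))" for i
    by (simp add: W_def X_def Y_def fun_eq_iff complex_eq_iff)
  define \<phi> where "\<phi> n f = (\<lambda>i\<in>{..<n}. f (real (Suc i) * d) - f (real i * d) :: real)" for n :: nat and f
  have \<phi>: "\<phi> n \<in> measurable (Pi\<^sub>M {0..} (\<lambda>_. borel)) (Pi\<^sub>M {..<n} (\<lambda>_. borel))" for n
  proof -
    have "(\<lambda>f. f t) \<in> borel_measurable (Pi\<^sub>M {0..} (\<lambda>_. borel :: real measure))" if "t \<ge> 0" for t :: real
      using that by (intro measurable_component_singleton) simp
    then show ?thesis unfolding \<phi>_def using d by (intro measurable_restrict borel_measurable_diff) simp_all
  qed
  have XY: "indep_var (Pi\<^sub>M {..<n} (\<lambda>_. borel)) (\<lambda>\<omega>. \<lambda>i\<in>{..<n}. X i \<omega>)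
      (Pi\<^sub>M {..<n} (\<lambda>_. borel)) (\<lambda>\<omega>. \<lambda>i\<in>{..<n}. Y i \<omega>)" for n
    using indep_var_compose[OF Re_Im_independent \<phi>[of n] \<phi>[of n]] d
    by (simp add: \<phi>_def o_def X_def Y_def cong: restrict_cong)
  have Xi: "indep_vars (\<lambda>_. borel) X {..<n}" for n
    using R.independent_increments[of "\<lambda>i. real i * d" n] d unfolding X_def by simp
  have Yi: "indep_vars (\<lambda>_. borel) Y {..<n}" for n
    using I.independent_increments[of "\<lambda>i. real i * d" n] d unfolding Y_def by simp
  show "indep_vars (\<lambda>_. borel) W {..<n}"
    unfolding W by (rule indep_vars_Complex[OF Xi Yi XY])
  have dX: "distributed M lborel (X i) (normal_density 0 (sqrt d))" for i
    using R.gaussian_increments[of "real i * d" "real (Suc i) * d"] d unfolding X_def by (simp add: algebra_simps)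
  have dY: "distributed M lborel (Y i) (normal_density 0 (sqrt d))" for i
    using I.gaussian_increments[of "real i * d" "real (Suc i) * d"] d unfolding Y_def by (simp add: algebra_simps)
  have XYi: "indep_var borel (X i) borel (Y i)" for i
  proof -
    have "(\<lambda>f. f i) \<in> borel_measurable (Pi\<^sub>M {..<Suc i} (\<lambda>_. borel :: real measure))"
      by (intro measurable_component_singleton) simp
    from indep_var_compose[OF XY[of "Suc i"] this this] show ?thesis by (simp add: o_def)
  qed
  have sd: "sqrt d > 0" using d by simp
  note m = complex_gaussian_moments[OF dX dY XYi sd, of i, folded W]
  show "integrable M (W i)" "expectation (W i) = 0"
    "integrable M (\<lambda>\<omega>. (W i \<omega>)\<^sup>2)" "expectation (\<lambda>\<omega>. (W i \<omega>)\<^sup>2) = 0"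
    "integrable M (\<lambda>\<omega>. cmod (W i \<omega>) ^ 3)" "expectation (\<lambda>\<omega>. cmod (W i \<omega>) ^ 3) \<le> 16 * sqrt d ^ 3"
    using m unfolding W by simp_all
qed

section \<open>A global cubic Taylor estimate\<close>

text \<open>Gaussian steps are unbounded, so the estimate must hold for every w, including those
  leading out of U, where \<open>u\<close> is zero. Small w are handled by Cauchy estimates; for |w|
  >= r all terms are bounded by multiples of |w|^3, since |w| / r >= 1.\<close>

lemma Re_holomorphic_taylor_bound:
  assumes U: "open U" and G: "G holomorphic_on U" and B: "\<And>z. z \<in> U \<Longrightarrow> cmod (G z) \<le> B"
    and K: "compact K" "K \<subseteq> U"
  defines "u \<equiv> \<lambda>z. if z \<in> U then Re (G z) else 0"
  obtains C B1 B2 where "C \<ge> 0" "\<And>z. z \<in> K \<Longrightarrow> cmod (deriv G z) \<le> B1"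
    "\<And>z. z \<in> K \<Longrightarrow> cmod (deriv (deriv G) z / 2) \<le> B2"
    "\<And>z w. z \<in> K \<Longrightarrow> \<bar>u (z + w) - u z - Re (deriv G z * w + deriv (deriv G) z / 2 * w\<^sup>2)\<bar> \<le> C * cmod w ^ 3"
proof -
  obtain e0 where e0: "e0 > 0" "(\<Union>x\<in>K. cball x e0) \<subseteq> U"
    using compact_subset_open_imp_cball_epsilon_subset[OF K(1) U K(2)] by blast
  \<comment> \<open>Halving leaves room for a Cauchy disc of radius \<open>r\<close> around every
    point of \<open>ball z r\<close>.\<close>
  define r where "r = e0 / 2"
  have r: "r > 0" using e0 by (simp add: r_def)
  have near: "cball x r \<subseteq> U" if "z \<in> K" "x \<in> ball z r" for x z
  proof
    fix y assume "y \<in> cball x r"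
    then have "dist z y \<le> e0" using that dist_triangle[of z y x] by (auto simp: r_def)
    then have "y \<in> cball z e0" by simp
    then show "y \<in> U" using e0(2) that(1) by blast
  qed
  \<comment> \<open>The Cauchy bound asks for values in an open ball, hence the strict
    enlargement.\<close>
  define B' where "B' = \<bar>B\<bar> + 1"
  have bd: "cmod ((deriv ^^ n) G x) \<le> fact n * B' / r ^ n" if "z \<in> K" "x \<in> ball z r" "n > 0" for n x z
  proof (rule Cauchy_higher_deriv_bound[OF _ _ _ r \<open>n > 0\<close>])
    note N = near[OF that(1,2)]
    show "G holomorphic_on ball x r" using G N by (rule holomorphic_on_subset[OF _ subset_trans[OF ball_subset_cball]])
    show "continuous_on (cball x r) G" using G N by (intro holomorphic_on_imp_continuous_on) (rule holomorphic_on_subset)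
    show "G w \<in> ball 0 B'" if "w \<in> ball x r" for w
      using B[of w] N that by (force simp: B'_def)
  qed
  have B'0: "B' > 0" by (simp add: B'_def)
  define c1 where "c1 = B' / r"
  define c2 where "c2 = B' / r\<^sup>2"
  \<comment> \<open>The factor 3 is 3! / 2!: Cauchy's bound for the third derivative carries 3!, the
    Taylor remainder divides by 2!. \<open>C2\<close> collects the three terms of the case |w| >=
    r.\<close>
  define C1 where "C1 = 3 * B' / r ^ 3"
  define C2 where "C2 = 2 * B' / r ^ 3 + c1 / r\<^sup>2 + c2 / r"
  have pos: "c1 > 0" "c2 > 0" "C1 > 0" "C2 > 0" using r B'0 by (auto simp: c1_def c2_def C1_def C2_def intro!: add_pos_pos)
  have d1: "cmod (deriv G z) \<le> c1" if "z \<in> K" for z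
    using bd[OF that, of z 1] r by (simp add: c1_def)
  have d2: "cmod (deriv (deriv G) z / 2) \<le> c2" if "z \<in> K" for z
    using bd[OF that, of z 2] r by (simp add: c2_def numeral_2_eq_2 norm_divide mult.commute)
  have main: "\<bar>u (z + w) - u z - Re (deriv G z * w + deriv (deriv G) z / 2 * w\<^sup>2)\<bar> \<le> (C1 + C2) * cmod w ^ 3"
    if z: "z \<in> K" for z w
  proof (cases "cmod w < r")
    case True
    have zw: "z + w \<in> ball z r" "z \<in> ball z r" using True r by (auto simp: dist_norm)
    have "cmod ((deriv ^^ 0) G (z + w) - (\<Sum>i\<le>2. (deriv ^^ i) G z * (z + w - z) ^ i / fact i))
        \<le> (fact 3 * B' / r ^ 3) * cmod (z + w - z) ^ Suc 2 / fact 2"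
    proof (rule complex_Taylor[where S="ball z r" and f="\<lambda>i. (deriv ^^ i) G"])
      fix i x assume x: "x \<in> ball z r"
      have "(deriv ^^ i) G holomorphic_on U" by (rule holomorphic_higher_deriv[OF G U])
      moreover have "x \<in> U" using near[OF z x] r by auto
      ultimately have "((deriv ^^ i) G has_field_derivative deriv ((deriv ^^ i) G) x) (at x)"
        using U holomorphic_derivI by blast
      then show "((deriv ^^ i) G has_field_derivative (deriv ^^ Suc i) G x) (at x within ball z r)"
        by (auto intro: has_field_derivative_at_within)
    next
      fix x assume "x \<in> ball z r"
      from bd[OF z this, of "Suc 2"] show "cmod ((deriv ^^ Suc 2) G x) \<le> fact 3 * B' / r ^ 3"
        by (simp add: eval_nat_numeral del: fact_Suc)
    qed (use zw in auto)
    also have "(fact 3 * B' / r ^ 3) * cmod (z + w - z) ^ Suc 2 / fact 2 \<le> C1 * cmod w ^ 3"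
      using B'0 r by (simp add: C1_def eval_nat_numeral mult.assoc)
    also have "(deriv ^^ 0) G (z + w) - (\<Sum>i\<le>2. (deriv ^^ i) G z * (z + w - z) ^ i / fact i) =
        G (z + w) - G z - (deriv G z * w + deriv (deriv G) z / 2 * w\<^sup>2)"
      by (simp add: numeral_2_eq_2)
    finally have "cmod (G (z + w) - G z - (deriv G z * w + deriv (deriv G) z / 2 * w\<^sup>2)) \<le> C1 * cmod w ^ 3" .
    moreover have "\<bar>Re (G (z + w) - G z - (deriv G z * w + deriv (deriv G) z / 2 * w\<^sup>2))\<bar> \<le>
        cmod (G (z + w) - G z - (deriv G z * w + deriv (deriv G) z / 2 * w\<^sup>2))"
      by (rule abs_Re_le_cmod)
    moreover have "C1 * cmod w ^ 3 \<le> (C1 + C2) * cmod w ^ 3"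
      using pos by (intro mult_right_mono) auto
    moreover have "z \<in> U" "z + w \<in> U" using near[OF z zw(2)] near[OF z zw(1)] r by auto
    ultimately show ?thesis unfolding u_def by (simp only: if_True minus_complex.sel)
  next
    case False
    then have w: "r \<le> cmod w" by simp
    have ub: "\<bar>u y\<bar> \<le> B'" for y
      using B[of y] abs_Re_le_cmod[of "G y"] by (auto simp: u_def B'_def)
    have r1: "1 \<le> cmod w / r" using w r by simp
    have p: "1 \<le> (cmod w / r) ^ 3" "1 \<le> (cmod w / r) ^ 2" using r1 by (auto intro: one_le_power)
    have "\<bar>u (z + w) - u z\<bar> \<le> 2 * B' * 1" using ub[of "z + w"] ub[of z] by linarith
    also have "\<dots> \<le> 2 * B' * (cmod w / r) ^ 3" using p B'0 by (intro mult_left_mono) auto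
    also have "\<dots> = 2 * B' / r ^ 3 * cmod w ^ 3" by (simp add: power_divide)
    finally have 1: "\<bar>u (z + w) - u z\<bar> \<le> 2 * B' / r ^ 3 * cmod w ^ 3" .
    have "cmod (deriv G z * w) \<le> c1 * cmod w * 1"
      using d1[OF z] by (simp add: norm_mult mult_right_mono)
    also have "\<dots> \<le> c1 * cmod w * (cmod w / r) ^ 2" using p pos by (intro mult_left_mono) auto
    also have "\<dots> = c1 / r\<^sup>2 * cmod w ^ 3" by (simp add: power_divide eval_nat_numeral)
    finally have 2: "cmod (deriv G z * w) \<le> c1 / r\<^sup>2 * cmod w ^ 3" .
    have "cmod (deriv (deriv G) z / 2 * w\<^sup>2) \<le> c2 * cmod w ^ 2 * 1"
      unfolding norm_mult norm_power by (rule order_trans[OF mult_right_mono[OF d2[OF z]]]) simp_all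
    also have "\<dots> \<le> c2 * cmod w ^ 2 * (cmod w / r)" using r1 pos by (intro mult_left_mono) auto
    also have "\<dots> = c2 / r * cmod w ^ 3" by (simp add: eval_nat_numeral)
    finally have 3: "cmod (deriv (deriv G) z / 2 * w\<^sup>2) \<le> c2 / r * cmod w ^ 3" .
    have "\<bar>Re (deriv G z * w + deriv (deriv G) z / 2 * w\<^sup>2)\<bar> \<le> cmod (deriv G z * w) + cmod (deriv (deriv G) z / 2 * w\<^sup>2)"
      by (rule order_trans[OF abs_Re_le_cmod norm_triangle_ineq])
    then have "\<bar>u (z + w) - u z - Re (deriv G z * w + deriv (deriv G) z / 2 * w\<^sup>2)\<bar> \<le>
        2 * B' / r ^ 3 * cmod w ^ 3 + c1 / r\<^sup>2 * cmod w ^ 3 + c2 / r * cmod w ^ 3"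
      using 1 2 3 by linarith
    also have "\<dots> = C2 * cmod w ^ 3" by (simp add: C2_def distrib_right)
    also have "\<dots> \<le> (C1 + C2) * cmod w ^ 3" using pos by (intro mult_right_mono) auto
    finally show ?thesis .
  qed
  show thesis
    by (rule that[of "C1 + C2" c1 c2]) (use pos d1 d2 main in auto)
qed

section \<open>Exit points of planar Brownian motion from compact sets\<close>

context planar_brownian_motion
begin

lemma borel_measurable_Z: "t \<ge> 0 \<Longrightarrow> Z t \<in> borel_measurable M"
  using standard_brownian_motion.measurable_at[OF Re_brownian] standard_brownian_motion.measurable_at[OF Im_brownian]
  by (subst borel_measurable_complex_iff) auto

lemma continuous_path: "\<omega> \<in> space M \<Longrightarrow> continuous_on {0..} (\<lambda>t. Z t \<omega>)"
proof -
  assume "\<omega> \<in> space M"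
  then have "continuous_on {0..} (\<lambda>t. Complex (Re (Z t \<omega>)) (Im (Z t \<omega>)))"
    using standard_brownian_motion.continuous_paths[OF Re_brownian] standard_brownian_motion.continuous_paths[OF Im_brownian]
    by (intro continuous_on_Complex) auto
  then show ?thesis by simp
qed

lemma AE_starts_at_0: "AE \<omega> in M. Z 0 \<omega> = 0"
  using standard_brownian_motion.starts_at_0[OF Re_brownian] standard_brownian_motion.starts_at_0[OF Im_brownian]
  by eventually_elim (simp add: complex_eq_iff)

text \<open>At time n + 1 the real part of the increment has a density at most 1 / sqrt(n + 1), so
  remaining in [-r, r] at all integer times has probability at most 2 r / sqrt(n + 1) for every n.
  The increment from time 0 is used because the path starts at 0 only almost surely.\<close>

lemma AE_exit_bounded:
  assumes K: "bounded K"
  shows "AE \<omega> in M. \<exists>t\<ge>0. Z t \<omega> - Z 0 \<omega> \<notin> K"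
proof -
  interpret R: standard_brownian_motion M "\<lambda>t \<omega>. Re (Z t \<omega>)" by (rule Re_brownian)
  obtain r where r: "r > 0" "\<And>z. z \<in> K \<Longrightarrow> cmod z \<le> r"
    using K unfolding bounded_pos by auto
  define X where "X n \<omega> = Re (Z (real (Suc n)) \<omega>) - Re (Z 0 \<omega>)" for n \<omega>
  have Xm[measurable]: "X n \<in> borel_measurable M" for n
    unfolding X_def using R.measurable_at by (intro borel_measurable_diff) auto
  define N where "N = {\<omega> \<in> space M. \<forall>n. X n \<omega> \<in> {-r..r}}"
  have Nm: "N \<in> sets M" unfolding N_def by measurable
  have est: "emeasure M N \<le> ennreal (2 * r / sqrt (real (Suc n)))" for n
  proof -
    have d: "distributed M lborel (X n) (normal_density 0 (sqrt (real (Suc n))))"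
      using R.gaussian_increments[of 0 "real (Suc n)"] unfolding X_def by simp
    have "emeasure M N \<le> emeasure M (X n -` {-r..r} \<inter> space M)"
      by (rule emeasure_mono) (auto simp: N_def)
    also have "\<dots> = (\<integral>\<^sup>+x. ennreal (normal_density 0 (sqrt (real (Suc n))) x) * indicator {-r..r} x \<partial>lborel)"
      by (rule distributed_emeasure[OF d]) simp
    also have "\<dots> \<le> (\<integral>\<^sup>+x. ennreal (1 / sqrt (real (Suc n))) * indicator {-r..r} x \<partial>lborel)"
    proof (intro nn_integral_mono mult_right_mono ennreal_leI)
      fix x
      have "normal_density 0 (sqrt (real (Suc n))) x = 1 / sqrt (2 * pi * real (Suc n)) * exp (- x\<^sup>2 / (2 * real (Suc n)))"
        by (simp add: normal_density_def)
      also have "\<dots> \<le> 1 / sqrt (2 * pi * real (Suc n)) * 1"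
        by (intro mult_left_mono) auto
      also have "\<dots> \<le> 1 / sqrt (real (Suc n))"
      proof -
        have "real (Suc n) \<le> 2 * pi * real (Suc n)" using pi_ge_two by simp
        then show ?thesis by (simp add: frac_le del: of_nat_Suc)
      qed
      finally show "normal_density 0 (sqrt (real (Suc n))) x \<le> 1 / sqrt (real (Suc n))" .
    qed simp
    also have "\<dots> = ennreal (1 / sqrt (real (Suc n))) * emeasure lborel {-r..r}"
      by (rule nn_integral_cmult_indicator) simp
    also have "\<dots> = ennreal (2 * r / sqrt (real (Suc n)))"
      using r by (simp add: ennreal_mult[symmetric] del: of_nat_Suc)
    finally show ?thesis .
  qed
  have "(\<lambda>n. 2 * r / sqrt (real (Suc n))) \<longlonglongrightarrow> 0"
    by (rule LIMSEQ_Suc[where f="\<lambda>n. 2 * r / sqrt (real n)"])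
       (intro real_tendsto_divide_at_top[OF tendsto_const] filterlim_compose[OF sqrt_at_top filterlim_real_sequentially])
  then have "(\<lambda>n. ennreal (2 * r / sqrt (real (Suc n)))) \<longlonglongrightarrow> ennreal 0" by (rule tendsto_ennrealI)
  then have "emeasure M N \<le> ennreal 0"
    by (rule LIMSEQ_le_const) (use est in blast)
  then have "N \<in> null_sets M" using Nm by (simp add: null_sets_def)
  then have "AE \<omega> in M. \<omega> \<notin> N" by (rule AE_not_in)
  then show ?thesis
  proof (rule AE_mp, intro AE_I2 impI)
    fix \<omega> assume "\<omega> \<in> space M" "\<omega> \<notin> N"
    then obtain n where n: "X n \<omega> \<notin> {-r..r}" unfolding N_def by blast
    then have "Z (real (Suc n)) \<omega> - Z 0 \<omega> \<notin> K"
      using r(2)[of "Z (real (Suc n)) \<omega> - Z 0 \<omega>"] abs_Re_le_cmod[of "Z (real (Suc n)) \<omega> - Z 0 \<omega>"]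
      by (force simp: X_def abs_le_iff)
    then show "\<exists>t\<ge>0. Z t \<omega> - Z 0 \<omega> \<notin> K" by (intro exI[of _ "real (Suc n)"]) simp
  qed
qed

text \<open>
  Defined as a limit along grids in order to be measurable; almost surely this is the position of
  \<open>Z - Z 0\<close> at its exit time from \<open>K\<close>.
\<close>

definition exit_point :: "complex set \<Rightarrow> 'a \<Rightarrow> complex" where
  "exit_point K \<omega> = lim (\<lambda>n. frozen_walk K (\<lambda>i. Z (real (Suc i) / 4 ^ n) \<omega> - Z (real i / 4 ^ n) \<omega>) (n * 4 ^ n))"

lemma measurable_grid_walk:
  assumes "K \<in> sets borel"
  shows "(\<lambda>\<omega>. frozen_walk K (\<lambda>i. Z (real (Suc i) / 4 ^ n) \<omega> - Z (real i / 4 ^ n) \<omega>) j) \<in> borel_measurable M"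
  by (rule measurable_frozen_walk[OF _ assms order_refl])
     (intro borel_measurable_diff borel_measurable_Z; simp)

lemma measurable_exit_point:
  assumes "K \<in> sets borel" shows "exit_point K \<in> borel_measurable M"
  unfolding exit_point_def by (intro borel_measurable_lim_metric measurable_grid_walk assms)

text \<open>Grid increments do not see the starting point, so the deterministic limit is applied to
  the path shifted to start at 0.\<close>

lemma grid_walk_tendsto:
  assumes "closed K" and \<omega>: "\<omega> \<in> space M" and ex: "\<exists>t\<ge>0. Z t \<omega> - Z 0 \<omega> \<notin> K"
  defines "\<sigma> \<equiv> Inf {t. 0 \<le> t \<and> Z t \<omega> - Z 0 \<omega> \<notin> K}"
  shows "(\<lambda>n. frozen_walk K (\<lambda>i. Z (real (Suc i) / 4 ^ n) \<omega> - Z (real i / 4 ^ n) \<omega>) (n * 4 ^ n)) \<longlonglongrightarrow> Z \<sigma> \<omega> - Z 0 \<omega>"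
    and "exit_point K \<omega> = Z \<sigma> \<omega> - Z 0 \<omega>"
proof -
  have "(\<lambda>n. frozen_walk K (\<lambda>i. (\<lambda>t. Z t \<omega> - Z 0 \<omega>) (real (Suc i) / 4 ^ n) - (\<lambda>t. Z t \<omega> - Z 0 \<omega>) (real i / 4 ^ n)) (n * 4 ^ n))
      \<longlonglongrightarrow> (\<lambda>t. Z t \<omega> - Z 0 \<omega>) (Inf {t. 0 \<le> t \<and> (\<lambda>t. Z t \<omega> - Z 0 \<omega>) t \<notin> K})"
    by (rule frozen_walk_grid_limit) (use assms in \<open>auto intro!: continuous_intros continuous_path\<close>)
  then show lim: "(\<lambda>n. frozen_walk K (\<lambda>i. Z (real (Suc i) / 4 ^ n) \<omega> - Z (real i / 4 ^ n) \<omega>) (n * 4 ^ n)) \<longlonglongrightarrow> Z \<sigma> \<omega> - Z 0 \<omega>"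
    by (simp add: \<sigma>_def)
  then show "exit_point K \<omega> = Z \<sigma> \<omega> - Z 0 \<omega>" unfolding exit_point_def by (rule limI)
qed

end

text \<open>A position outside the closed set would be preceded by earlier times outside it; a
  position in the interior would keep the path in \<open>K\<close> for a while after
  \<sigma>.\<close>

lemma exit_position_in_frontier:
  fixes x :: "real \<Rightarrow> complex"
  assumes x: "continuous_on {0..} x" and K: "closed K" and x0: "x 0 \<in> K" and ex: "\<exists>t\<ge>0. x t \<notin> K"
  defines "\<sigma> \<equiv> Inf {t. 0 \<le> t \<and> x t \<notin> K}"
  shows "0 \<le> \<sigma>" "x \<sigma> \<in> K" "x \<sigma> \<notin> interior K" "\<And>t. 0 \<le> t \<Longrightarrow> t < \<sigma> \<Longrightarrow> x t \<in> K"
proof -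
  let ?E = "{t. 0 \<le> t \<and> x t \<notin> K}"
  have ne: "?E \<noteq> {}" and bdd: "bdd_below ?E" using ex by (auto intro!: bdd_belowI[of _ 0])
  show s0: "\<sigma> \<ge> 0" unfolding \<sigma>_def using ne by (intro cInf_greatest) auto
  show before: "x t \<in> K" if "0 \<le> t" "t < \<sigma>" for t
    using that cInf_lower[OF _ bdd, of t] unfolding \<sigma>_def by force
  show "x \<sigma> \<in> K"
  proof (rule ccontr)
    assume n: "x \<sigma> \<notin> K"
    then have "\<sigma> \<noteq> 0" using x0 by auto
    then have pos: "\<sigma> > 0" using s0 by simp
    obtain e where e: "e > 0" "ball (x \<sigma>) e \<subseteq> - K" using n K openE[OF open_Compl[OF K], of "x \<sigma>"] by auto
    obtain d where d: "d > 0" "\<And>t. t \<ge> 0 \<Longrightarrow> \<bar>t - \<sigma>\<bar> < d \<Longrightarrow> cmod (x t - x \<sigma>) < e"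
      using x s0 e(1) unfolding continuous_on_iff by (metis atLeast_iff dist_norm real_norm_def)
    define t where "t = max 0 (\<sigma> - d / 2)"
    have "0 \<le> t" "t < \<sigma>" "\<bar>t - \<sigma>\<bar> < d" using pos d(1) by (auto simp: t_def max_def)
    then have "x t \<in> K" "cmod (x t - x \<sigma>) < e" using before d(2) by blast+
    then have "x t \<in> K" "x t \<in> ball (x \<sigma>) e" by (simp_all add: dist_norm norm_minus_commute)
    then show False using e(2) by auto
  qed
  show "x \<sigma> \<notin> interior K"
  proof
    assume "x \<sigma> \<in> interior K"
    then obtain e where e: "e > 0" "ball (x \<sigma>) e \<subseteq> K" unfolding mem_interior by blast
    obtain d where d: "d > 0" "\<And>t. t \<ge> 0 \<Longrightarrow> \<bar>t - \<sigma>\<bar> < d \<Longrightarrow> cmod (x t - x \<sigma>) < e"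
      using x s0 e(1) unfolding continuous_on_iff by (metis atLeast_iff dist_norm real_norm_def)
    obtain s where s: "s \<in> ?E" "s < \<sigma> + d"
      using cInf_lessD[OF ne, of "\<sigma> + d"] d(1) unfolding \<sigma>_def by auto
    have "\<sigma> \<le> s" unfolding \<sigma>_def using s by (intro cInf_lower bdd)
    then have "cmod (x s - x \<sigma>) < e" using d(2)[of s] s by simp
    then have "x s \<in> ball (x \<sigma>) e" by (simp add: dist_norm norm_minus_commute)
    then show False using e(2) s by auto
  qed
qed

text \<open>The sampled walk may overshoot U, but its limit lies in \<open>K\<close>, inside the
  open set where the cut-off function is continuous. Bounded convergence therefore carries the
  approximate identity to the exit point.\<close>

lemma (in planar_brownian_motion) expectation_exit_point:
  assumes U: "open U" and G: "G holomorphic_on U" and B: "\<And>z. z \<in> U \<Longrightarrow> cmod (G z) \<le> B"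
    and K: "compact K" "K \<subseteq> U" "0 \<in> K"
  shows "AE \<omega> in M. exit_point K \<omega> \<in> K"
    and "expectation (\<lambda>\<omega>. if exit_point K \<omega> \<in> U then Re (G (exit_point K \<omega>)) else 0) = Re (G 0)"
proof -
  define u where "u z = (if z \<in> U then Re (G z) else 0)" for z
  obtain C B1 B2 where C: "C \<ge> 0" and B1: "\<And>z. z \<in> K \<Longrightarrow> cmod (deriv G z) \<le> B1"
    and B2: "\<And>z. z \<in> K \<Longrightarrow> cmod (deriv (deriv G) z / 2) \<le> B2"
    and taylor: "\<And>z w. z \<in> K \<Longrightarrow> \<bar>u (z + w) - u z - Re (deriv G z * w + deriv (deriv G) z / 2 * w\<^sup>2)\<bar> \<le> C * cmod w ^ 3"
    using Re_holomorphic_taylor_bound[OF U G B K(1,2)] unfolding u_def by blast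
  have Kc: "closed K" and Kb: "K \<in> sets borel" using K(1) by (auto intro: compact_imp_closed borel_closed)
  have Gc: "continuous_on U G" by (rule holomorphic_on_imp_continuous_on[OF G])
  have d1c: "continuous_on K (deriv G)" "continuous_on K (deriv (deriv G))"
    using holomorphic_deriv[OF G U] holomorphic_deriv[OF holomorphic_deriv[OF G U] U] K(2)
    by (auto intro: continuous_on_subset dest: holomorphic_on_imp_continuous_on)
  have um: "u \<in> borel_measurable borel"
    unfolding u_def using U by (intro borel_measurable_continuous_on_if continuous_intros Gc) auto
  define d1 where "d1 z = (if z \<in> K then deriv G z else 0)" for z
  define d2 where "d2 z = (if z \<in> K then deriv (deriv G) z / 2 else 0)" for z
  have dm: "d1 \<in> borel_measurable borel" "d2 \<in> borel_measurable borel"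
    unfolding d1_def d2_def by (intro borel_measurable_continuous_on_if continuous_intros d1c Kb; simp)+
  have db: "cmod (d1 z) \<le> \<bar>B1\<bar>" "cmod (d2 z) \<le> \<bar>B2\<bar>" for z
    using B1[of z] B2[of z] by (auto simp: d1_def d2_def)
  have ub: "\<bar>u z\<bar> \<le> \<bar>B\<bar>" for z
    using B[of z] abs_Re_le_cmod[of "G z"] by (auto simp: u_def)
  define V where "V n \<omega> = frozen_walk K (\<lambda>i. Z (real (Suc i) / 4 ^ n) \<omega> - Z (real i / 4 ^ n) \<omega>) (n * 4 ^ n)" for n \<omega>
  have Vm: "V n \<in> borel_measurable M" for n unfolding V_def by (rule measurable_grid_walk[OF Kb])
  have est: "\<bar>expectation (\<lambda>\<omega>. u (V n \<omega>)) - u 0\<bar> \<le> 16 * C * (real n * (1/2) ^ n)" for n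
  proof -
    \<comment> \<open>Each of the n 4^n steps costs 16 C d^(3/2) = 16 C 8^(-n), in total 16 C n
      2^(-n). A power of 4 makes the square root of the mesh a power of 1/2.\<close>
    define d where "d = 1 / (4::real) ^ n"
    have d: "d > 0" by (simp add: d_def)
    note g = grid_increments[OF d]
    have "\<bar>expectation (\<lambda>\<omega>. u (frozen_walk K (\<lambda>i. Z (real (Suc i) * d) \<omega> - Z (real i * d) \<omega>) (n * 4 ^ n))) - u 0\<bar>
        \<le> real (n * 4 ^ n) * (C * (16 * sqrt d ^ 3))"
      by (rule frozen_walk_almost_martingale[OF g(1) Kb g(2-7) um ub dm(1) db(1) dm(2) db(2) C _ order_refl])
         (use taylor in \<open>simp add: d1_def d2_def\<close>)
    also have "sqrt d = (1/2) ^ n"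
    proof -
      have "d = ((1/2) ^ n)\<^sup>2" by (simp add: d_def power_divide flip: power_mult_distrib power_mult power2_eq_square)
          (simp add: power_mult[symmetric] mult.commute[of n] power_mult)
      then show ?thesis by simp
    qed
    also have "real (n * 4 ^ n) * (C * (16 * ((1/2) ^ n) ^ 3)) = 16 * C * (real n * (4 ^ n * ((1/2) ^ n) ^ 3))"
      by simp
    also have "(4::real) ^ n * ((1/2) ^ n) ^ 3 = (1/2) ^ n"
    proof -
      have "(4::real) ^ n * ((1/2) ^ n) ^ 3 = (4 * (1/2) ^ 3) ^ n"
        by (simp add: power_mult_distrib power_mult[symmetric] mult.commute[of n])
      also have "4 * (1/2) ^ 3 = (1/2 :: real)" by (simp add: eval_nat_numeral)
      finally show ?thesis .
    qed
    finally show ?thesis by (simp add: V_def d_def)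
  qed
  have ae: "AE \<omega> in M. exit_point K \<omega> \<in> K \<and> (\<lambda>n. V n \<omega>) \<longlonglongrightarrow> exit_point K \<omega>"
    using AE_exit_bounded[OF compact_imp_bounded[OF K(1)]] AE_space
  proof eventually_elim
    case (elim \<omega>)
    note t = grid_walk_tendsto[OF Kc elim(2,1)]
    have "continuous_on {0..} (\<lambda>t. Z t \<omega> - Z 0 \<omega>)"
      by (intro continuous_intros continuous_path elim)
    from exit_position_in_frontier(2)[OF this Kc _ elim(1)] K(3) show ?case
      using t by (simp add: V_def)
  qed
  then show "AE \<omega> in M. exit_point K \<omega> \<in> K" by eventually_elim simp
  have "(\<lambda>n. expectation (\<lambda>\<omega>. u (V n \<omega>))) \<longlonglongrightarrow> expectation (\<lambda>\<omega>. u (exit_point K \<omega>))"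
  proof (rule integral_dominated_convergence[where w="\<lambda>_. \<bar>B\<bar>"])
    show "AE \<omega> in M. (\<lambda>n. u (V n \<omega>)) \<longlonglongrightarrow> u (exit_point K \<omega>)"
      using ae
    proof eventually_elim
      case (elim \<omega>)
      then have "exit_point K \<omega> \<in> U" using K(2) by auto
      moreover have "continuous_on U u"
        using Gc by (subst continuous_on_cong[OF refl, of _ _ "\<lambda>z. Re (G z)"]) (auto simp: u_def intro: continuous_intros)
      ultimately have "isCont u (exit_point K \<omega>)" using U by (simp add: continuous_on_eq_continuous_at)
      then show ?case using elim by (intro isCont_tendsto_compose[of _ u]) auto
    qed
  qed (use ub measurable_compose[OF Vm um] measurable_compose[OF measurable_exit_point[OF Kb] um] in auto)
  moreover have "(\<lambda>n. expectation (\<lambda>\<omega>. u (V n \<omega>))) \<longlonglongrightarrow> u 0"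
  proof (rule Lim_transform_bound[where g="\<lambda>n. 16 * C * (real n * (1/2) ^ n)" and f="\<lambda>n. expectation (\<lambda>\<omega>. u (V n \<omega>)) - u 0", THEN Lim_null[THEN iffD2]])
    show "\<forall>\<^sub>F n in sequentially. norm (expectation (\<lambda>\<omega>. u (V n \<omega>)) - u 0) \<le> norm (16 * C * (real n * (1/2) ^ n))"
      using est C by (intro always_eventually allI) (simp add: abs_mult order_trans[OF est])
    have "(\<lambda>n. real n * (1/2) ^ n) \<longlonglongrightarrow> (0::real)"
      using powser_times_n_limit_0[of "1/2::real"] by simp
    then show "(\<lambda>n. 16 * C * (real n * (1/2) ^ n)) \<longlonglongrightarrow> 0" by (rule tendsto_mult_right_zero)
  qed
  ultimately have "expectation (\<lambda>\<omega>. u (exit_point K \<omega>)) = u 0" by (rule LIMSEQ_unique)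
  moreover have "u 0 = Re (G 0)" using K by (auto simp: u_def)
  ultimately show "expectation (\<lambda>\<omega>. if exit_point K \<omega> \<in> U then Re (G (exit_point K \<omega>)) else 0) = Re (G 0)"
    by (simp add: u_def)
qed

section \<open>The exit distribution of the real part\<close>

text \<open>These are the real trigonometric polynomials, presented through a holomorphic polynomial
  so that each comes with its harmonic extension to the disc.\<close>

definition Re_poly_on_circle :: "(complex \<Rightarrow> real) \<Rightarrow> bool" where
  "Re_poly_on_circle f \<longleftrightarrow> (\<exists>p. \<forall>z\<in>sphere 0 1. f z = Re (poly p z))"

lemma Re_poly_on_circle_poly: "Re_poly_on_circle (\<lambda>z. Re (poly p z))"
  unfolding Re_poly_on_circle_def by blast

lemma Re_poly_on_circle_add:
  "Re_poly_on_circle f \<Longrightarrow> Re_poly_on_circle g \<Longrightarrow> Re_poly_on_circle (\<lambda>z. f z + g z)"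
  unfolding Re_poly_on_circle_def by (metis plus_complex.sel(1) poly_add)

lemma Re_poly_on_circle_const: "Re_poly_on_circle (\<lambda>_. c)"
  unfolding Re_poly_on_circle_def by (intro exI[of _ "[:of_real c:]"]) simp

lemma Re_poly_on_circle_sum:
  "finite A \<Longrightarrow> (\<And>i. i \<in> A \<Longrightarrow> Re_poly_on_circle (f i)) \<Longrightarrow> Re_poly_on_circle (\<lambda>z. \<Sum>i\<in>A. f i z)"
  by (induction A rule: finite_induct) (auto intro: Re_poly_on_circle_const Re_poly_on_circle_add)

lemma Re_poly_on_circle_cong:
  "Re_poly_on_circle f \<Longrightarrow> (\<And>z. cmod z = 1 \<Longrightarrow> f z = g z) \<Longrightarrow> Re_poly_on_circle g"
  unfolding Re_poly_on_circle_def by (metis dist_0_norm mem_sphere)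

text \<open>On the circle z conj(z) = 1 cancels the smaller power. If the conjugated power is the
  larger one, conjugating the product leaves the real part unchanged.\<close>

lemma Re_poly_on_circle_monom_cnj:
  "Re_poly_on_circle (\<lambda>z. Re (a * z ^ i * cnj (b * z ^ j)))"
proof -
  have *: "z ^ k * cnj z ^ k = 1" if "cmod z = 1" for z k
    using that by (simp add: power_mult_distrib[symmetric] complex_norm_square[symmetric])
  show ?thesis
  proof (cases "j \<le> i")
    case True
    show ?thesis
    proof (rule Re_poly_on_circle_cong[OF Re_poly_on_circle_poly[of "monom (a * cnj b) (i - j)"]])
      fix z :: complex assume z: "cmod z = 1"
      have "a * z ^ i * cnj (b * z ^ j) = a * cnj b * z ^ (i - j) * (z ^ j * cnj z ^ j)"
        using True by (simp add: power_add[symmetric] mult_ac)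
      then show "Re (poly (monom (a * cnj b) (i - j)) z) = Re (a * z ^ i * cnj (b * z ^ j))"
        by (simp only: *[OF z] poly_monom mult_1_right)
    qed
  next
    case False
    show ?thesis
    proof (rule Re_poly_on_circle_cong[OF Re_poly_on_circle_poly[of "monom (b * cnj a) (j - i)"]])
      fix z :: complex assume z: "cmod z = 1"
      have "cnj (a * z ^ i * cnj (b * z ^ j)) = b * cnj a * z ^ (j - i) * (z ^ i * cnj z ^ i)"
        using False by (simp add: power_add[symmetric] mult_ac)
      then have "Re (cnj (a * z ^ i * cnj (b * z ^ j))) = Re (poly (monom (b * cnj a) (j - i)) z)"
        by (simp only: *[OF z] poly_monom mult_1_right)
      then show "Re (poly (monom (b * cnj a) (j - i)) z) = Re (a * z ^ i * cnj (b * z ^ j))"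
        by (simp only: cnj.sel)
    qed
  qed
qed

text \<open>Re v Re w = Re(v conj(w) + v w) / 2, where only the first product needs reduction on the
  circle.\<close>

lemma Re_poly_on_circle_mult:
  assumes "Re_poly_on_circle f" "Re_poly_on_circle g"
  shows "Re_poly_on_circle (\<lambda>z. f z * g z)"
proof -
  obtain p q where p: "\<And>z. cmod z = 1 \<Longrightarrow> f z = Re (poly p z)" and q: "\<And>z. cmod z = 1 \<Longrightarrow> g z = Re (poly q z)"
    using assms unfolding Re_poly_on_circle_def by auto
  have "Re_poly_on_circle (\<lambda>z. \<Sum>i\<le>degree p. \<Sum>j\<le>degree q. Re (coeff p i * z ^ i * cnj (coeff q j * z ^ j)))"
    by (intro Re_poly_on_circle_sum Re_poly_on_circle_monom_cnj) auto
  then have "Re_poly_on_circle (\<lambda>z. Re (poly p z * cnj (poly q z)))"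
    by (rule Re_poly_on_circle_cong) (simp only: poly_altdef cnj_sum sum_product Re_sum)
  from Re_poly_on_circle_add[OF this Re_poly_on_circle_poly[of "p * q"]]
  have "Re_poly_on_circle (\<lambda>z. Re (poly p z * cnj (poly q z)) + Re (poly (p * q) z))" .
  then obtain r where r: "\<And>z. cmod z = 1 \<Longrightarrow> Re (poly p z * cnj (poly q z)) + Re (poly (p * q) z) = Re (poly r z)"
    unfolding Re_poly_on_circle_def by auto
  show ?thesis
  proof (rule Re_poly_on_circle_cong[OF Re_poly_on_circle_poly[of "smult (1/2) r"]])
    fix z :: complex assume z: "cmod z = 1"
    show "Re (poly (smult (1/2) r) z) = f z * g z"
      using r[OF z] p[OF z] q[OF z] by simp
  qed
qed

text \<open>Stone-Weierstrass: the coordinates Re z and Im z = Re(-i z) belong to the algebra and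
  separate points.\<close>

lemma Re_poly_approx_on_circle:
  assumes "continuous_on (sphere 0 1) \<phi>" "e > 0"
  obtains p where "\<And>z. cmod z = 1 \<Longrightarrow> \<bar>\<phi> z - Re (poly p z)\<bar> < e"
proof -
  have "\<exists>g. Re_poly_on_circle' g \<and> (\<forall>z\<in>sphere 0 1. \<bar>\<phi> z - g z\<bar> < e)"
    if R: "Re_poly_on_circle' = (\<lambda>f. continuous_on (sphere 0 1) f \<and> Re_poly_on_circle f)" for Re_poly_on_circle'
  proof (rule Stone_Weierstrass_HOL[OF _ _ _ _ _ _ assms])
    show "compact (sphere 0 1 :: complex set)" by simp
    show "\<exists>f. Re_poly_on_circle' f \<and> f x \<noteq> f y" if "x \<in> sphere 0 1 \<and> y \<in> sphere 0 1 \<and> x \<noteq> y" for x y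
    proof (cases "Re x = Re y")
      case False
      then show ?thesis unfolding R
        using Re_poly_on_circle_poly[of "[:0, 1:]"] by (intro exI[of _ Re]) (auto intro!: continuous_intros)
    next
      case True
      then have "Im x \<noteq> Im y" using that complex_eq_iff by blast
      then show ?thesis unfolding R
        using Re_poly_on_circle_poly[of "[:0, -\<i>:]"] by (intro exI[of _ Im]) (auto intro!: continuous_intros)
    qed
  qed (auto simp: R intro!: continuous_intros Re_poly_on_circle_const Re_poly_on_circle_add Re_poly_on_circle_mult)
  then obtain g where "Re_poly_on_circle g" "\<forall>z\<in>sphere 0 1. \<bar>\<phi> z - g z\<bar> < e" by blast
  then show thesis unfolding Re_poly_on_circle_def using that by force
qed

lemma circle_mean_poly:
  "(LBINT t:{-pi..pi}. Re (poly p (cis t))) = 2 * pi * Re (poly p 0)"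
proof -
  have "((\<lambda>t. \<Sum>k\<le>degree p. coeff p k * cis (of_int (int k) * t)) has_integral
     (\<Sum>k\<le>degree p. coeff p k * (if int k = 0 then of_real (2 * pi) else 0))) {-pi..pi}"
    by (intro has_integral_sum has_integral_mult_right has_integral_cis) simp
  also have "(\<Sum>k\<le>degree p. coeff p k * (if int k = 0 then of_real (2 * pi) else 0)) =
      (\<Sum>k\<le>degree p. if k = 0 then coeff p 0 * of_real (2 * pi) else 0)"
    by (intro sum.cong) auto
  also have "\<dots> = poly p 0 * of_real (2 * pi)" by (simp add: poly_0_coeff_0)
  also have "(\<lambda>t. \<Sum>k\<le>degree p. coeff p k * cis (of_int (int k) * t)) = (\<lambda>t. poly p (cis t))"
    by (simp add: poly_altdef Complex.DeMoivre fun_eq_iff)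
  finally have "((\<lambda>t. poly p (cis t)) has_integral poly p 0 * of_real (2 * pi)) {-pi..pi}" .
  from has_integral_linear[OF this bounded_linear_Re]
  have "((\<lambda>t. Re (poly p (cis t))) has_integral 2 * pi * Re (poly p 0)) {-pi..pi}"
    by (simp add: o_def mult.commute)
  moreover have "continuous_on {-pi..pi} (\<lambda>t. Re (poly p (cis t)))"
    by (intro continuous_intros)
  then have "set_integrable lborel {-pi..pi} (\<lambda>t. Re (poly p (cis t)))"
    unfolding set_integrable_def by (rule borel_integrable_compact[OF compact_Icc])
  ultimately show ?thesis
    using set_borel_integral_eq_integral(2) integral_unique by metis
qed

text \<open>\<open>distr\<close> of a non-measurable map is the null measure, for which every property holds almost everywhere.\<close>

lemma nondegenerate_distr_measurable:
  fixes X :: "'a \<Rightarrow> real"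
  assumes "prob_space M" and nd: "nondegenerate (distr M borel X)"
  shows "X \<in> borel_measurable M"
proof -
  interpret prob_space M by fact
  let ?D = "distr M borel X"
  let ?m = "\<lambda>A. emeasure M (X -` A \<inter> space M)"
  have em: "emeasure ?D A = (if A \<in> sets borel \<and> measure_space UNIV (sets borel) ?m then ?m A else 0)" for A
    unfolding distr_def by (subst emeasure_measure_of_conv) (simp add: sets.sigma_sets_eq[of borel, simplified])
  have ms: "measure_space UNIV (sets borel) ?m"
  proof (rule ccontr)
    assume "\<not> ?thesis"
    then have "emeasure ?D (space ?D) = 0" by (simp only: em) simp
    then have "space ?D \<in> null_sets ?D" by (auto simp: null_sets_def)
    then have "AE x in ?D. x \<notin> space ?D" by (rule AE_not_in)
    then have "AE x in ?D. x = 0" by eventually_elim simp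
    with nd show False by (auto simp: nondegenerate_def)
  qed
  have em': "emeasure ?D A = ?m A" if "A \<in> sets borel" for A using em ms that by simp
  show ?thesis
  proof (rule measurableI)
    fix A :: "real set" assume A: "A \<in> sets borel"
    show "X -` A \<inter> space M \<in> sets M"
    proof (rule ccontr)
      assume n: "X -` A \<inter> space M \<notin> sets M"
      have "X -` A \<inter> space M = space M - (X -` (-A) \<inter> space M)" by auto
      with n have n': "X -` (-A) \<inter> space M \<notin> sets M" using sets.compl_sets by metis
      \<comment> \<open>If the preimage of A is not measurable, neither is that of its complement.
        Both then have measure 0 by convention, although the total mass is 1.\<close>
      have "emeasure ?D A + emeasure ?D (-A) = emeasure ?D (A \<union> - A)"
        using A by (intro plus_emeasure) auto
      also have "\<dots> = 1" using em'[of UNIV] by (simp add: emeasure_space_1)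
      also have "emeasure ?D A = 0" using A n em' by (simp add: emeasure_notin_sets)
      also have "emeasure ?D (-A) = 0" using A n' em'[of "-A"] by (simp add: emeasure_notin_sets)
      finally show False by simp
    qed
  qed simp
qed

section \<open>Exhaustion of the domain and identification of the exit law\<close>

text \<open>The exit times increase and are bounded by \<tau>. Were the path in U at their limit s,
  late exit positions would lie in the interior of a fixed \<open>K m\<close>, contradicting that
  they avoid the interiors of all later sets; hence s = \<tau>.\<close>

lemma exit_positions_exhaustion:
  fixes x :: "real \<Rightarrow> complex" and K :: "nat \<Rightarrow> complex set"
  assumes x: "continuous_on {0..} x" and x0: "x 0 \<in> K 0"
    and K: "\<And>k. closed (K k)" "\<And>k. K k \<subseteq> interior (K (Suc k))" and U: "U = (\<Union>k. K k)"
    and ex: "\<exists>t\<ge>0. x t \<notin> U"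
  defines "\<sigma> \<equiv> \<lambda>k. Inf {t. 0 \<le> t \<and> x t \<notin> K k}" and "\<tau> \<equiv> Inf {t. 0 \<le> t \<and> x t \<notin> U}"
  shows "(\<lambda>k. x (\<sigma> k)) \<longlonglongrightarrow> x \<tau>" and "0 \<le> \<tau>" and "x \<tau> \<notin> U"
proof -
  have Kmono: "K i \<subseteq> K j" if "i \<le> j" for i j
    using that by (rule lift_Suc_mono_le[rotated]) (use K(2) interior_subset in blast)
  have KU: "K k \<subseteq> U" for k using U by auto
  have exK: "\<exists>t\<ge>0. x t \<notin> K k" for k using ex KU by blast
  have x0K: "x 0 \<in> K k" for k using x0 Kmono[of 0 k] by auto
  have fr: "0 \<le> \<sigma> k" "x (\<sigma> k) \<notin> interior (K k)" for k
    using exit_position_in_frontier[OF x K(1)[of k] x0K[of k] exK[of k]] unfolding \<sigma>_def by auto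
  have bdd: "bdd_below {t. 0 \<le> t \<and> x t \<notin> A}" for A by (auto intro!: bdd_belowI[of _ 0])
  have mono: "\<sigma> i \<le> \<sigma> j" if "i \<le> j" for i j
    unfolding \<sigma>_def using exK[of j] Kmono[OF that] by (intro cInf_superset_mono bdd) auto
  have le: "\<sigma> k \<le> \<tau>" for k
    unfolding \<sigma>_def \<tau>_def using ex KU[of k] by (intro cInf_superset_mono bdd) auto
  obtain s where s: "\<sigma> \<longlonglongrightarrow> s" "\<And>k. \<sigma> k \<le> s"
    using incseq_convergent[of \<sigma> \<tau>] mono le by (metis incseq_def)
  have s0: "s \<ge> 0" using s(2)[of 0] fr(1)[of 0] by simp
  have lim: "(\<lambda>k. x (\<sigma> k)) \<longlonglongrightarrow> x s"
    by (rule continuous_on_tendsto_compose[OF x s(1)]) (use s0 fr(1) in auto)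
  have sU: "x s \<notin> U"
  proof
    assume "x s \<in> U"
    then obtain m where m: "x s \<in> interior (K (Suc m))" using U K(2) by blast
    have "\<forall>\<^sub>F k in sequentially. x (\<sigma> k) \<in> interior (K (Suc m))"
      by (rule topological_tendstoD[OF lim open_interior m])
    then obtain n where n: "\<And>k. k \<ge> n \<Longrightarrow> x (\<sigma> k) \<in> interior (K (Suc m))"
      unfolding eventually_sequentially by blast
    let ?k = "max n (Suc m)"
    have "x (\<sigma> ?k) \<in> interior (K ?k)"
      using n[of ?k] interior_mono[OF Kmono[of "Suc m" ?k]] by auto
    then show False using fr(2)[of ?k] by blast
  qed
  have "\<tau> \<le> s" unfolding \<tau>_def using s0 sU by (intro cInf_lower bdd) auto
  moreover have "s \<le> \<tau>" using s(1) le by (intro LIMSEQ_le_const2) auto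
  ultimately have "s = \<tau>" by simp
  then show "(\<lambda>k. x (\<sigma> k)) \<longlonglongrightarrow> x \<tau>" "0 \<le> \<tau>" "x \<tau> \<notin> U" using lim s0 sU by auto
qed

lemma enn2real_exit_time:
  assumes "0 \<le> \<tau>" "Z \<tau> \<omega> \<notin> U" and \<tau>: "\<tau> = Inf {t. 0 \<le> t \<and> Z t \<omega> \<notin> U}"
  shows "enn2real (exit_time Z U \<omega>) = \<tau>"
proof -
  have "exit_time Z U \<omega> = ennreal \<tau>"
    unfolding exit_time_def
  proof (rule antisym)
    show "(INF t\<in>{t. 0 \<le> t \<and> Z t \<omega> \<notin> U}. ennreal t) \<le> ennreal \<tau>"
      using assms(1,2) by (intro INF_lower) simp
    show "ennreal \<tau> \<le> (INF t\<in>{t. 0 \<le> t \<and> Z t \<omega> \<notin> U}. ennreal t)"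
      unfolding \<tau> by (intro INF_greatest ennreal_leI cInf_lower bdd_belowI[of _ 0]) auto
  qed
  then show ?thesis using assms(1) by simp
qed

lemma eq_of_abs_diff_le_mult:
  fixes a b c :: real
  assumes "\<And>e. e > 0 \<Longrightarrow> \<bar>a - b\<bar> \<le> c * e" "c > 0"
  shows "a = b"
proof (rule ccontr)
  assume "a \<noteq> b"
  then have "\<bar>a - b\<bar> \<le> c * (\<bar>a - b\<bar> / (2 * c))" using assms by (intro assms(1)) simp
  then show False using \<open>a \<noteq> b\<close> assms(2) by (simp add: abs_if split: if_splits)
qed

text \<open>Uniform continuity allows each point near the circle to be compared with its radial
  projection z / |z|.\<close>

lemma uniformly_close_near_circle:
  fixes D :: "complex \<Rightarrow> real"
  assumes D: "continuous_on (cball 0 1) D" and circle: "\<And>z. cmod z = 1 \<Longrightarrow> D z \<le> e" and e: "e > 0"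
  obtains r where "r < 1" "\<And>z. r < cmod z \<Longrightarrow> cmod z \<le> 1 \<Longrightarrow> D z \<le> 2 * e"
proof -
  have "uniformly_continuous_on (cball 0 1) D"
    by (rule compact_uniformly_continuous[OF D compact_cball])
  then obtain d where d: "d > 0" "\<And>z w. cmod z \<le> 1 \<Longrightarrow> cmod w \<le> 1 \<Longrightarrow> dist w z < d \<Longrightarrow> dist (D w) (D z) < e"
    using e unfolding uniformly_continuous_on_def by (metis dist_0_norm mem_cball)
  show thesis
  proof (rule that[of "max (1 - d) 0"])
    show "max (1 - d) 0 < 1" using d(1) by simp
    fix z :: complex assume z: "max (1 - d) 0 < cmod z" "cmod z \<le> 1"
    define w where "w = z / of_real (cmod z)"
    have w: "cmod w = 1" using z by (simp add: w_def norm_divide)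
    have "z - w = w * of_real (cmod z - 1)" using z by (simp add: w_def field_simps)
    then have "dist z w = 1 - cmod z" using w z by (simp add: dist_norm norm_mult del: of_real_diff)
    then have "dist (D z) (D w) < e" using z w by (intro d(2)) auto
    then show "D z \<le> 2 * e" using circle[OF w] by (simp add: dist_real_def)
  qed
qed

text \<open>Splitting characteristic functions into cosine and sine leaves continuous real test
  functions bounded by 1.\<close>

lemma real_distribution_eqI_cos_sin:
  assumes "real_distribution \<mu>" "real_distribution \<nu>"
    and cos: "\<And>s. (LINT x|\<mu>. cos (s * x)) = (LINT x|\<nu>. cos (s * x))"
    and sin: "\<And>s. (LINT x|\<mu>. sin (s * x)) = (LINT x|\<nu>. sin (s * x))"
  shows "\<mu> = \<nu>"
proof (rule Levy_uniqueness[OF assms(1,2)])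
  have parts: "Re (char m s) = (LINT x|m. cos (s * x))" "Im (char m s) = (LINT x|m. sin (s * x))"
    if "real_distribution m" for m :: "real measure" and s
  proof -
    interpret real_distribution m by fact
    have i: "complex_integrable m (\<lambda>x. iexp (s * x))" by (rule integrable_const_bound[where B=1]) auto
    show "Re (char m s) = (LINT x|m. cos (s * x))" "Im (char m s) = (LINT x|m. sin (s * x))"
      unfolding char_def using integral_Re[OF i] integral_Im[OF i] by (simp_all add: Re_exp Im_exp)
  qed
  show "char \<mu> = char \<nu>"
    using parts[OF assms(1)] parts[OF assms(2)] cos sin by (auto simp: fun_eq_iff complex_eq_iff)
qed

text \<open>Only interior exit points enter: on leaving the image of the disc of radius r_k, the
  path is at f(z) with |z| = r_k. There the test function is compared with the harmonic polynomial
  at z, uniformly for r_k near 1 because f extends continuously.\<close>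

lemma (in planar_brownian_motion) exit_Re_distr_eq_circle_distr:
  assumes U: "open U" and f: "univalent_onto f U"
    and sum: "summable (\<lambda>n. (real n)\<^sup>2 * (cmod (taylor_coeff f n))\<^sup>2)"
    and nd: "nondegenerate (exit_Re_distr M Z U)"
  shows "exit_Re_distr M Z U = circle_distr (\<lambda>t. Re (\<Sum>k. taylor_coeff f k * cis (real k * t)))"
proof -
  have fh: "f holomorphic_on ball 0 1" and fi: "inj_on f (ball 0 1)" and fU: "f ` ball 0 1 = U" and f0: "f 0 = 0"
    using f by (auto simp: univalent_onto_def)
  define c where "c = taylor_coeff f"
  define F where "F z = (\<Sum>k. c k * z ^ k)" for z
  define h where "h t = Re (\<Sum>k. c k * cis (real k * t))" for t
  have sc: "summable (\<lambda>k. cmod (c k))" using summable_norm_of_dirichlet sum unfolding c_def by blast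
  have Ff: "F z = f z" if "cmod z < 1" for z
    using holomorphic_power_series[OF fh, of z] that
    by (simp add: F_def c_def taylor_coeff_def sums_iff)
  have term_le: "cmod (c k * z ^ k) \<le> cmod (c k)" if "cmod z \<le> 1" for z k
    using power_le_one[of "cmod z" k] that by (simp add: norm_mult norm_power mult_left_le)
  have Fc: "continuous_on (cball 0 1) F"
  proof (rule uniform_limit_theorem)
    show "uniform_limit (cball 0 1) (\<lambda>n z. \<Sum>k<n. c k * z ^ k) F sequentially"
      unfolding F_def by (rule Weierstrass_m_test[OF _ sc]) (use term_le in simp)
  qed (auto intro!: always_eventually continuous_intros)
  have hF: "h t = Re (F (cis t))" for t by (simp add: h_def F_def Complex.DeMoivre)
  have hc: "continuous_on A h" for A
    unfolding hF by (intro continuous_on_Re continuous_on_compose2[OF Fc]) (auto intro!: continuous_intros)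
  have hb: "h \<in> borel_measurable borel" by (rule borel_measurable_continuous_onI[OF hc])
  have "bounded (F ` cball 0 1)" by (intro compact_imp_bounded compact_continuous_image Fc compact_cball)
  moreover have "U \<subseteq> F ` cball 0 1"
  proof
    fix w assume "w \<in> U"
    then obtain z where "cmod z < 1" "w = f z" using fU by auto
    then show "w \<in> F ` cball 0 1" using Ff[of z] by (intro image_eqI[of _ F z]) auto
  qed
  ultimately have Ub: "bounded U" by (rule bounded_subset)
  obtain g where gh: "g holomorphic_on U" and g: "\<And>z. cmod z < 1 \<Longrightarrow> g (f z) = z"
    using holomorphic_has_inverse[OF fh open_ball fi] fU by (metis mem_ball_0)
  \<comment> \<open>Strictly increasing radii tending to 1; the shift by 2 makes the first radius
    1/2 and thus positive.\<close>
  define r where "r k = 1 - 1 / (real k + 2)" for k :: nat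
  have r: "0 < r k" "r k < 1" for k by (auto simp: r_def field_simps)
  have r_Suc: "r k < r (Suc k)" for k by (simp add: r_def frac_less2)
  have r_lim: "r \<longlonglongrightarrow> 1"
    unfolding r_def by real_asymp
  define K where "K k = f ` cball 0 (r k)" for k
  have sub: "cball 0 (r k) \<subseteq> ball 0 1" "ball 0 (r k) \<subseteq> ball 0 1" for k using r(2)[of k] by auto
  have Kcomp: "compact (K k)" for k
    unfolding K_def using holomorphic_on_imp_continuous_on[OF fh] sub
    by (intro compact_continuous_image compact_cball) (rule continuous_on_subset)
  have KU: "K k \<subseteq> U" for k unfolding K_def using sub fU by blast
  have K0: "0 \<in> K k" for k
    unfolding K_def using r(1)[of k] f0 by (intro image_eqI[of _ f 0]) auto
  have fball: "f ` ball 0 (r k) \<subseteq> interior (K k)" for k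
  proof (rule interior_maximal)
    show "open (f ` ball 0 (r k))"
      using open_mapping_thm3[OF holomorphic_on_subset[OF fh sub(2)] open_ball inj_on_subset[OF fi sub(2)]] .
  qed (auto simp: K_def)
  have Kint: "K k \<subseteq> interior (K (Suc k))" for k
  proof -
    have "K k \<subseteq> f ` ball 0 (r (Suc k))" unfolding K_def using r_Suc[of k] by (intro image_mono) auto
    then show ?thesis using fball by blast
  qed
  have UK: "U = (\<Union>k. K k)"
  proof
    show "U \<subseteq> (\<Union>k. K k)"
    proof
      fix w assume "w \<in> U"
      then obtain z where z: "cmod z < 1" "w = f z" using fU by auto
      have "\<forall>\<^sub>F k in sequentially. cmod z < r k" by (rule order_tendstoD(1)[OF r_lim z(1)])
      then obtain k where "cmod z < r k" by (auto simp: eventually_sequentially)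
      then have "f z \<in> K k" unfolding K_def by (intro imageI) simp
      then show "w \<in> (\<Union>k. K k)" unfolding z(2) by blast
    qed
  qed (use KU in auto)
  define X where "X \<omega> = Re (Z (enn2real (exit_time Z U \<omega>)) \<omega>)" for \<omega>
  have \<mu>: "exit_Re_distr M Z U = distr M borel X" by (simp add: exit_Re_distr_def X_def[abs_def])
  have Xm[measurable]: "X \<in> borel_measurable M"
    by (rule nondegenerate_distr_measurable[OF prob_space_axioms]) (use nd \<mu> in simp)
  have Em: "exit_point (K k) \<in> borel_measurable M" for k
    by (intro measurable_exit_point borel_closed compact_imp_closed Kcomp)
  have ae: "AE \<omega> in M. (\<lambda>k. Re (exit_point (K k) \<omega>)) \<longlonglongrightarrow> X \<omega> \<and>
      (\<forall>k. \<exists>z. cmod z = r k \<and> exit_point (K k) \<omega> = f z)"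
    using AE_exit_bounded[OF Ub] AE_starts_at_0 AE_space
  proof eventually_elim
    case (elim \<omega>)
    let ?x = "\<lambda>t. Z t \<omega> - Z 0 \<omega>"
    have xc: "continuous_on {0..} ?x" by (intro continuous_intros continuous_path elim)
    have x0: "?x 0 \<in> K k" for k using K0 by simp
    have exK: "\<exists>t\<ge>0. ?x t \<notin> K k" for k using elim(1) KU by blast
    have Kcl: "closed (K k)" for k using Kcomp by (rule compact_imp_closed)
    have pt: "exit_point (K k) \<omega> = ?x (Inf {t. 0 \<le> t \<and> ?x t \<notin> K k})" for k
      by (rule grid_walk_tendsto(2)[OF Kcl elim(3) exK])
    define \<tau> where "\<tau> = Inf {t. 0 \<le> t \<and> ?x t \<notin> U}"
    note E = exit_positions_exhaustion[OF xc x0[of 0] Kcl Kint UK elim(1), folded \<tau>_def]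
    have "enn2real (exit_time Z U \<omega>) = \<tau>"
      by (rule enn2real_exit_time) (use E elim(2) in \<open>auto simp: \<tau>_def\<close>)
    then have "X \<omega> = Re (?x \<tau>)" using elim(2) by (simp add: X_def)
    then have "(\<lambda>k. Re (exit_point (K k) \<omega>)) \<longlonglongrightarrow> X \<omega>"
      unfolding pt using tendsto_Re[OF E(1)] by simp
    moreover have "\<exists>z. cmod z = r k \<and> exit_point (K k) \<omega> = f z" for k
    proof -
      have K1: "exit_point (K k) \<omega> \<in> K k" and K2: "exit_point (K k) \<omega> \<notin> interior (K k)"
        unfolding pt using exit_position_in_frontier(2,3)[OF xc Kcl x0 exK] by blast+
      from K1 obtain z where z: "cmod z \<le> r k" "exit_point (K k) \<omega> = f z" unfolding K_def by auto
      have "\<not> cmod z < r k"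
      proof
        assume "cmod z < r k"
        then have "f z \<in> f ` ball 0 (r k)" by auto
        then show False using fball[of k] K2 z(2) by auto
      qed
      then show ?thesis using z by (intro exI[of _ z]) simp
    qed
    ultimately show ?case by blast
  qed
  have test: "expectation (\<lambda>\<omega>. \<psi> (X \<omega>)) = (1 / (2 * pi)) * (LBINT t:{-pi..pi}. \<psi> (h t))"
    if \<psi>: "continuous_on UNIV \<psi>" and \<psi>1: "\<And>x. \<bar>\<psi> x\<bar> \<le> 1" for \<psi> :: "real \<Rightarrow> real"
  proof (rule eq_of_abs_diff_le_mult[where c=3])
    \<comment> \<open>The factor 3 consists of 2e from the comparison at interior exit points and e
      from the comparison on the circle.\<close>
    fix e :: real assume e: "e > 0"
    have \<psi>m[measurable]: "\<psi> \<in> borel_measurable borel" by (rule borel_measurable_continuous_onI[OF \<psi>])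
    have \<psi>F: "continuous_on (cball 0 1) (\<lambda>z. \<psi> (Re (F z)))"
      by (rule continuous_on_compose2[OF \<psi> continuous_on_Re[OF Fc]]) simp
    obtain p where p: "\<And>z. cmod z = 1 \<Longrightarrow> \<bar>\<psi> (Re (F z)) - Re (poly p z)\<bar> < e"
      using Re_poly_approx_on_circle[OF continuous_on_subset[OF \<psi>F sphere_cball] e] by blast
    define D where "D z = \<bar>\<psi> (Re (F z)) - Re (poly p z)\<bar>" for z
    have "continuous_on (cball 0 1) D"
      unfolding D_def by (intro continuous_intros \<psi>F)
    moreover have "D z \<le> e" if "cmod z = 1" for z using p[OF that] by (simp add: D_def)
    ultimately obtain r0 where r0: "r0 < 1" "\<And>z. r0 < cmod z \<Longrightarrow> cmod z \<le> 1 \<Longrightarrow> D z \<le> 2 * e"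
      using uniformly_close_near_circle[of D e] e by blast
    \<comment> \<open>\<open>g\<close> maps U back into the disc, so \<open>G\<close> is bounded by
      the maximum of the polynomial on the closed disc.\<close>
    define G where "G = (\<lambda>w. poly p (g w))"
    have Gh: "G holomorphic_on U" unfolding G_def by (intro holomorphic_intros gh)
    have "bounded (poly p ` cball 0 1)"
      by (intro compact_imp_bounded compact_continuous_image continuous_intros compact_cball)
    then obtain B where "\<forall>y\<in>poly p ` cball 0 1. cmod y \<le> B" unfolding bounded_iff by blast
    then have B: "cmod (poly p z) \<le> B" if "cmod z \<le> 1" for z using that by simp
    have GB: "cmod (G w) \<le> B" if "w \<in> U" for w
    proof -
      have "w \<in> f ` ball 0 1" using that fU by simp
      then obtain z where "cmod z < 1" "w = f z" by auto
      then show ?thesis using g B by (simp add: G_def)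
    qed
    define u where "u w = (if w \<in> U then Re (G w) else 0)" for w
    have um: "u \<in> borel_measurable borel"
      unfolding u_def using U holomorphic_on_imp_continuous_on[OF Gh]
      by (intro borel_measurable_continuous_on_if continuous_intros) auto
    have B0: "B \<ge> 0" using order_trans[OF norm_ge_zero B[of 0]] by simp
    have ub: "\<bar>u w\<bar> \<le> B" for w
      using GB[of w] abs_Re_le_cmod[of "G w"] B0 by (auto simp: u_def)
    have Eu: "expectation (\<lambda>\<omega>. u (exit_point (K k) \<omega>)) = Re (poly p 0)" for k
      using expectation_exit_point(2)[OF U Gh GB Kcomp KU K0] g[of 0] f0 by (simp add: u_def G_def)
    have iu: "integrable M (\<lambda>\<omega>. u (exit_point (K k) \<omega>))" for k
      by (rule integrable_const_bound[where B=B]) (use ub measurable_compose[OF Em um] in auto)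
    have \<psi>E: "(\<lambda>\<omega>. \<psi> (Re (exit_point (K k) \<omega>))) \<in> borel_measurable M" for k
      using Em[of k] by measurable
    have i\<psi>: "integrable M (\<lambda>\<omega>. \<psi> (Re (exit_point (K k) \<omega>)))" for k
      by (rule integrable_const_bound[where B=1]) (use \<psi>1 \<psi>E in auto)
    have "(\<lambda>k. expectation (\<lambda>\<omega>. \<psi> (Re (exit_point (K k) \<omega>)))) \<longlonglongrightarrow> expectation (\<lambda>\<omega>. \<psi> (X \<omega>))"
    proof (rule integral_dominated_convergence[where w="\<lambda>_. 1"])
      show "AE \<omega> in M. (\<lambda>k. \<psi> (Re (exit_point (K k) \<omega>))) \<longlonglongrightarrow> \<psi> (X \<omega>)"
        using ae
      proof eventually_elim
        case (elim \<omega>)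
        have "isCont \<psi> (X \<omega>)" using \<psi> by (simp add: continuous_on_eq_continuous_at)
        then show ?case using elim by (intro isCont_tendsto_compose[of _ \<psi>]) auto
      qed
    qed (use \<psi>1 \<psi>E in auto)
    then have "(\<lambda>k. \<bar>expectation (\<lambda>\<omega>. \<psi> (Re (exit_point (K k) \<omega>))) - Re (poly p 0)\<bar>) \<longlonglongrightarrow>
        \<bar>expectation (\<lambda>\<omega>. \<psi> (X \<omega>)) - Re (poly p 0)\<bar>"
      by (intro tendsto_intros)
    moreover have "\<exists>n. \<forall>k\<ge>n. \<bar>expectation (\<lambda>\<omega>. \<psi> (Re (exit_point (K k) \<omega>))) - Re (poly p 0)\<bar> \<le> 2 * e"
    proof -
      obtain n where n: "\<And>k. k \<ge> n \<Longrightarrow> r0 < r k"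
        using order_tendstoD(1)[OF r_lim r0(1)] unfolding eventually_sequentially by blast
      have "\<bar>expectation (\<lambda>\<omega>. \<psi> (Re (exit_point (K k) \<omega>))) - Re (poly p 0)\<bar> \<le> 2 * e" if k: "k \<ge> n" for k
      proof -
        have "AE \<omega> in M. \<bar>\<psi> (Re (exit_point (K k) \<omega>)) - u (exit_point (K k) \<omega>)\<bar> \<le> 2 * e"
          using ae
        proof eventually_elim
          case (elim \<omega>)
          then obtain z where z: "cmod z = r k" "exit_point (K k) \<omega> = f z" by blast
          then have z1: "cmod z < 1" using r by simp
          then have "f z \<in> U" using fU by auto
          then have "u (f z) = Re (poly p z)" using g[OF z1] by (simp add: u_def G_def)
          then show ?case using r0(2)[of z] n[OF k] z z1 Ff[OF z1] by (simp add: D_def)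
        qed
        then have "expectation (\<lambda>\<omega>. \<bar>\<psi> (Re (exit_point (K k) \<omega>)) - u (exit_point (K k) \<omega>)\<bar>) \<le> expectation (\<lambda>_. 2 * e)"
          by (intro integral_mono_AE integrable_abs Bochner_Integration.integrable_diff i\<psi> iu integrable_const) auto
        moreover have "\<bar>expectation (\<lambda>\<omega>. \<psi> (Re (exit_point (K k) \<omega>)) - u (exit_point (K k) \<omega>))\<bar> \<le>
            expectation (\<lambda>\<omega>. \<bar>\<psi> (Re (exit_point (K k) \<omega>)) - u (exit_point (K k) \<omega>)\<bar>)"
          by (rule integral_abs_bound)
        moreover have "expectation (\<lambda>\<omega>. \<psi> (Re (exit_point (K k) \<omega>)) - u (exit_point (K k) \<omega>)) =
            expectation (\<lambda>\<omega>. \<psi> (Re (exit_point (K k) \<omega>))) - Re (poly p 0)"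
          using Eu by (subst Bochner_Integration.integral_diff[OF i\<psi> iu]) simp
        ultimately show ?thesis by (simp add: prob_space)
      qed
      then show ?thesis by blast
    qed
    ultimately have 1: "\<bar>expectation (\<lambda>\<omega>. \<psi> (X \<omega>)) - Re (poly p 0)\<bar> \<le> 2 * e"
      by (rule LIMSEQ_le_const2)
    have ci: "set_integrable lborel {-pi..pi} q" if "continuous_on {-pi..pi} q" for q :: "real \<Rightarrow> real"
      unfolding set_integrable_def by (rule borel_integrable_compact[OF compact_Icc that])
    have i1: "set_integrable lborel {-pi..pi} (\<lambda>t. \<psi> (h t))"
      by (intro ci continuous_on_compose2[OF \<psi> hc]) simp
    have i2: "set_integrable lborel {-pi..pi} (\<lambda>t. Re (poly p (cis t)))"
      by (intro ci continuous_intros)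
    have "\<bar>(LBINT t:{-pi..pi}. \<psi> (h t)) - 2 * pi * Re (poly p 0)\<bar> = \<bar>LBINT t:{-pi..pi}. \<psi> (h t) - Re (poly p (cis t))\<bar>"
      using set_integral_diff(2)[OF i1 i2] circle_mean_poly[of p] by simp
    also have "\<dots> \<le> (LBINT t:{-pi..pi}. e)"
      unfolding set_lebesgue_integral_def
    proof (rule integral_abs_bound_integral)
      show "integrable lborel (\<lambda>t. indicator {-pi..pi} t *\<^sub>R (\<psi> (h t) - Re (poly p (cis t))))"
        using set_integral_diff(1)[OF i1 i2] by (simp add: set_integrable_def)
      show "integrable lborel (\<lambda>t. indicator {-pi..pi} t *\<^sub>R e)" by simp
      show "\<bar>indicator {-pi..pi} t *\<^sub>R (\<psi> (h t) - Re (poly p (cis t)))\<bar> \<le> indicator {-pi..pi} t *\<^sub>R e" for t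
        using p[of "cis t"] by (simp add: indicator_def hF less_imp_le)
    qed
    also have "\<dots> = 2 * pi * e" by (simp add: set_lebesgue_integral_def)
    finally have "\<bar>(LBINT t:{-pi..pi}. \<psi> (h t)) - 2 * pi * Re (poly p 0)\<bar> \<le> 2 * pi * e" .
    moreover have "(1 / (2 * pi)) * (LBINT t:{-pi..pi}. \<psi> (h t)) - Re (poly p 0) =
        ((LBINT t:{-pi..pi}. \<psi> (h t)) - 2 * pi * Re (poly p 0)) / (2 * pi)"
      by (simp add: diff_divide_distrib)
    ultimately have "\<bar>(1 / (2 * pi)) * (LBINT t:{-pi..pi}. \<psi> (h t)) - Re (poly p 0)\<bar> \<le> e"
      by (simp only: abs_divide) (simp add: divide_le_eq mult.commute)
    then show "\<bar>expectation (\<lambda>\<omega>. \<psi> (X \<omega>)) - (1 / (2 * pi)) * (LBINT t:{-pi..pi}. \<psi> (h t))\<bar> \<le> 3 * e"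
      using 1 by linarith
  qed simp
  have eq: "(LINT x|distr M borel X. \<psi> x) = (LINT x|circle_distr h. \<psi> x)"
    if \<psi>: "continuous_on UNIV \<psi>" and \<psi>1: "\<And>x. \<bar>\<psi> x\<bar> \<le> 1" for \<psi> :: "real \<Rightarrow> real"
  proof -
    have \<psi>m: "\<psi> \<in> borel_measurable borel" by (rule borel_measurable_continuous_onI[OF \<psi>])
    then show ?thesis using test[OF that] by (simp add: integral_distr[OF Xm] integral_circle_distr[OF hb])
  qed
  have "distr M borel X = circle_distr h"
    by (rule real_distribution_eqI_cos_sin[OF real_distribution_distr[OF Xm] real_distribution_circle_distr[OF hb]])
       (rule eq; auto intro!: continuous_intros)+
  then show ?thesis unfolding \<mu> h_def[abs_def] c_def .
qed

theorem theorem5: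
  fixes U :: "complex set" and M :: "'a measure" and Z :: "real \<Rightarrow> 'a \<Rightarrow> complex" and p :: real
  assumes "open U" and "simply_connected U" and "0 \<in> U" and "U \<noteq> UNIV"
    and "planar_brownian_motion M Z"
    and "nondegenerate (exit_Re_distr M Z U)"
    and "p > 1" and "integrable (exit_Re_distr M Z U) (\<lambda>x. \<bar>x\<bar> powr p)"
    and "(LINT x|exit_Re_distr M Z U. x) = 0"
  shows "skorokhod_energy (gross_domain (exit_Re_distr M Z U)) \<le> skorokhod_energy U"
proof -
  interpret planar_brownian_motion M Z by fact
  obtain f where f: "univalent_onto f U"
    using univalent_onto_exists assms(1-4) by blast
  define c where "c = taylor_coeff f"
  have E: "skorokhod_energy U = (\<Sum>n. ennreal ((real n)\<^sup>2 * (cmod (c n))\<^sup>2)) / 4"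
    using skorokhod_energy_eq[OF f] by (simp add: coeff_energy_def c_def)
  show ?thesis
  proof (cases "summable (\<lambda>n. (real n)\<^sup>2 * (cmod (c n))\<^sup>2)")
    \<comment> \<open>Divergence of the nonnegative series means that the right-hand side is
      infinite.\<close>
    case False
    have "(\<Sum>n. ennreal ((real n)\<^sup>2 * (cmod (c n))\<^sup>2)) = top"
    proof (rule ccontr)
      assume "\<not> ?thesis"
      then have "summable (\<lambda>n. (real n)\<^sup>2 * (cmod (c n))\<^sup>2)"
        by (intro summable_suminf_not_top) simp_all
      with False show False ..
    qed
    then have "skorokhod_energy U = top" unfolding E by (simp add: ennreal_top_divide)
    then show ?thesis by simp
  next
    case True
    define h where "h = (\<lambda>t. Re (\<Sum>k. c k * cis (real k * t)))"
    have sc: "summable (\<lambda>k. cmod (c k))" by (rule summable_norm_of_dirichlet[OF True])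
    have eq: "exit_Re_distr M Z U = circle_distr h"
      using exit_Re_distr_eq_circle_distr[OF assms(1) f True[unfolded c_def] assms(6)]
      unfolding h_def c_def .
    have fh: "f holomorphic_on ball 0 1" and fi: "inj_on f (ball 0 1)" and f0: "f 0 = 0"
      using f by (auto simp: univalent_onto_def)
    have c0: "c 0 = 0" by (simp add: c_def taylor_coeff_def f0)
    \<comment> \<open>An injective holomorphic map has no critical point; this nonzero coefficient
      is what the count of level points rests on.\<close>
    have c1: "c 1 \<noteq> 0"
      using holomorphic_injective_imp_regular[OF fh open_ball fi, of 0] by (simp add: c_def taylor_coeff_def)
    note bd = bounded_real_distribution_cis_series[OF sc, folded h_def]
    have "skorokhod_energy (gross_domain (circle_distr h)) = (\<Sum>n. ennreal ((real n)\<^sup>2 * (gross_coeff (circle_distr h) n)\<^sup>2)) / 4"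
      by (rule bounded_real_distribution.skorokhod_energy_gross_domain[OF bd assms(6)[unfolded eq]])
    also have "\<dots> \<le> (\<Sum>n. ennreal ((real n)\<^sup>2 * (cmod (c n))\<^sup>2)) / 4"
      using polya_szego_series[of c, OF c1 c0 True] unfolding h_def by (rule divide_right_mono_ennreal)
    finally show ?thesis unfolding E eq .
  qed
qed

end
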